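(* Let $q>0$ and consider the map $T_{q\log}:\mathbb{T}\to\mathbb{T}$ of the circle $\mathbb{T}=\mathbb{R}/\mathbb{Z}$ (parametrized by $[0,1)$) defined by $T_{q\log}(0)=0$, $T_{q\log}(x)=\big(1+(1-\log 2x)^{-q}\big)x$ for $x\in(0,\frac12]$, and $T_{q\log}(x)=2x-1$ for $x\in[\frac12,1)$ (values modulo $1$). For any $\alpha\in(0,1)$ and any $A\in V:=\mathcal{C}^{\alpha+q\log}(\mathbb{T})$, the transfer operator $\mathscr{L}_{T_{q\log},A}$ acting on $\mathcal{C}^\alpha(\mathbb{T})$ satisfies a Ruelle–Perron–Frobenius theorem with a spectral gap. (In particular, as soon as $A$ is Hölder of any exponent, the RPF measure $\mu_A$ enjoys exponential decay of correlations for all Hölder observables.)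
   Context: Function spaces: a modulus of continuity is a continuous, increasing, concave function $\omega:[0,+\infty)\to[0,+\infty)$ with $\omega(0)=0$. On a compact metric space $(\Omega,d)$, $\mathcal{C}^\omega(\Omega)$ is the Banach space of functions $f:\Omega\to\mathbb{R}$ such that $|f(x)-f(y)|\le C\omega(d(x,y))$ for some $C$ (least such $C$ denoted $\mathrm{Hol}_\omega(f)$), with norm $\|f\|_\infty+\mathrm{Hol}_\omega(f)$. $\mathcal{C}^\alpha$ corresponds to $\omega(r)=r^\alpha$ ($\mathcal{C}^1$ meaning Lipschitz). For $\alpha\in(0,1)$ and $\beta\in\mathbb{R}$, $\mathcal{C}^{\alpha+\beta\log}$ corresponds to a modulus $\omega_{\alpha+\beta\log}$ equal to $r^\alpha/(\log\frac{r_0}{r})^\beta$ for $r\in(0,1]$, where $r_0$ is a constant large enough to make this increasing and concave on $[0,1]$ (other choices with the same germ behaviour at $0$ give equivalent norms). Transfer operator: $\mathscr{L}_{T,A}f(x)=\sum_{T(y)=x}e^{A(y)}f(y)$. An operator $\mathscr{L}=\mathscr{L}_{T,A}$ acting continuously on a Banach space $\mathcal{X}$ of functions satisfies a Ruelle–Perron–Frobenius (RPF) theorem on $\mathcal{X}$ if there exist a positive function $h\in\mathcal{X}$, a constant $\rho>0$ and a nonzero positive finite measure $\nu$ such that $\mathscr{L}h=\rho h$ and $\mathscr{L}^*\nu=\rho\nu$ (i.e. $\int\mathscr{L}f\,d\nu=\rho\int f\,d\nu$ for all $f\in\mathcal{X}$). The RPF measure is the probability measure $\mu_A$ with $d\mu_A=h\,d\nu$,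 $h$ suitably scaled. The operator has a spectral gap if moreover there are $C\ge1$, $\delta\in(0,1)$ such that for all $t\in\mathbb{N}$ and all $f\in\mathcal{X}$ with $\nu(f)=0$, $\|\mathscr{L}^tf\|\le C\rho^t(1-\delta)^t\|f\|$. Exponential decay of correlations for all Hölder observables: for every $a\in(0,1]$ there are $C>0$, $\delta\in(0,1)$ such that for all $f\in\mathcal{C}^a(\mathbb{T})$, $g\in L^1(\mu_A)$, $t\in\mathbb{N}$: $\left|\int f\cdot g\circ T^t\,d\mu_A-\int f\,d\mu_A\int g\,d\mu_A\right|\le C(1-\delta)^t\,\mathrm{Hol}_a(f)\,\|g\|_{L^1(\mu_A)}$. *)

theory Defs
  imports "HOL-Probability.Probability"
begin

section \<open>The circle as a metric space\<close>

quotient_type circle = real / "\<lambda>x y :: real. x - y \<in> \<int>"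
proof (rule equivpI)
  show "reflp (\<lambda>x y :: real. x - y \<in> \<int>)"
    by (simp add: reflp_def)
  show "symp (\<lambda>x y :: real. x - y \<in> \<int>)"
    by (rule sympI) (use Ints_minus in fastforce)
  show "transp (\<lambda>x y :: real. x - y \<in> \<int>)"
  proof (rule transpI)
    fix x y z :: real
    assume "x - y \<in> \<int>" "y - z \<in> \<int>"
    then have "(x - y) + (y - z) \<in> \<int>" by (rule Ints_add)
    then show "x - z \<in> \<int>" by simp
  qed
qed

lift_definition circle_coord :: "circle \<Rightarrow> real" is frac
proof -
  fix x y :: real
  assume "x - y \<in> \<int>"
  then obtain n where "x - y = of_int n" by (elim Ints_cases)
  then have "x = y + of_int n" by simp
  then show "frac x = frac y" by (simp add: frac_def)
qed

instantiation circle :: metric_space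
begin

text \<open>The quotient metric: distance of \<open>x - y\<close> to the nearest integer.\<close>

lift_definition dist_circle :: "circle \<Rightarrow> circle \<Rightarrow> real"
  is "\<lambda>x y. \<bar>(x - y) - of_int (round (x - y))\<bar>"
proof -
  fix x x' y y' :: real
  assume "x - x' \<in> \<int>" "y - y' \<in> \<int>"
  then obtain m n where "x - x' = of_int m" "y - y' = of_int n" by (metis Ints_cases)
  then have e: "x - y = (x' - y') + of_int (m - n)" by simp
  have "round (x - y) = round (x' - y') + (m - n)"
  proof -
    have "\<lfloor>(x' - y') + of_int (m - n) + 1/2\<rfloor> = \<lfloor>((x' - y') + 1/2) + of_int (m - n)\<rfloor>"
      by (simp only: ac_simps)
    then show ?thesis unfolding e round_def by (simp only: floor_add_int)
  qed
  with e show "\<bar>(x - y) - of_int (round (x - y))\<bar> = \<bar>(x' - y') - of_int (round (x' - y'))\<bar>"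
    by simp
qed

definition uniformity_circle :: "(circle \<times> circle) filter"
  where "uniformity_circle = (INF e\<in>{0<..}. principal {(x, y). dist x y < e})"

definition open_circle :: "circle set \<Rightarrow> bool"
  where "open_circle U = (\<forall>x\<in>U. eventually (\<lambda>(x', y). x' = x \<longrightarrow> y \<in> U) uniformity)"

instance
proof
  fix x y z :: circle
  show "dist x y = 0 \<longleftrightarrow> x = y"
  proof transfer
    fix x y :: real
    show "\<bar>(x - y) - of_int (round (x - y))\<bar> = 0 \<longleftrightarrow> x - y \<in> \<int>"
    proof
      assume "\<bar>(x - y) - of_int (round (x - y))\<bar> = 0"
      then have "x - y = of_int (round (x - y))" by linarith
      then show "x - y \<in> \<int>" by (metis Ints_of_int)
    next
      assume "x - y \<in> \<int>"
      then obtain n where "x - y = of_int n" by (elim Ints_cases)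
      then show "\<bar>(x - y) - of_int (round (x - y))\<bar> = 0" by simp
    qed
  qed
  show "dist x y \<le> dist x z + dist y z"
  proof transfer
    fix x y z :: real
    let ?m = "round (x - z)" and ?n = "round (y - z)"
    have "\<bar>(x - y) - of_int (round (x - y))\<bar> \<le> \<bar>(x - y) - of_int (?m - ?n)\<bar>"
      by (rule round_diff_minimal)
    also have "\<dots> \<le> \<bar>(x - z) - of_int ?m\<bar> + \<bar>(y - z) - of_int ?n\<bar>"
      unfolding of_int_diff by linarith
    finally show "\<bar>(x - y) - of_int (round (x - y))\<bar>
      \<le> \<bar>(x - z) - of_int ?m\<bar> + \<bar>(y - z) - of_int ?n\<bar>" .
  qed
qed (rule uniformity_circle_def open_circle_def)+

end


section \<open>Spaces of functions with a given modulus of continuity\<close>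

definition is_modulus :: "(real \<Rightarrow> real) \<Rightarrow> bool" where
  "is_modulus \<omega> \<longleftrightarrow>
     continuous_on {0..} \<omega> \<and> mono_on {0..} \<omega> \<and> concave_on {0..} \<omega> \<and> \<omega> 0 = 0"

definition modulus_space :: "(real \<Rightarrow> real) \<Rightarrow> ('a::metric_space \<Rightarrow> real) set" where
  "modulus_space \<omega> = {f. \<exists>C. \<forall>x y. \<bar>f x - f y\<bar> \<le> C * \<omega> (dist x y)}"

definition Hol_const :: "(real \<Rightarrow> real) \<Rightarrow> ('a::metric_space \<Rightarrow> real) \<Rightarrow> real" where
  "Hol_const \<omega> f = Inf {C. 0 \<le> C \<and> (\<forall>x y. \<bar>f x - f y\<bar> \<le> C * \<omega> (dist x y))}"

definition modulus_norm :: "(real \<Rightarrow> real) \<Rightarrow> ('a::metric_space \<Rightarrow> real) \<Rightarrow> real" where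
  "modulus_norm \<omega> f = (SUP x. \<bar>f x\<bar>) + Hol_const \<omega> f"

definition power_modulus :: "real \<Rightarrow> real \<Rightarrow> real" where
  "power_modulus \<alpha> r = r powr \<alpha>"

abbreviation Holder_space :: "real \<Rightarrow> ('a::metric_space \<Rightarrow> real) set" where
  "Holder_space \<alpha> \<equiv> modulus_space (power_modulus \<alpha>)"

abbreviation Holder_norm :: "real \<Rightarrow> ('a::metric_space \<Rightarrow> real) \<Rightarrow> real" where
  "Holder_norm \<alpha> \<equiv> modulus_norm (power_modulus \<alpha>)"

definition is_log_modulus :: "real \<Rightarrow> real \<Rightarrow> (real \<Rightarrow> real) \<Rightarrow> bool" where
  "is_log_modulus \<alpha> \<beta> \<omega> \<longleftrightarrow> is_modulus \<omega> \<and>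
     (\<exists>r\<^sub>0>1. \<forall>r\<in>{0<..1}. \<omega> r = r powr \<alpha> / (ln (r\<^sub>0 / r)) powr \<beta>)"

text \<open>
  On a space of diameter at most 1 such as the circle, any two choices of the constant
  \<open>r\<^sub>0\<close> and of the extension of the modulus to \<open>r > 1\<close> yield the same space,
  so the existential quantifier below only expresses independence of the choice.
\<close>

definition log_Holder_space :: "real \<Rightarrow> real \<Rightarrow> ('a::metric_space \<Rightarrow> real) set" where
  "log_Holder_space \<alpha> \<beta> = (\<Union>\<omega>\<in>{\<omega>. is_log_modulus \<alpha> \<beta> \<omega>}. modulus_space \<omega>)"


section \<open>Transfer operators and the Ruelle--Perron--Frobenius property\<close>

text \<open>The finite sum is the intended one only for maps with finite fibres.\<close>

definition transfer_op ::
  "('a \<Rightarrow> 'a) \<Rightarrow> ('a \<Rightarrow> real) \<Rightarrow> ('a \<Rightarrow> real) \<Rightarrow> 'a \<Rightarrow> real" where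
  "transfer_op T A f x = (\<Sum>y\<in>{y. T y = x}. exp (A y) * f y)"

text \<open>
  A Banach space of functions is given by its carrier \<open>X\<close> and its norm \<open>N\<close>.
  For the linear operators considered here, continuity is boundedness.
\<close>

definition acts_continuously ::
  "('a \<Rightarrow> real) set \<Rightarrow> (('a \<Rightarrow> real) \<Rightarrow> real) \<Rightarrow> (('a \<Rightarrow> real) \<Rightarrow> 'a \<Rightarrow> real) \<Rightarrow> bool" where
  "acts_continuously X N L \<longleftrightarrow> (\<forall>f\<in>X. L f \<in> X) \<and> (\<exists>K. \<forall>f\<in>X. N (L f) \<le> K * N f)"

definition RPF_triple ::
  "('a::topological_space \<Rightarrow> real) set \<Rightarrow> (('a \<Rightarrow> real) \<Rightarrow> 'a \<Rightarrow> real) \<Rightarrow>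
   ('a \<Rightarrow> real) \<Rightarrow> real \<Rightarrow> 'a measure \<Rightarrow> bool" where
  "RPF_triple X L h \<rho> \<nu> \<longleftrightarrow>
     h \<in> X \<and> (\<forall>x. 0 < h x) \<and> 0 < \<rho> \<and>
     finite_measure \<nu> \<and> sets \<nu> = sets borel \<and> emeasure \<nu> (space \<nu>) \<noteq> 0 \<and>
     (\<forall>x. L h x = \<rho> * h x) \<and>
     (\<forall>f\<in>X. (\<integral>x. L f x \<partial>\<nu>) = \<rho> * (\<integral>x. f x \<partial>\<nu>))"

definition RPF_with_spectral_gap ::
  "('a::topological_space \<Rightarrow> real) set \<Rightarrow> (('a \<Rightarrow> real) \<Rightarrow> real) \<Rightarrow>
   (('a \<Rightarrow> real) \<Rightarrow> 'a \<Rightarrow> real) \<Rightarrow> bool" where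
  "RPF_with_spectral_gap X N L \<longleftrightarrow>
     acts_continuously X N L \<and>
     (\<exists>h \<rho> \<nu>. RPF_triple X L h \<rho> \<nu> \<and>
        (\<exists>C\<ge>1. \<exists>\<delta>\<in>{0<..<1}. \<forall>t::nat. \<forall>f\<in>X. (\<integral>x. f x \<partial>\<nu>) = 0 \<longrightarrow>
           N ((L ^^ t) f) \<le> C * \<rho> ^ t * (1 - \<delta>) ^ t * N f))"

definition RPF_measure ::
  "('a::topological_space \<Rightarrow> real) set \<Rightarrow> (('a \<Rightarrow> real) \<Rightarrow> 'a \<Rightarrow> real) \<Rightarrow> 'a measure \<Rightarrow> bool" where
  "RPF_measure X L \<mu> \<longleftrightarrow>
     (\<exists>h \<rho> \<nu>. RPF_triple X L h \<rho> \<nu> \<and> \<mu> = density \<nu> (\<lambda>x. ennreal (h x)) \<and> prob_space \<mu>)"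

definition exp_decay_of_correlations ::
  "('a::metric_space \<Rightarrow> 'a) \<Rightarrow> 'a measure \<Rightarrow> bool" where
  "exp_decay_of_correlations T \<mu> \<longleftrightarrow>
     (\<forall>a\<in>{0<..1}. \<exists>C>0. \<exists>\<delta>\<in>{0<..<1}.
        \<forall>f\<in>Holder_space a. \<forall>g. integrable \<mu> g \<longrightarrow> (\<forall>t::nat.
          \<bar>(\<integral>x. f x * g ((T ^^ t) x) \<partial>\<mu>) - (\<integral>x. f x \<partial>\<mu>) * (\<integral>x. g x \<partial>\<mu>)\<bar>
            \<le> C * (1 - \<delta>) ^ t * Hol_const (power_modulus a) f * (\<integral>x. \<bar>g x\<bar> \<partial>\<mu>)))"


section \<open>The intermittent circle map\<close>

definition T_qlog :: "real \<Rightarrow> circle \<Rightarrow> circle" where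
  "T_qlog q z = (let x = circle_coord z in abs_circle (
     if x = 0 then 0
     else if x \<le> 1/2 then (1 + (1 - ln (2 * x)) powr (-q)) * x
     else 2 * x - 1))"

end

theory Submission
  imports Defs
begin

text \<open>
  If \<open>d(x, x')\<close> is the distance of two points and \<open>s\<close> the distance of a suitable
  pair of preimages, then \<open>d(x, x') \<ge> s (1 + (1 - ln s)\<^sup>-\<^sup>q / 2)\<close>, so that
  \<open>s\<^sup>\<alpha> (1 - ln s)\<^sup>-\<^sup>q\<close> is at most a constant times \<open>d(x, x')\<^sup>\<alpha> - s\<^sup>\<alpha>\<close>:
  the variation of the potential along paired inverse branches is paid for by the loss of distance.
  The other pair of preimages is contracted by a factor 2. Consequently the transfer operator maps
  the cone of functions \<open>f \<ge> 0\<close> with \<open>f x \<le> exp (b d(x, x')\<^sup>\<alpha>) f x'\<close> into the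
  same cone with a smaller constant, hence contracts it strictly. This yields the eigenfunction and
  geometric convergence of the normalised iterates; the eigenmeasure is a weak limit of the
  normalised sums over the preimages of one point. Decay of correlations for exponents below
  \<open>\<alpha>\<close> follows by running the same argument in the larger space, where the eigenmeasure
  is the same up to a factor because finite measures are determined by Lipschitz functions.
\<close>

section \<open>Hoelder functions and cones of log-Hoelder functions\<close>

text \<open>On that pair the cone exponent is merely preserved. The strict gain comes from
  averaging: the other pair is contracted, and its share of the sum is bounded below because
  \<open>A\<close> is bounded and cone functions oscillate by a bounded factor. How preimages are
  paired depends on the position of the two points. If the short arc between them crosses 0, its
  preimage arcs join points of different branches, and the arc around 0 expands at the logarithmic
  rate only on its left-branch side; halving the logarithmic weight covers this case. Contraction is
  expressed by order relations between multiples of two iterates, normalised at a base point, rather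
  than by a projective metric. The convergence so obtained yields a coefficient functional on
  Hoelder functions only; compactness of probability measures represents it by an integral.\<close>

lemma transfer_op_add: "transfer_op T A (\<lambda>x. f x + g x) x = transfer_op T A f x + transfer_op T A g x"
  by (simp add: transfer_op_def sum.distrib distrib_left)

lemma transfer_op_scale: "transfer_op T A (\<lambda>x. c * f x) x = c * transfer_op T A f x"
  by (simp add: transfer_op_def sum_distrib_left mult.left_commute)

lemma transfer_op_diff: "transfer_op T A (\<lambda>x. f x - g x) x = transfer_op T A f x - transfer_op T A g x"
  by (simp add: transfer_op_def sum_subtractf right_diff_distrib)

lemma transfer_op_pow_diff:
  "(transfer_op T A ^^ n) (\<lambda>x. f x - g x) x = (transfer_op T A ^^ n) f x - (transfer_op T A ^^ n) g x"
proof (induction n arbitrary: x)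
  case (Suc n)
  then have "(transfer_op T A ^^ n) (\<lambda>x. f x - g x)
      = (\<lambda>x. (transfer_op T A ^^ n) f x - (transfer_op T A ^^ n) g x)" by blast
  then show ?case by (simp add: transfer_op_diff)
qed simp

text \<open>A Hoelder bound with constant \<open>b\<close> for the logarithm of \<open>f\<close>,
  written multiplicatively: this admits the zero function and makes the condition stable under
  nonnegative multiples and pointwise limits.\<close>

definition holder_cone :: "real \<Rightarrow> real \<Rightarrow> ('a::metric_space \<Rightarrow> real) set" where
  "holder_cone \<alpha> b = {f. \<forall>x y. 0 \<le> f x \<and> f x \<le> exp (b * dist x y powr \<alpha>) * f y}"

text \<open>One number for both the supremum and the Hoelder quotient. On the circle the least such
  number equals \<open>Holder_norm\<close> up to a factor 2, and estimates with it involve neither a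
  supremum nor an infimum.\<close>

definition holder_bound :: "real \<Rightarrow> ('a::metric_space \<Rightarrow> real) \<Rightarrow> real \<Rightarrow> bool" where
  "holder_bound \<alpha> f N \<longleftrightarrow> (\<forall>x. \<bar>f x\<bar> \<le> N) \<and> (\<forall>x y. \<bar>f x - f y\<bar> \<le> N * dist x y powr \<alpha>)"

lemma holder_boundI:
  assumes "\<And>x. \<bar>f x\<bar> \<le> N" "\<And>x y. f x - f y \<le> N * dist x y powr \<alpha>"
  shows "holder_bound \<alpha> f N"
  unfolding holder_bound_def
proof (intro conjI allI)
  fix x y
  show "\<bar>f x - f y\<bar> \<le> N * dist x y powr \<alpha>"
    using assms(2)[of x y] assms(2)[of y x] by (simp add: dist_commute abs_le_iff)
qed (fact assms(1))

lemma holder_boundD: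
  assumes "holder_bound \<alpha> f N"
  shows "\<bar>f x\<bar> \<le> N" "\<bar>f x - f y\<bar> \<le> N * dist x y powr \<alpha>" "0 \<le> N"
  using assms unfolding holder_bound_def by (auto intro: order_trans[OF abs_ge_zero])

lemma holder_bound_mono: "holder_bound \<alpha> f N \<Longrightarrow> N \<le> M \<Longrightarrow> holder_bound \<alpha> f M"
  unfolding holder_bound_def by (meson mult_right_mono order_trans powr_ge_zero)

lemma holder_bound_add:
  assumes "holder_bound \<alpha> f N" "holder_bound \<alpha> g M"
  shows "holder_bound \<alpha> (\<lambda>x. f x + g x) (N + M)"
proof (rule holder_boundI)
  show "\<bar>f x + g x\<bar> \<le> N + M" for x
    using holder_boundD(1)[OF assms(1), of x] holder_boundD(1)[OF assms(2), of x] by linarith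
  show "f x + g x - (f y + g y) \<le> (N + M) * dist x y powr \<alpha>" for x y
    using holder_boundD(2)[OF assms(1), of x y] holder_boundD(2)[OF assms(2), of x y]
    unfolding distrib_right by linarith
qed

lemma holder_bound_scale:
  assumes "holder_bound \<alpha> f N"
  shows "holder_bound \<alpha> (\<lambda>x. c * f x) (\<bar>c\<bar> * N)"
proof (rule holder_boundI)
  show "\<bar>c * f x\<bar> \<le> \<bar>c\<bar> * N" for x
    using holder_boundD(1)[OF assms, of x] by (simp add: abs_mult mult_left_mono)
  show "c * f x - c * f y \<le> \<bar>c\<bar> * N * dist x y powr \<alpha>" for x y
  proof -
    have "c * f x - c * f y \<le> \<bar>c\<bar> * \<bar>f x - f y\<bar>"
      by (metis abs_ge_self abs_mult right_diff_distrib)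
    also have "\<dots> \<le> \<bar>c\<bar> * (N * dist x y powr \<alpha>)"
      using holder_boundD(2)[OF assms, of x y] by (simp add: mult_left_mono)
    finally show ?thesis by (simp add: mult.assoc)
  qed
qed

lemma holder_bound_diff:
  assumes "holder_bound \<alpha> f N" "holder_bound \<alpha> g M"
  shows "holder_bound \<alpha> (\<lambda>x. f x - g x) (N + M)"
  using holder_bound_add[OF assms(1) holder_bound_scale[OF assms(2), of "-1"]] by simp

lemma holder_bound_mult:
  assumes "holder_bound \<alpha> f N" "holder_bound \<alpha> g M"
  shows "holder_bound \<alpha> (\<lambda>x. f x * g x) (2 * N * M)"
proof (rule holder_boundI)
  note f = holder_boundD[OF assms(1)] and g = holder_boundD[OF assms(2)]
  have "\<bar>f x * g x\<bar> \<le> N * M" for x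
    using f(1)[of x] g(1)[of x] f(3) by (simp add: abs_mult mult_mono)
  moreover have "N * M \<le> 2 * N * M" using f(3) g(3) by simp
  ultimately show "\<bar>f x * g x\<bar> \<le> 2 * N * M" for x by (meson order_trans)
  show "f x * g x - f y * g y \<le> 2 * N * M * dist x y powr \<alpha>" for x y
  proof -
    have "f x * g x - f y * g y = f x * (g x - g y) + (f x - f y) * g y" by algebra
    also have "\<dots> \<le> \<bar>f x\<bar> * \<bar>g x - g y\<bar> + \<bar>f x - f y\<bar> * \<bar>g y\<bar>"
      by (metis abs_ge_self abs_mult add_mono)
    also have "\<dots> \<le> N * (M * dist x y powr \<alpha>) + N * dist x y powr \<alpha> * M"
      using f g by (intro add_mono mult_mono) auto
    finally show ?thesis by (simp add: algebra_simps)
  qed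
qed

lemma holder_bound_const: "0 \<le> c \<Longrightarrow> holder_bound \<alpha> (\<lambda>x. c) c"
  by (simp add: holder_bound_def)

lemma holder_coneI:
  assumes "\<And>x. 0 \<le> f x" "\<And>x y. f x \<le> exp (b * dist x y powr \<alpha>) * f y"
  shows "f \<in> holder_cone \<alpha> b"
  using assms by (simp add: holder_cone_def)

lemma holder_coneD:
  assumes "f \<in> holder_cone \<alpha> b"
  shows "0 \<le> f x" "f x \<le> exp (b * dist x y powr \<alpha>) * f y"
  using assms by (simp_all add: holder_cone_def)

lemma holder_cone_scale:
  "f \<in> holder_cone \<alpha> b \<Longrightarrow> 0 \<le> c \<Longrightarrow> (\<lambda>x. c * f x) \<in> holder_cone \<alpha> b"
  unfolding holder_cone_def by (auto simp: mult.left_commute[of _ c] intro: mult_left_mono)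

lemma holder_cone_mono:
  assumes "f \<in> holder_cone \<alpha> b" "b \<le> c"
  shows "f \<in> holder_cone \<alpha> c"
proof (rule holder_coneI)
  show "f x \<le> exp (c * dist x y powr \<alpha>) * f y" for x y
  proof -
    have "f x \<le> exp (b * dist x y powr \<alpha>) * f y" by (rule holder_coneD(2)[OF assms(1)])
    also have "\<dots> \<le> exp (c * dist x y powr \<alpha>) * f y"
      using assms(2) holder_coneD(1)[OF assms(1), of y] by (simp add: mult_right_mono)
    finally show ?thesis .
  qed
qed (rule holder_coneD(1)[OF assms(1)])

lemma holder_cone_const: "0 \<le> c \<Longrightarrow> 0 \<le> b \<Longrightarrow> (\<lambda>x. c) \<in> holder_cone \<alpha> b"
  by (rule holder_coneI) (simp_all add: mult_le_cancel_right1)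

lemma holder_cone_limit:
  assumes "\<And>n. f n \<in> holder_cone \<alpha> b" "\<And>x. (\<lambda>n. f n x) \<longlonglongrightarrow> g x"
  shows "g \<in> holder_cone \<alpha> b"
proof (rule holder_coneI)
  show "0 \<le> g x" for x
    using holder_coneD(1)[OF assms(1)] by (intro LIMSEQ_le_const[OF assms(2)]) auto
  show "g x \<le> exp (b * dist x y powr \<alpha>) * g y" for x y
    using holder_coneD(2)[OF assms(1), of _ x y]
    by (intro LIMSEQ_le[OF assms(2) tendsto_mult[OF tendsto_const assms(2)]]) auto
qed

lemma exp_minus_one_le: "exp x - 1 \<le> x * exp x" for x :: real
  using exp_ge_add_one_self[of "-x"] mult_right_mono[of "1 - x" "exp (-x)" "exp x"]
  by (simp add: algebra_simps exp_minus field_simps)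

lemma half_le_one_minus_exp:
  fixes x :: real
  assumes "0 \<le> x" "x \<le> 1"
  shows "x / 2 \<le> 1 - exp (- x)"
proof -
  have "exp (- x) \<le> 1 / (1 + x)"
    using assms exp_ge_add_one_self[of x] by (simp only: exp_minus inverse_eq_divide) (intro divide_left_mono; simp)
  also have "\<dots> \<le> 1 - x / 2"
  proof -
    have "x * x \<le> x" using assms by (simp add: mult_left_le)
    then have "1 \<le> (1 - x / 2) * (1 + x)" by (simp add: field_simps)
    then show ?thesis using assms by (simp add: divide_le_eq)
  qed
  finally show ?thesis by simp
qed

text \<open>
  The bounds on \<open>A\<close> say that its variation along a matched pair is absorbed by the loss of
  (powered) distance; only the second pair is uniformly contracted.
\<close>

locale paired_transfer =
  fixes T :: "'a::metric_space \<Rightarrow> 'a" and A :: "'a \<Rightarrow> real" and \<alpha> C \<theta> S :: real and x0 :: 'a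
  assumes alpha_pos: "0 < \<alpha>"
    and dist_le_1: "\<And>x y :: 'a. dist x y \<le> 1"
    and C_nonneg: "0 \<le> C"
    and theta: "0 < \<theta>" "\<theta> < 1"
    and A_bound: "\<And>x. \<bar>A x\<bar> \<le> S"
    and matching: "\<And>x x'. \<exists>z\<^sub>1 z\<^sub>2 z\<^sub>1' z\<^sub>2'. z\<^sub>1 \<noteq> z\<^sub>2 \<and> z\<^sub>1' \<noteq> z\<^sub>2' \<and>
      {y. T y = x} = {z\<^sub>1, z\<^sub>2} \<and> {y. T y = x'} = {z\<^sub>1', z\<^sub>2'} \<and>
      dist z\<^sub>1 z\<^sub>1' powr \<alpha> \<le> dist x x' powr \<alpha> \<and>
      \<bar>A z\<^sub>1 - A z\<^sub>1'\<bar> \<le> C * (dist x x' powr \<alpha> - dist z\<^sub>1 z\<^sub>1' powr \<alpha>) \<and>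
      \<bar>A z\<^sub>2 - A z\<^sub>2'\<bar> \<le> C * (dist x x' powr \<alpha> - dist z\<^sub>2 z\<^sub>2' powr \<alpha>) \<and>
      dist z\<^sub>2 z\<^sub>2' powr \<alpha> \<le> \<theta> * dist x x' powr \<alpha>"
begin

section \<open>The constants of the cone and the strict invariance\<close>

abbreviation L :: "('a \<Rightarrow> real) \<Rightarrow> 'a \<Rightarrow> real" where "L \<equiv> transfer_op T A"
abbreviation e :: "'a \<Rightarrow> 'a \<Rightarrow> real" where "e x y \<equiv> dist x y powr \<alpha>"

lemma e_le_1: "e x y \<le> 1"
  using powr_le1[of \<alpha> "dist x y"] alpha_pos dist_le_1[of x y] by simp

text \<open>Write \<open>D\<close> for the powered distance of the points and \<open>d\<close> for
  that of a pair of preimages. In the exponent \<open>A\<close> costs \<open>C * (D - d)\<close> and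
  \<open>f\<close> costs \<open>b * d\<close>; with \<open>b = C + 1\<close> the total is
  \<open>C * D + d\<close>. This is at most \<open>b * D\<close>, and at most
  \<open>(C + \<theta>) * D\<close> for the second pair.\<close>

definition b where "b = C + 1"
text \<open>Bounds the first term of \<open>L f x'\<close> by a multiple of the second:
  \<open>2 * S\<close> comes from the weights, \<open>b\<close> from the oscillation of a cone
  function.\<close>

definition Q where "Q = exp (2 * S + b)"
text \<open>The gain of exponent in one step, defined by
  \<open>4 * Q * \<tau> = 1 - \<theta> - \<tau>\<close>. The 4 absorbs the two factors 2 lost in
  linearising the exponentials in \<open>weights_gap\<close>.\<close>

definition \<tau> where "\<tau> = (1 - \<theta>) / (4 * Q + 1)"
definition b' where "b' = b - \<tau>"

abbreviation K where "K \<equiv> holder_cone \<alpha> b :: ('a \<Rightarrow> real) set"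
abbreviation K' where "K' \<equiv> holder_cone \<alpha> b' :: ('a \<Rightarrow> real) set"

lemma S_nonneg: "0 \<le> S"
  using A_bound[of x0] by linarith

lemma b_ge_1: "1 \<le> b"
  using C_nonneg by (simp add: b_def)

lemma Q_ge_1: "1 \<le> Q"
  using S_nonneg b_ge_1 by (simp add: Q_def)

lemma tau: "0 < \<tau>" "\<tau> < 1" "\<tau> * (4 * Q + 1) = 1 - \<theta>"
proof -
  show "0 < \<tau>" "\<tau> * (4 * Q + 1) = 1 - \<theta>"
    using Q_ge_1 theta by (auto simp: \<tau>_def)
  have "1 - \<theta> < 4 * Q + 1" using Q_ge_1 theta by linarith
  then show "\<tau> < 1" using Q_ge_1 by (simp add: \<tau>_def)
qed

lemma b'_pos: "0 < b'"
  using tau b_ge_1 by (simp add: b'_def)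

lemma K'_subset_K: "f \<in> K' \<Longrightarrow> f \<in> K"
  using tau(1) by (auto intro: holder_cone_mono simp: b'_def)

text \<open>A Harnack inequality: powered distances are at most 1, so a comparison at the single
  point \<open>x0\<close> controls all other points.\<close>

lemma cone_osc:
  assumes "f \<in> K"
  shows "f x \<le> exp b * f y"
proof -
  have "f x \<le> exp (b * e x y) * f y" by (rule holder_coneD(2)[OF assms])
  also have "\<dots> \<le> exp b * f y"
    using e_le_1[of x y] b_ge_1 holder_coneD(1)[OF assms, of y]
    by (intro mult_right_mono) (auto simp: mult_le_cancel_left1)
  finally show ?thesis .
qed

lemma cone_pos:
  assumes "f \<in> K" "0 < f y"
  shows "0 < f x"
  using cone_osc[OF assms(1), of y x] assms(2)
  by (metis exp_gt_zero less_le_trans zero_less_mult_pos)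

text \<open>This is what averaging needs: relative to the target exponent \<open>b'\<close>, the
  excess on the first term, magnified by at most \<open>Q\<close>, is covered by the deficit on the
  second. After division by \<open>exp (b' * D)\<close> both sides are compared with linear
  functions of \<open>D\<close>.\<close>

lemma weights_gap:
  assumes "0 \<le> D" "D \<le> 1"
  shows "Q * (exp (b * D) - exp (b' * D)) \<le> exp (b' * D) - exp ((C + \<theta>) * D)"
proof -
  \<comment> \<open>The distance from \<open>b'\<close> down to the exponent
    \<open>C + \<theta>\<close> of the second pair, as \<open>\<tau>\<close> is the distance from
    \<open>b'\<close> up to \<open>b\<close>.\<close>
  let ?\<sigma> = "1 - \<theta> - \<tau>"
  have \<sigma>: "0 \<le> ?\<sigma>" "?\<sigma> \<le> 1"
    using tau theta Q_ge_1 mult_left_mono[of 1 "4 * Q + 1" \<tau>] by auto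
  have 1: "exp (\<tau> * D) - 1 \<le> 2 * (\<tau> * D)"
  proof -
    have "exp (\<tau> * D) \<le> 1 + \<tau> * D + (\<tau> * D)\<^sup>2"
      using tau assms by (intro exp_bound) (auto simp: mult_le_one)
    moreover have "(\<tau> * D)\<^sup>2 \<le> \<tau> * D"
      using tau assms by (simp add: power2_eq_square mult_le_one mult_left_le)
    ultimately show ?thesis by linarith
  qed
  have 2: "1 - exp (- (?\<sigma> * D)) \<ge> ?\<sigma> * D / 2"
    using \<sigma> assms by (intro half_le_one_minus_exp) (auto simp: mult_le_one)
  have "Q * (exp (\<tau> * D) - 1) \<le> Q * (2 * (\<tau> * D))"
    using 1 Q_ge_1 by simp
  also have "\<dots> \<le> ?\<sigma> * D / 2"
  proof -
    have "4 * Q * \<tau> = 1 - \<theta> - \<tau>" using tau(3) by (simp add: algebra_simps)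
    then have "4 * Q * \<tau> * D = ?\<sigma> * D" by (simp only:)
    then show ?thesis by linarith
  qed
  also have "\<dots> \<le> 1 - exp (- (?\<sigma> * D))" by (rule 2)
  finally have "exp (b' * D) * (Q * (exp (\<tau> * D) - 1)) \<le> exp (b' * D) * (1 - exp (- (?\<sigma> * D)))"
    by simp
  moreover have "exp (b' * D) * exp (\<tau> * D) = exp (b * D)"
    by (simp add: b'_def algebra_simps flip: exp_add)
  moreover have "exp (b' * D) * exp (- (?\<sigma> * D)) = exp ((C + \<theta>) * D)"
  proof -
    have "b' * D + - (?\<sigma> * D) = (C + \<theta>) * D" by (simp add: b'_def b_def algebra_simps)
    then show ?thesis by (metis exp_add)
  qed
  ultimately show ?thesis by (simp only: right_diff_distrib mult.left_commute[of _ Q] mult_1_right mult.commute[of _ Q])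
qed

text \<open>The first pair only keeps the exponent \<open>b\<close>. The second lowers it to
  \<open>C + \<theta>\<close> and carries at least the share \<open>1 / (Q + 1)\<close> of
  \<open>L f x'\<close>, which is enough to lower the exponent of the sum to
  \<open>b'\<close>.\<close>

lemma L_cone:
  assumes "f \<in> K"
  shows "L f \<in> K'"
proof (rule holder_coneI)
  show "0 \<le> L f x" for x
    unfolding transfer_op_def by (intro sum_nonneg) (simp add: holder_coneD(1)[OF assms])
  fix x x'
  obtain z1 z2 z1' z2' where z: "z1 \<noteq> z2" "z1' \<noteq> z2'"
    "{y. T y = x} = {z1, z2}" "{y. T y = x'} = {z1', z2'}" "e z1 z1' \<le> e x x'"
    "\<bar>A z1 - A z1'\<bar> \<le> C * (e x x' - e z1 z1')"
    "\<bar>A z2 - A z2'\<bar> \<le> C * (e x x' - e z2 z2')" "e z2 z2' \<le> \<theta> * e x x'"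
    using matching[of x x'] by blast
  define D where "D = e x x'"
  define u v where "u = exp (A z1') * f z1'" and "v = exp (A z2') * f z2'"
  have uv: "0 \<le> u" "0 \<le> v" by (auto simp: u_def v_def holder_coneD(1)[OF assms])
  have D: "0 \<le> D" "D \<le> 1" by (auto simp: D_def e_le_1)
  have step: "exp (A z) * f z \<le> exp (C * D + e z z') * (exp (A z') * f z')"
    if "\<bar>A z - A z'\<bar> \<le> C * (D - e z z')" for z z'
  proof -
    have "exp (A z) * f z \<le> exp (A z' + C * (D - e z z')) * (exp (b * e z z') * f z')"
      using that holder_coneD[OF assms] by (intro mult_mono) (auto simp: abs_le_iff)
    also have "\<dots> = exp (C * D + e z z') * (exp (A z') * f z')"
      by (simp add: b_def algebra_simps flip: exp_add)
    finally show ?thesis .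
  qed
  have 1: "exp (A z1) * f z1 \<le> exp (b * D) * u"
  proof -
    have "exp (C * D + e z1 z1') * u \<le> exp (b * D) * u"
      using z(5) uv by (intro mult_right_mono) (auto simp: b_def D_def algebra_simps)
    with step[of z1 z1'] z(6) show ?thesis unfolding u_def D_def by linarith
  qed
  have 2: "exp (A z2) * f z2 \<le> exp ((C + \<theta>) * D) * v"
  proof -
    have "exp (C * D + e z2 z2') * v \<le> exp ((C + \<theta>) * D) * v"
      using z(8) uv by (intro mult_right_mono) (auto simp: D_def algebra_simps)
    with step[of z2 z2'] z(7) show ?thesis unfolding v_def D_def by linarith
  qed
  have "u \<le> exp (2 * S + A z2') * (exp b * f z2')"
    unfolding u_def
    using A_bound[of z1'] A_bound[of z2'] cone_osc[OF assms, of z1' z2'] holder_coneD(1)[OF assms]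
    by (intro mult_mono) auto
  also have "\<dots> = Q * v" by (simp add: Q_def v_def exp_add algebra_simps)
  finally have u: "u \<le> Q * v" .
  have "L f x = exp (A z1) * f z1 + exp (A z2) * f z2"
    using z by (simp add: transfer_op_def)
  also have "\<dots> \<le> exp (b * D) * u + exp ((C + \<theta>) * D) * v" using 1 2 by linarith
  also have "\<dots> \<le> exp (b' * D) * (u + v)"
  proof -
    have "u * (exp (b * D) - exp (b' * D)) \<le> Q * v * (exp (b * D) - exp (b' * D))"
      using u D tau by (intro mult_right_mono) (auto simp: b'_def mult_right_mono)
    also have "\<dots> \<le> v * (exp (b' * D) - exp ((C + \<theta>) * D))"
      using mult_left_mono[OF weights_gap[OF D] uv(2)] by (simp add: algebra_simps)
    finally show ?thesis by (simp add: algebra_simps)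
  qed
  also have "u + v = L f x'" using z by (simp add: transfer_op_def u_def v_def)
  finally show "L f x \<le> exp (b' * e x x') * L f x'" by (simp add: D_def)
qed

text \<open>Chosen so that \<open>\<kappa> * (2 * b * exp b) * exp (2 * b) = \<tau>\<close> in
  \<open>cone_subtract\<close>: \<open>exp (2 * b)\<close> is the price of comparing
  \<open>v\<close> with \<open>u\<close> away from \<open>x0\<close>, the bracket that of
  linearising the oscillation of \<open>v\<close>.\<close>

definition \<kappa> where "\<kappa> = \<tau> / (2 * b * exp (3 * b))"

lemma kappa: "0 < \<kappa>" "\<kappa> < 1"
proof -
  show "0 < \<kappa>" using tau b_ge_1 by (simp add: \<kappa>_def)
  have "1 * 1 \<le> (2 * b) * exp (3 * b)" using b_ge_1 by (intro mult_mono) auto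
  then show "\<kappa> < 1" using tau b_ge_1 by (simp add: \<kappa>_def divide_less_eq_1)
qed

text \<open>Subtracting \<open>v\<close> worsens the oscillation of \<open>u\<close> by an amount at
  most linear in the powered distance \<open>D\<close>, while the room
  \<open>exp (b * D) - exp (b' * D)\<close> is at least linear in \<open>D\<close>. This replaces
  the statement that the smaller cone has finite projective diameter.\<close>

lemma cone_subtract:
  assumes "u \<in> K'" "v \<in> K'" "v x0 \<le> u x0"
  shows "(\<lambda>x. u x - \<kappa> * v x) \<in> K"
proof (rule holder_coneI)
  note u = K'_subset_K[OF assms(1)] and v = K'_subset_K[OF assms(2)]
  have vu: "v x \<le> exp (2 * b) * u x" for x
  proof -
    have "v x \<le> exp b * v x0" by (rule cone_osc[OF v])
    also have "\<dots> \<le> exp b * (exp b * u x)"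
      using assms(3) cone_osc[OF u, of x0 x] by simp
    finally show ?thesis by (simp add: mult.assoc[symmetric] flip: exp_add)
  qed
  have \<kappa>b: "\<kappa> * (2 * b * exp b) * exp (2 * b) = \<tau>"
  proof -
    have "exp b * exp (2 * b) = exp (3 * b)" by (simp flip: exp_add)
    then have "\<kappa> * (2 * b * exp b) * exp (2 * b) = \<kappa> * (2 * b * exp (3 * b))"
      by (metis mult.assoc)
    then show ?thesis using b_ge_1 by (simp add: \<kappa>_def)
  qed
  have "\<kappa> * exp (2 * b) \<le> 1"
  proof -
    have "1 * 1 \<le> (2 * b) * exp b" using b_ge_1 by (intro mult_mono) auto
    then have "\<kappa> * exp (2 * b) * 1 \<le> \<kappa> * exp (2 * b) * (2 * b * exp b)"
      using kappa by (intro mult_left_mono) auto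
    then show ?thesis using \<kappa>b tau by (simp add: algebra_simps)
  qed
  then have "\<kappa> * exp (2 * b) * u x \<le> u x" for x
    using holder_coneD(1)[OF u, of x] mult_right_mono[of "\<kappa> * exp (2 * b)" 1 "u x"] by simp
  then show "0 \<le> u x - \<kappa> * v x" for x
    using vu[of x] kappa mult_left_mono[of "v x" "exp (2 * b) * u x" \<kappa>]
    by (smt (verit) mult.assoc)
  fix x y
  define D where "D = e x y"
  have D: "0 \<le> D" "D \<le> 1" by (auto simp: D_def e_le_1)
  have bD: "b * D \<le> b" "0 \<le> b * D" using D b_ge_1 by (auto simp: mult_left_le)
  have ux: "u x \<le> exp (b' * D) * u y" using holder_coneD(2)[OF assms(1), of x y] by (simp add: D_def)
  have vx: "exp (- (b * D)) * v y \<le> v x"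
  proof -
    have "v y \<le> exp (b * D) * v x"
      using holder_coneD(2)[OF v, of y x] by (simp add: D_def dist_commute)
    then show ?thesis by (simp add: exp_minus field_simps)
  qed
  \<comment> \<open>In the worst case \<open>v x\<close> is as small as
    \<open>exp (- (b * D)) * v y\<close>, while the cone condition for the difference is charged
    \<open>exp (b * D) * v y\<close>; the gap between the two vanishes linearly with
    \<open>D\<close>.\<close>
  have "\<kappa> * ((exp (b * D) - exp (- (b * D))) * v y) \<le> \<kappa> * ((2 * b * exp b * D) * (exp (2 * b) * u y))"
  proof (intro mult_left_mono mult_mono vu)
    have "exp (b * D) - exp (- (b * D)) \<le> 2 * (b * D) * exp (b * D)"
    proof -
      have "1 - b * D \<le> exp (- (b * D))" using exp_ge_add_one_self[of "- (b * D)"] by simp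
      moreover have "exp (b * D) - 1 \<le> (b * D) * exp (b * D)" by (rule exp_minus_one_le)
      moreover have "(b * D) * 1 \<le> (b * D) * exp (b * D)" using bD by (intro mult_left_mono) auto
      ultimately show ?thesis by linarith
    qed
    also have "\<dots> \<le> 2 * (b * D) * exp b" using bD by (intro mult_left_mono) auto
    finally show "exp (b * D) - exp (- (b * D)) \<le> 2 * b * exp b * D" by (simp add: algebra_simps)
  qed (use kappa holder_coneD(1)[OF v] D b_ge_1 in auto)
  also have "\<dots> = \<tau> * D * u y" using \<kappa>b by (metis (no_types, lifting) mult.assoc mult.commute)
  also have "\<dots> \<le> (exp (b * D) - exp (b' * D)) * u y"
  proof (rule mult_right_mono)
    have "exp (b * D) = exp (b' * D) * exp (\<tau> * D)"
      by (simp add: b'_def algebra_simps flip: exp_add)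
    then have "exp (b * D) - exp (b' * D) = exp (b' * D) * (exp (\<tau> * D) - 1)"
      by (simp add: algebra_simps)
    moreover have "1 * (\<tau> * D) \<le> exp (b' * D) * (exp (\<tau> * D) - 1)"
    proof (rule mult_mono)
      show "\<tau> * D \<le> exp (\<tau> * D) - 1" using exp_ge_add_one_self[of "\<tau> * D"] by linarith
    qed (use b'_pos D tau in auto)
    ultimately show "\<tau> * D \<le> exp (b * D) - exp (b' * D)" by simp
  qed (rule holder_coneD(1)[OF u])
  finally have "exp (b' * D) * u y - \<kappa> * (exp (- (b * D)) * v y)
      \<le> exp (b * D) * (u y - \<kappa> * v y)" by (simp add: algebra_simps)
  moreover have "\<kappa> * (exp (- (b * D)) * v y) \<le> \<kappa> * v x" using vx kappa by simp
  ultimately show "u x - \<kappa> * v x \<le> exp (b * dist x y powr \<alpha>) * (u y - \<kappa> * v y)"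
    using ux by (simp add: D_def)
qed

section \<open>Contraction of the cone and the eigenfunction\<close>

lemma L_pow_cone: "f \<in> K \<Longrightarrow> (L ^^ n) f \<in> K"
  by (induction n) (auto intro: K'_subset_K L_cone)

lemma L_pos:
  assumes "\<And>x. 0 < f x"
  shows "0 < L f x"
proof -
  obtain z1 z2 where z: "z1 \<noteq> z2" "{y. T y = x} = {z1, z2}"
    using matching[of x x] by blast
  show ?thesis using z assms[of z1] assms[of z2] by (simp add: transfer_op_def add_pos_pos)
qed

lemma L_pow_pos:
  assumes "\<And>x. 0 < f x"
  shows "0 < (L ^^ n) f x"
  using assms by (induction n arbitrary: x) (simp_all add: L_pos)

text \<open>Each step removes the fraction \<open>\<kappa> / 2\<close> of the gap between the two
  bounds: \<open>\<kappa>\<close> from \<open>cone_subtract\<close>, one half because only one of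
  the two bounds moves.\<close>

definition r where "r = 1 - \<kappa> / 2"

lemma r: "0 < r" "r < 1"
  using kappa by (auto simp: r_def)

text \<open>
  If \<open>f\<close> lies between \<open>a g\<close> and \<open>c g\<close> in the cone order, then at the
  base point one of \<open>L f - a L g\<close> and \<open>c L g - L f\<close> is at least half of their sum,
  so that a definite multiple of \<open>L g\<close> can be moved from it to the corresponding bound.
\<close>

lemma contraction_step:
  assumes "(\<lambda>x. f x - a * g x) \<in> K" "(\<lambda>x. c * g x - f x) \<in> K" "g \<in> K" "a \<le> c"
  shows "\<exists>a' c'. a \<le> a' \<and> c' \<le> c \<and> a' \<le> c' \<and> c' - a' = r * (c - a) \<and>
    (\<lambda>x. L f x - a' * L g x) \<in> K \<and> (\<lambda>x. c' * L g x - L f x) \<in> K"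
proof -
  define p where "p = (\<lambda>x. L f x - a * L g x)"
  define s where "s = (\<lambda>x. c * L g x - L f x)"
  have "L (\<lambda>x. f x - a * g x) = p" "L (\<lambda>x. c * g x - f x) = s"
    by (auto simp: p_def s_def transfer_op_diff transfer_op_scale)
  then have p: "p \<in> K'" and s: "s \<in> K'" using L_cone[OF assms(1)] L_cone[OF assms(2)] by auto
  define v where "v = (\<lambda>x. (c - a) / 2 * L g x)"
  have v: "v \<in> K'" unfolding v_def using assms(4) by (intro holder_cone_scale L_cone assms) auto
  have ps: "p x0 + s x0 = 2 * v x0" by (simp add: p_def s_def v_def algebra_simps)
  have half: "\<kappa> * (c - a) / 2 \<le> c - a" "0 \<le> \<kappa> * (c - a) / 2"
    using kappa assms(4) mult_right_mono[of \<kappa> 1 "c - a"] by auto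
  show ?thesis
  proof (cases "v x0 \<le> p x0")
    case True
    have "(\<lambda>x. p x - \<kappa> * v x) \<in> K" by (rule cone_subtract[OF p v True])
    also have "(\<lambda>x. p x - \<kappa> * v x) = (\<lambda>x. L f x - (a + \<kappa> * (c - a) / 2) * L g x)"
      by (auto simp: p_def v_def algebra_simps)
    finally show ?thesis using K'_subset_K[OF s] half
      by (intro exI[of _ "a + \<kappa> * (c - a) / 2"] exI[of _ c]) (auto simp: s_def r_def algebra_simps)
  next
    case False
    then have "v x0 \<le> s x0" using ps by linarith
    then have "(\<lambda>x. s x - \<kappa> * v x) \<in> K" by (rule cone_subtract[OF s v])
    also have "(\<lambda>x. s x - \<kappa> * v x) = (\<lambda>x. (c - \<kappa> * (c - a) / 2) * L g x - L f x)"
      by (auto simp: s_def v_def algebra_simps)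
    finally show ?thesis using K'_subset_K[OF p] half
      by (intro exI[of _ a] exI[of _ "c - \<kappa> * (c - a) / 2"]) (auto simp: p_def r_def algebra_simps)
  qed
qed

text \<open>Scale \<open>g\<close> to agree with \<open>f\<close> at \<open>x0\<close> and apply
  \<open>cone_subtract\<close> in both directions; the second result, divided by
  \<open>\<kappa>\<close>, is the upper bound.\<close>

lemma initial_bounds:
  assumes "f \<in> K'" "g \<in> K'" "0 < g x0"
  shows "(\<lambda>x. f x - \<kappa> * f x0 / g x0 * g x) \<in> K" "(\<lambda>x. f x0 / (\<kappa> * g x0) * g x - f x) \<in> K"
proof -
  define v where "v = (\<lambda>x. f x0 / g x0 * g x)"
  have v: "v \<in> K'" unfolding v_def
    using assms holder_coneD(1)[OF assms(1)] by (intro holder_cone_scale) auto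
  have x0: "v x0 = f x0" using assms(3) by (simp add: v_def)
  show "(\<lambda>x. f x - \<kappa> * f x0 / g x0 * g x) \<in> K"
    using cone_subtract[OF assms(1) v eq_refl[OF x0]] by (simp add: v_def mult.assoc)
  have "(\<lambda>x. 1 / \<kappa> * (v x - \<kappa> * f x)) \<in> K"
    using cone_subtract[OF v assms(1)] x0 kappa by (intro holder_cone_scale) auto
  also have "(\<lambda>x. 1 / \<kappa> * (v x - \<kappa> * f x)) = (\<lambda>x. f x0 / (\<kappa> * g x0) * g x - f x)"
    using kappa by (auto simp: v_def field_simps)
  finally show "(\<lambda>x. f x0 / (\<kappa> * g x0) * g x - f x) \<in> K" .
qed

text \<open>Iterating the contraction step gives nested intervals of length at most a multiple of
  \<open>r ^ n\<close>, whose common point \<open>l\<close> is the limiting ratio of the iterates of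
  \<open>f\<close> and \<open>g\<close>. The lower ends keep the initial bound, which later makes
  the eigenvalue positive.\<close>

lemma ratio_sequences:
  assumes f: "f \<in> K'" and g: "g \<in> K'" "0 < g x0"
  shows "\<exists>l a c. \<forall>n. \<kappa> * f x0 / g x0 \<le> a n \<and> a n \<le> l \<and> l \<le> c n \<and>
      c n - a n \<le> r ^ n * (f x0 / (\<kappa> * g x0)) \<and>
      (\<lambda>x. (L ^^ n) f x - a n * (L ^^ n) g x) \<in> K \<and> (\<lambda>x. c n * (L ^^ n) g x - (L ^^ n) f x) \<in> K"
proof -
  define a0 c0 where "a0 = \<kappa> * f x0 / g x0" and "c0 = f x0 / (\<kappa> * g x0)"
  have f0: "0 \<le> f x0" by (rule holder_coneD(1)[OF f])
  have "\<kappa> * f x0 \<le> f x0 / \<kappa>"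
    using kappa f0 mult_mono[of \<kappa> 1 \<kappa> 1] mult_left_mono[of "\<kappa> * \<kappa>" 1 "f x0"]
    by (simp add: field_simps)
  then have ac: "a0 \<le> c0" using g(2) divide_right_mono[of "\<kappa> * f x0" "f x0 / \<kappa>" "g x0"]
    by (simp add: a0_def c0_def)
  \<comment> \<open>A state is the pair of lower and upper bound. \<open>P\<close> is its invariant
    at time \<open>n\<close>; the nesting relates consecutive states and is therefore put into
    \<open>R\<close>.\<close>
  define P where "P = (\<lambda>n z. fst z \<le> snd z \<and> snd z - fst z = r ^ n * (c0 - a0) \<and>
     (\<lambda>x. (L ^^ n) f x - fst z * (L ^^ n) g x) \<in> K \<and> (\<lambda>x. snd z * (L ^^ n) g x - (L ^^ n) f x) \<in> K)"
  define R where "R = (\<lambda>(n::nat) z z'. fst z \<le> fst z' \<and> snd z' \<le> (snd z::real) \<and> a0 \<le> (fst z' :: real))"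
  have "\<exists>z. \<forall>n. (P n (z n) \<and> a0 \<le> fst (z n)) \<and> R n (z n) (z (Suc n))"
  proof (rule dependent_nat_choice)
    show "\<exists>z. P 0 z \<and> a0 \<le> fst z"
      using ac initial_bounds[OF f g] by (intro exI[of _ "(a0, c0)"]) (auto simp: P_def a0_def c0_def)
    fix z n assume z: "P n z \<and> a0 \<le> fst z"
    then obtain a' c' where "fst z \<le> a' \<and> c' \<le> snd z \<and> a' \<le> c' \<and> c' - a' = r * (snd z - fst z) \<and>
      (\<lambda>x. L ((L ^^ n) f) x - a' * L ((L ^^ n) g) x) \<in> K \<and> (\<lambda>x. c' * L ((L ^^ n) g) x - L ((L ^^ n) f) x) \<in> K"
      using contraction_step[of "(L ^^ n) f" "fst z" "(L ^^ n) g" "snd z"] L_pow_cone[OF K'_subset_K[OF g(1)]]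
      unfolding P_def by blast
    then show "\<exists>z'. (P (Suc n) z' \<and> a0 \<le> fst z') \<and> R n z z'"
      using z by (intro exI[of _ "(a', c')"]) (auto simp: P_def R_def)
  qed
  then obtain z where z: "\<And>n. P n (z n)" "\<And>n. R n (z n) (z (Suc n))" "\<And>n. a0 \<le> fst (z n)" by blast
  have inc: "incseq (\<lambda>n. fst (z n))" using z(2) by (intro incseq_SucI) (auto simp: R_def)
  have dec: "decseq (\<lambda>n. snd (z n))" using z(2) by (intro decseq_SucI) (auto simp: R_def)
  have cross: "fst (z m) \<le> snd (z n)" for m n
    using incseqD[OF inc, of m "max m n"] decseqD[OF dec, of n "max m n"] z(1)[of "max m n"]
    by (simp add: P_def)
  obtain l where l: "(\<lambda>n. fst (z n)) \<longlonglongrightarrow> l" "\<And>n. fst (z n) \<le> l"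
    using incseq_convergent[OF inc, of "snd (z 0)"] cross by metis
  have l': "l \<le> snd (z n)" for n using cross by (intro LIMSEQ_le_const2[OF l(1)]) auto
  \<comment> \<open>Allows the initial length \<open>c0 - a0\<close> to be replaced by
    \<open>c0\<close>.\<close>
  have "0 \<le> a0" using kappa f0 g(2) by (simp add: a0_def)
  then have "r ^ n * (c0 - a0) \<le> r ^ n * c0" for n using r by (intro mult_left_mono) auto
  then show ?thesis using z l l' 
    by (intro exI[of _ l] exI[of _ "\<lambda>n. fst (z n)"] exI[of _ "\<lambda>n. snd (z n)"])
      (simp add: P_def R_def a0_def c0_def)
qed

text \<open>Comparing the iterates of \<open>L 1\<close> with those of \<open>1\<close> controls the
  ratios of consecutive iterates of the constant 1. Their limit is the eigenvalue, and the iterates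
  normalised at \<open>x0\<close> converge because their increments are geometrically small.\<close>

lemma eigenfunction:
  "\<exists>h \<rho>. h \<in> K' \<and> (\<forall>x. 0 < h x) \<and> 0 < \<rho> \<and> h x0 = 1 \<and> (\<forall>x. L h x = \<rho> * h x)"
proof -
  define one :: "'a \<Rightarrow> real" where "one = (\<lambda>x. 1)"
  have one: "one \<in> K'" unfolding one_def using b'_pos by (intro holder_cone_const) auto
  define H where "H = (\<lambda>n. (L ^^ n) one)"
  have Hpos: "0 < H n x" for n x unfolding H_def by (rule L_pow_pos) (simp add: one_def)
  have HK: "H n \<in> K'" for n
    using one unfolding H_def by (induction n) (auto intro: L_cone K'_subset_K)
  have HS: "L (H n) = H (Suc n)" for n by (simp add: H_def)
  have HS': "(L ^^ n) (H 1) = H (Suc n)" for n by (simp add: H_def funpow_swap1)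
  obtain l a c where lac: "\<And>n. \<kappa> * H 1 x0 \<le> a n" "\<And>n. a n \<le> l" "\<And>n. l \<le> c n"
      "\<And>n. c n - a n \<le> r ^ n * (H 1 x0 / \<kappa>)"
      "\<And>n. (\<lambda>x. H (Suc n) x - a n * H n x) \<in> K" "\<And>n. (\<lambda>x. c n * H n x - H (Suc n) x) \<in> K"
    using ratio_sequences[OF HK[of 1] one] unfolding HS' by (auto simp: one_def H_def)
  have sand: "a n * H n x \<le> H (Suc n) x" "H (Suc n) x \<le> c n * H n x" for n x
    using holder_coneD(1)[OF lac(5), of n x] holder_coneD(1)[OF lac(6), of n x] by auto
  define a0 where "a0 = \<kappa> * H 1 x0"
  have a0: "0 < a0" using kappa Hpos by (simp add: a0_def)
  define \<rho> where "\<rho> = (\<lambda>n. H (Suc n) x0 / H n x0)"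
  have \<rho>: "a n \<le> \<rho> n" "\<rho> n \<le> c n" for n
    using sand[of n x0] Hpos[of n x0] by (auto simp: \<rho>_def field_simps)
  have \<rho>a: "a0 \<le> \<rho> n" for n using \<rho>(1)[of n] lac(1)[of n] by (simp add: a0_def)
  define hn where "hn = (\<lambda>n x. H n x / H n x0)"
  have hnK: "hn n \<in> K'" for n
  proof -
    have "(\<lambda>x. 1 / H n x0 * H n x) \<in> K'" using Hpos[of n x0] by (intro holder_cone_scale HK) auto
    then show ?thesis by (simp add: hn_def)
  qed
  have hn0: "hn n x0 = 1" for n using Hpos[of n x0] by (simp add: hn_def)
  have hn_le: "0 \<le> hn n x" "hn n x \<le> exp b" for n x
    using cone_osc[OF K'_subset_K[OF hnK[of n]], of x x0] holder_coneD(1)[OF hnK[of n], of x] hn0[of n] by auto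
  have hnS: "\<rho> n * hn (Suc n) x = H (Suc n) x / H n x0" for n x
    using Hpos[of "Suc n" x0] by (simp add: \<rho>_def hn_def)
  have diff: "\<bar>hn (Suc n) x - hn n x\<bar> \<le> (H 1 x0 / \<kappa> * exp b / a0) * r ^ n" for n x
  proof -
    \<comment> \<open>Both \<open>\<rho> n * hn (Suc n) x\<close> and
      \<open>\<rho> n * hn n x\<close> lie between \<open>a n * hn n x\<close> and
      \<open>c n * hn n x\<close>; dividing by \<open>\<rho> n \<ge> a0\<close> bounds the
      increment.\<close>
    have 1: "a n * hn n x \<le> \<rho> n * hn (Suc n) x" "\<rho> n * hn (Suc n) x \<le> c n * hn n x"
      unfolding hnS using sand[of n x] Hpos[of n x0] by (auto simp: hn_def divide_right_mono)
    have 2: "a n * hn n x \<le> \<rho> n * hn n x" "\<rho> n * hn n x \<le> c n * hn n x"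
      using \<rho>[of n] hn_le(1)[of n x] by (auto intro: mult_right_mono)
    have "a0 * \<bar>hn (Suc n) x - hn n x\<bar> \<le> \<rho> n * \<bar>hn (Suc n) x - hn n x\<bar>"
      using \<rho>a[of n] by (intro mult_right_mono) auto
    also have "\<dots> = \<bar>\<rho> n * hn (Suc n) x - \<rho> n * hn n x\<bar>"
      using \<rho>a[of n] a0 by (simp add: abs_mult flip: right_diff_distrib)
    also have "\<dots> \<le> c n * hn n x - a n * hn n x" using 1 2 by linarith
    also have "\<dots> = (c n - a n) * hn n x" by (simp add: algebra_simps)
    also have "\<dots> \<le> (r ^ n * (H 1 x0 / \<kappa>)) * exp b"
      using lac(2,3,4)[of n] hn_le[of n x] by (intro mult_mono) auto
    finally have "\<bar>hn (Suc n) x - hn n x\<bar> \<le> (r ^ n * (H 1 x0 / \<kappa>)) * exp b / a0"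
      using a0 by (subst pos_le_divide_eq) (simp_all only: mult.commute)
    then show ?thesis by (simp add: mult_ac)
  qed
  have "\<exists>l. (\<lambda>n. hn n x) \<longlonglongrightarrow> l" for x
  proof -
    have "summable (\<lambda>n. (H 1 x0 / \<kappa> * exp b / a0) * r ^ n)"
      using r by (intro summable_mult summable_geometric) auto
    then have "summable (\<lambda>n. hn (Suc n) x - hn n x)"
      by (rule summable_comparison_test'[where N = 0]) (simp only: real_norm_def diff)
    then have "(\<lambda>n. (\<Sum>i<n. hn (Suc i) x - hn i x)) \<longlonglongrightarrow> (\<Sum>i. hn (Suc i) x - hn i x)"
      by (rule summable_LIMSEQ)
    then have "(\<lambda>n. hn n x - hn 0 x) \<longlonglongrightarrow> (\<Sum>i. hn (Suc i) x - hn i x)"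
      by (simp only: sum_lessThan_telescope[of "\<lambda>i. hn i x"])
    from tendsto_add[OF this tendsto_const[of "hn 0 x"]] show ?thesis by auto
  qed
  then obtain h where h: "\<And>x. (\<lambda>n. hn n x) \<longlonglongrightarrow> h x" by metis
  have hK: "h \<in> K'" by (rule holder_cone_limit[OF hnK h])
  have h0: "h x0 = 1" using LIMSEQ_unique[OF h[of x0]] hn0 by simp
  have ca: "(\<lambda>n. c n - a n) \<longlonglongrightarrow> 0"
  proof (rule Lim_null_comparison)
    show "(\<lambda>n. r ^ n * (H 1 x0 / \<kappa>)) \<longlonglongrightarrow> 0"
      using r by (intro tendsto_mult_left_zero LIMSEQ_realpow_zero) auto
    show "\<forall>\<^sub>F n in sequentially. norm (c n - a n) \<le> r ^ n * (H 1 x0 / \<kappa>)"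
      using lac(2,3,4) by (intro always_eventually allI) (smt (verit) real_norm_def)
  qed
  have \<rho>l: "\<rho> \<longlonglongrightarrow> l"
  proof (rule LIM_zero_cancel, rule Lim_null_comparison[OF _ ca])
    show "\<forall>\<^sub>F n in sequentially. norm (\<rho> n - l) \<le> c n - a n"
      using lac(2,3) \<rho> by (intro always_eventually allI) (smt (verit) real_norm_def)
  qed
  have "L h x = l * h x" for x
  proof (rule LIMSEQ_unique)
    show "(\<lambda>n. L (hn n) x) \<longlonglongrightarrow> L h x"
      unfolding transfer_op_def by (intro tendsto_intros h)
    have "L (hn n) x = \<rho> n * hn (Suc n) x" for n
      using transfer_op_scale[of T A "1 / H n x0" "H n" x] by (simp add: hnS HS) (simp add: hn_def)
    then show "(\<lambda>n. L (hn n) x) \<longlonglongrightarrow> l * h x"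
      using tendsto_mult[OF \<rho>l LIMSEQ_Suc[OF h[of x]]] by simp
  qed
  moreover have "0 < h x" for x using cone_pos[OF K'_subset_K[OF hK], of x0 x] h0 by simp
  moreover have "0 < l" using a0 lac(1,2)[of 0] by (simp add: a0_def)
  ultimately show ?thesis using hK h0 by blast
qed

section \<open>Passing between cone bounds and Hoelder bounds\<close>

lemma cone_holder_bound:
  assumes "u \<in> K" "\<And>x. u x \<le> m"
  shows "holder_bound \<alpha> u (m * b * exp b)"
proof (rule holder_boundI)
  note u = holder_coneD[OF assms(1)]
  have m: "0 \<le> m" using u(1) assms(2) order_trans by blast
  have "1 * 1 \<le> b * exp b" using b_ge_1 by (intro mult_mono) auto
  then have "m * 1 \<le> m * (b * exp b)" using m by (intro mult_left_mono) auto
  then show "\<bar>u x\<bar> \<le> m * b * exp b" for x using u(1)[of x] assms(2)[of x] by (simp add: mult.assoc)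
  fix x y
  have bD: "b * e x y \<le> b" using e_le_1[of x y] b_ge_1 by (simp add: mult_left_le)
  have "u x - u y \<le> (exp (b * e x y) - 1) * u y" using u(2)[of x y] by (simp add: algebra_simps)
  also have "\<dots> \<le> (b * e x y * exp b) * m"
  proof (rule mult_mono)
    have "exp (b * e x y) - 1 \<le> (b * e x y) * exp (b * e x y)" by (rule exp_minus_one_le)
    also have "\<dots> \<le> b * e x y * exp b" using bD b_ge_1 by (intro mult_left_mono) auto
    finally show "exp (b * e x y) - 1 \<le> b * e x y * exp b" .
  qed (use u assms b_ge_1 in auto)
  finally show "u x - u y \<le> m * b * exp b * e x y" by (simp add: algebra_simps)
qed

text \<open>Makes every Hoelder function a difference of two cone elements. The shift by
  \<open>N\<close> gives nonnegativity; the further \<open>N / b'\<close> makes the values so large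
  that a variation \<open>N * D\<close> is at most \<open>b' * D\<close> times the value, and then
  \<open>1 + x \<le> exp x\<close> applies.\<close>

lemma holder_bound_cone:
  assumes "holder_bound \<alpha> f N"
  shows "(\<lambda>x. f x + (N + N / b')) \<in> K'"
proof (rule holder_coneI)
  note f = holder_boundD[OF assms]
  have g: "N / b' \<le> f x + (N + N / b')" for x using f(1)[of x] by linarith
  have N: "0 \<le> N / b'" using f(3) b'_pos by simp
  show "0 \<le> f x + (N + N / b')" for x using g[of x] N by linarith
  fix x y
  let ?g = "f y + (N + N / b')" and ?D = "e x y"
  have "f x - f y \<le> b' * ?D * (N / b')" using f(2)[of x y] b'_pos by (simp add: abs_le_iff mult.commute)
  also have "\<dots> \<le> b' * ?D * ?g" using b'_pos g[of y] by (intro mult_left_mono) auto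
  finally have "f x + (N + N / b') \<le> (1 + b' * ?D) * ?g" by (simp add: algebra_simps)
  also have "\<dots> \<le> exp (b' * ?D) * ?g" using g[of y] N by (intro mult_right_mono exp_ge_add_one_self) linarith
  finally show "f x + (N + N / b') \<le> exp (b' * ?D) * ?g" .
qed

text \<open>For \<open>f\<close> in the cone, \<open>ratio_sequences\<close> with
  \<open>g = h\<close> squeezes the normalised iterates between multiples of \<open>h\<close> in the
  cone order. By \<open>cone_holder_bound\<close> this order also controls Hoelder quotients, so the
  convergence is in norm. A shift by a constant reduces general \<open>f\<close> to this
  case.\<close>

theorem spectral_convergence:
  "\<exists>h \<rho> M q. (\<exists>N. holder_bound \<alpha> h N) \<and> (\<exists>m>0. \<forall>x. m \<le> h x) \<and> 0 < \<rho> \<and> (\<forall>x. L h x = \<rho> * h x) \<and>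
     0 < M \<and> 0 < q \<and> q < 1 \<and>
     (\<forall>f N. holder_bound \<alpha> f N \<longrightarrow>
        (\<exists>l. \<forall>n. holder_bound \<alpha> (\<lambda>x. (L ^^ n) f x / \<rho> ^ n - l * h x) (M * q ^ n * N)))"
proof -
  obtain h \<rho> where h: "h \<in> K'" "\<And>x. 0 < h x" "0 < \<rho>" "h x0 = 1" "\<And>x. L h x = \<rho> * h x"
    using eigenfunction by blast
  have Lh: "(L ^^ n) h x = \<rho> ^ n * h x" for n x
  proof (induction n arbitrary: x)
    case (Suc n)
    then have "(L ^^ n) h = (\<lambda>x. \<rho> ^ n * h x)" by blast
    then show ?case by (simp add: transfer_op_scale h(5))
  qed simp
  have h_bounds: "exp (- b) \<le> h x" "h x \<le> exp b" for x
    using cone_osc[OF K'_subset_K[OF h(1)], of x0 x] cone_osc[OF K'_subset_K[OF h(1)], of x x0] h(4)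
    by (auto simp: exp_minus field_simps)
  have hb: "holder_bound \<alpha> h (exp b * b * exp b)"
    by (rule cone_holder_bound[OF K'_subset_K[OF h(1)] h_bounds(2)])
  \<comment> \<open>The 2 counts \<open>u\<close> and the remainder \<open>(l - a n) * h\<close>,
    both controlled by the width \<open>c n - a n\<close>.\<close>
  define M0 where "M0 = 2 * (exp b * b * exp b) / \<kappa>"
  have M0: "0 < M0" using b_ge_1 kappa by (simp add: M0_def)
  have cone: "\<exists>l. \<forall>n. holder_bound \<alpha> (\<lambda>x. (L ^^ n) f x / \<rho> ^ n - l * h x) (M0 * r ^ n * f x0)"
    if f: "f \<in> K'" for f
  proof -
    obtain l a c where lac: "\<And>n. a n \<le> l" "\<And>n. l \<le> c n" "\<And>n. c n - a n \<le> r ^ n * (f x0 / \<kappa>)"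
      "\<And>n. (\<lambda>x. (L ^^ n) f x - a n * (\<rho> ^ n * h x)) \<in> K" "\<And>n. (\<lambda>x. c n * (\<rho> ^ n * h x) - (L ^^ n) f x) \<in> K"
      using ratio_sequences[OF f h(1)] h(4) unfolding Lh by auto
    have "holder_bound \<alpha> (\<lambda>x. (L ^^ n) f x / \<rho> ^ n - l * h x) (M0 * r ^ n * f x0)" for n
    proof -
      define u where "u = (\<lambda>x. (L ^^ n) f x / \<rho> ^ n - a n * h x)"
      define m where "m = c n - a n"
      have \<rho>n: "0 < \<rho> ^ n" using h(3) by simp
      have "(\<lambda>x. 1 / \<rho> ^ n * ((L ^^ n) f x - a n * (\<rho> ^ n * h x))) \<in> K"
        using \<rho>n by (intro holder_cone_scale lac(4)) auto
      also have "(\<lambda>x. 1 / \<rho> ^ n * ((L ^^ n) f x - a n * (\<rho> ^ n * h x))) = u"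
        using h(3) by (auto simp: u_def right_diff_distrib)
      finally have u: "u \<in> K" .
      have "u x \<le> m * exp b" for x
      proof -
        have "(L ^^ n) f x \<le> c n * (\<rho> ^ n * h x)" using holder_coneD(1)[OF lac(5), of n x] by simp
        then have "(L ^^ n) f x / \<rho> ^ n \<le> c n * h x" using \<rho>n by (simp add: divide_le_eq mult_ac)
        then have "u x \<le> m * h x" by (simp add: u_def m_def algebra_simps)
        also have "\<dots> \<le> m * exp b" using lac(1,2)[of n] h_bounds(2) by (intro mult_left_mono) (auto simp: m_def)
        finally show ?thesis .
      qed
      then have ub: "holder_bound \<alpha> u (m * exp b * b * exp b)" by (rule cone_holder_bound[OF u])
      have "holder_bound \<alpha> (\<lambda>x. u x - (l - a n) * h x)
          (m * exp b * b * exp b + \<bar>l - a n\<bar> * (exp b * b * exp b))"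
        by (rule holder_bound_diff[OF ub holder_bound_scale[OF hb]])
      moreover have "m * exp b * b * exp b + \<bar>l - a n\<bar> * (exp b * b * exp b) \<le> M0 * r ^ n * f x0"
      proof -
        have "\<bar>l - a n\<bar> \<le> m" using lac(1,2)[of n] by (simp add: m_def)
        then have "\<bar>l - a n\<bar> * (exp b * b * exp b) \<le> m * (exp b * b * exp b)"
          using b_ge_1 by (intro mult_right_mono) auto
        moreover have "m * (exp b * b * exp b) \<le> r ^ n * (f x0 / \<kappa>) * (exp b * b * exp b)"
          using b_ge_1 lac(3)[of n] by (intro mult_right_mono) (auto simp: m_def)
        moreover have "2 * (r ^ n * (f x0 / \<kappa>) * (exp b * b * exp b)) = M0 * r ^ n * f x0"
          unfolding M0_def by (simp only: times_divide_eq_left times_divide_eq_right mult_ac)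
        moreover have "m * exp b * b * exp b = m * (exp b * b * exp b)" by simp
        ultimately show ?thesis by linarith
      qed
      ultimately show ?thesis
        by (auto simp: u_def algebra_simps intro: holder_bound_mono)
    qed
    then show ?thesis by blast
  qed
  \<comment> \<open>Comes from \<open>g x0 + c \<le> N + 2 * c\<close> with
    \<open>c = N + N / b'\<close>.\<close>
  define M where "M = M0 * (3 + 2 / b')"
  have "\<exists>l. \<forall>n. holder_bound \<alpha> (\<lambda>x. (L ^^ n) f x / \<rho> ^ n - l * h x) (M * r ^ n * N)"
    if fN: "holder_bound \<alpha> f N" for f N
  proof -
    define c where "c = N + N / b'"
    note f = holder_boundD[OF fN]
    have c: "0 \<le> c" using f(3) b'_pos by (simp add: c_def)
    define g where "g = (\<lambda>x. f x + c)"
    have g: "g \<in> K'" using holder_bound_cone[OF fN] by (simp add: g_def c_def)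
    have cK: "(\<lambda>x. c) \<in> K'" using c b'_pos by (intro holder_cone_const) auto
    obtain l1 where l1: "\<And>n. holder_bound \<alpha> (\<lambda>x. (L ^^ n) g x / \<rho> ^ n - l1 * h x) (M0 * r ^ n * g x0)"
      using cone[OF g] by blast
    obtain l2 where l2: "\<And>n. holder_bound \<alpha> (\<lambda>x. (L ^^ n) (\<lambda>x. c) x / \<rho> ^ n - l2 * h x) (M0 * r ^ n * c)"
      using cone[OF cK] by blast
    have "holder_bound \<alpha> (\<lambda>x. (L ^^ n) f x / \<rho> ^ n - (l1 - l2) * h x) (M * r ^ n * N)" for n
    proof -
      have *: "(L ^^ n) f x = (L ^^ n) g x - (L ^^ n) (\<lambda>x. c) x" for x
        using transfer_op_pow_diff[of n T A g "\<lambda>x. c" x] by (simp add: g_def)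
      have eq: "(\<lambda>x. (L ^^ n) f x / \<rho> ^ n - (l1 - l2) * h x) =
         (\<lambda>x. ((L ^^ n) g x / \<rho> ^ n - l1 * h x) - ((L ^^ n) (\<lambda>x. c) x / \<rho> ^ n - l2 * h x))"
        by (auto simp: * diff_divide_distrib left_diff_distrib)
      have "g x0 + c \<le> (3 + 2 / b') * N" using f(1)[of x0] by (simp add: g_def c_def algebra_simps)
      then have "M0 * r ^ n * (g x0 + c) \<le> M0 * r ^ n * ((3 + 2 / b') * N)"
        using M0 r by (intro mult_left_mono) auto
      then have "M0 * r ^ n * g x0 + M0 * r ^ n * c \<le> M * r ^ n * N" by (simp add: M_def algebra_simps)
      then show ?thesis unfolding eq using holder_bound_diff[OF l1[of n] l2[of n]] by (rule holder_bound_mono[rotated])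
    qed
    then show ?thesis by blast
  qed
  moreover have "0 < M" using M0 b'_pos by (simp add: M_def add_pos_pos)
  moreover have "\<exists>m>0. \<forall>x. m \<le> h x" using h_bounds(1) by (intro exI[of _ "exp (- b)"]) auto
  ultimately show ?thesis using h hb r by blast
qed

end

section \<open>The inverse branches of the circle map\<close>

lemma abs_circle_eq_iff: "abs_circle x = abs_circle y \<longleftrightarrow> x - y \<in> \<int>"
  by (rule circle.abs_eq_iff)

lemma circle_coord_abs: "circle_coord (abs_circle x) = frac x"
  by (rule circle_coord.abs_eq)

lemma abs_circle_coord: "abs_circle (circle_coord z) = z"
proof (induction z rule: circle.abs_induct)
  case (1 x)
  have "frac x - x = of_int (- \<lfloor>x\<rfloor>)" by (simp add: frac_def)
  then have "frac x - x \<in> \<int>" by (metis Ints_of_int)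
  then show ?case by (simp only: circle_coord_abs abs_circle_eq_iff)
qed

lemma circle_coord_bounds: "0 \<le> circle_coord z" "circle_coord z < 1"
proof -
  have "circle_coord z = frac (circle_coord z)" by (metis abs_circle_coord circle_coord_abs)
  then show "0 \<le> circle_coord z" "circle_coord z < 1" by (metis frac_ge_0, metis frac_lt_1)
qed

lemma circle_coord_abs_id: "0 \<le> x \<Longrightarrow> x < 1 \<Longrightarrow> circle_coord (abs_circle x) = x"
  by (simp add: circle_coord_abs frac_eq)

lemma dist_abs_circle: "dist (abs_circle x) (abs_circle y) = \<bar>(x - y) - of_int (round (x - y))\<bar>"
  by (rule dist_circle.abs_eq)

lemma dist_abs_circle_le: "dist (abs_circle x) (abs_circle y) \<le> \<bar>x - y\<bar>"
  using round_diff_minimal[of "x - y" 0] by (simp add: dist_abs_circle)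

lemma dist_circle_le_half: "dist x y \<le> 1 / 2" for x y :: circle
proof -
  have "dist (abs_circle (circle_coord x)) (abs_circle (circle_coord y)) \<le> 1 / 2"
    unfolding dist_abs_circle using of_int_round_abs_le[of "circle_coord x - circle_coord y"]
    by (simp add: abs_minus_commute)
  then show ?thesis by (simp only: abs_circle_coord)
qed

lemma dist_abs_circle_near:
  assumes "\<bar>x - y\<bar> \<le> 1 / 2"
  shows "dist (abs_circle x) (abs_circle y) = \<bar>x - y\<bar>"
proof (cases "round (x - y) = 0")
  case False
  then have "1 \<le> \<bar>real_of_int (round (x - y))\<bar>" by linarith
  then have "\<bar>x - y\<bar> \<le> dist (abs_circle x) (abs_circle y)" using assms unfolding dist_abs_circle by linarith
  then show ?thesis using dist_abs_circle_le[of x y] by linarith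
qed (simp add: dist_abs_circle)

lemma dist_abs_circle_far:
  assumes "1 / 2 \<le> x - y" "x - y \<le> 1"
  shows "dist (abs_circle x) (abs_circle y) = 1 - (x - y)"
proof -
  have "abs_circle x = abs_circle (x - 1)" by (simp add: abs_circle_eq_iff)
  then show ?thesis using dist_abs_circle_near[of "x - 1" y] assms by simp
qed

section \<open>The left branch of the map and its expansion\<close>

definition left_branch :: "real \<Rightarrow> real \<Rightarrow> real" where
  "left_branch q x = (1 + (1 - ln (2 * x)) powr (- q)) * x"

lemma left_branch_0 [simp]: "left_branch q 0 = 0"
  by (simp add: left_branch_def)

lemma left_branch_half [simp]: "left_branch q (1 / 2) = 1"
  by (simp add: left_branch_def)

text \<open>With \<open>2 * x\<close> instead of \<open>2 * x - 1\<close> the formula is an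
  increasing lift from \<open>[0, 1)\<close> to \<open>[0, 2)\<close> without a jump. The point
  \<open>1 / 2\<close> can change case because both branches give an integer there, and the separate
  value at 0 agrees with \<open>left_branch q 0 = 0\<close>.\<close>

lemma T_qlog_eq:
  "T_qlog q z = abs_circle (if circle_coord z < 1 / 2 then left_branch q (circle_coord z)
     else 2 * circle_coord z)"
proof -
  have 1: "abs_circle 1 = abs_circle 0" by (simp add: abs_circle_eq_iff)
  have 2: "abs_circle (2 * x - 1) = abs_circle (2 * x)" for x by (simp add: abs_circle_eq_iff)
  show ?thesis
  proof (cases "circle_coord z = 1 / 2")
    case True
    show ?thesis by (simp add: T_qlog_def Let_def True 1)
  qed (auto simp: T_qlog_def Let_def left_branch_def 2)
qed

lemma log_weight_bounds:
  fixes q x :: real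
  assumes "0 < q" "0 < x" "x \<le> 1"
  shows "0 < (1 - ln x) powr (- q)" "(1 - ln x) powr (- q) \<le> 1"
proof -
  have "ln x \<le> 0" using assms by simp
  then have "1 \<le> 1 - ln x" by simp
  then show "0 < (1 - ln x) powr (- q)" "(1 - ln x) powr (- q) \<le> 1"
    using assms(1) powr_mono2'[of "- q" 1 "1 - ln x"] by (simp_all only: powr_gt_zero) auto
qed

lemma log_weight_mono:
  fixes q x y :: real
  assumes "0 < q" "0 < x" "x \<le> y" "y \<le> 1"
  shows "(1 - ln x) powr (- q) \<le> (1 - ln y) powr (- q)"
proof -
  have "ln x \<le> ln y" "ln y \<le> 0" using assms by auto
  then have "1 - ln y \<le> 1 - ln x" "1 \<le> 1 - ln y" by auto
  then show ?thesis using assms(1) by (intro powr_mono2') auto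
qed

context
  fixes q :: real
  assumes q: "0 < q"
begin

abbreviation G where "G \<equiv> left_branch q"

text \<open>The weight increases with its argument, so replacing \<open>2 * x\<close> by
  \<open>x\<close> only lowers it and produces the weight of \<open>log_regular\<close>.\<close>

lemma left_branch_ge:
  assumes "0 \<le> x" "x \<le> 1 / 2"
  shows "x * (1 + (1 - ln x) powr (- q)) \<le> G x"
proof (cases "x = 0")
  case False
  then have "(1 - ln x) powr (- q) \<le> (1 - ln (2 * x)) powr (- q)"
    using assms q by (intro log_weight_mono) auto
  then have "x * (1 + (1 - ln x) powr (- q)) \<le> x * (1 + (1 - ln (2 * x)) powr (- q))"
    using assms by (intro mult_left_mono) auto
  then show ?thesis by (simp add: left_branch_def mult.commute)
qed simp

lemma left_branch_bounds:
  assumes "0 \<le> x" "x \<le> 1 / 2"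
  shows "x \<le> G x" "G x \<le> 2 * x"
proof -
  have "x * 1 \<le> x * (1 + (1 - ln x) powr (- q))" using assms by (intro mult_left_mono) auto
  then show "x \<le> G x" using left_branch_ge[OF assms] by simp
  show "G x \<le> 2 * x"
  proof (cases "x = 0")
    case False
    then show ?thesis unfolding left_branch_def
      using assms log_weight_bounds(2)[OF q, of "2 * x"] by (intro mult_right_mono) auto
  qed simp
qed

text \<open>The quotient \<open>G z / z\<close> increases with the logarithmic weight.
  Superadditivity carries the expansion at the fixed point over to every interval of the branch:
  \<open>G y - G x\<close> is at least \<open>G (y - x)\<close>.\<close>

lemma left_branch_superadd:
  assumes "0 \<le> x" "0 \<le> y" "x + y \<le> 1 / 2"
  shows "G x + G y \<le> G (x + y)"
proof -
  have *: "G z \<le> (1 + (1 - ln (2 * (x + y))) powr (- q)) * z" if "0 \<le> z" "z \<le> x + y" for z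
  proof (cases "z = 0")
    case False
    then show ?thesis unfolding left_branch_def
      using that assms by (intro mult_right_mono add_left_mono log_weight_mono q) auto
  qed simp
  show ?thesis using *[of x] *[of y] assms by (simp add: left_branch_def[of q "x + y"] distrib_left)
qed

lemma left_branch_strict_mono:
  assumes "0 \<le> x" "x < y" "y \<le> 1 / 2"
  shows "G x < G y"
  using left_branch_superadd[of x "y - x"] left_branch_bounds(1)[of "y - x"] assms by auto

text \<open>With \<open>w = 1 - ln (2 * z) \<ge> 1\<close> the derivative is
  \<open>1 + w powr (- q) + q * w powr (- q - 1)\<close>. The mean value theorem is used away from
  0; an interval starting at 0 is covered by \<open>G y \<le> 2 * y\<close>.\<close>

lemma left_branch_lipschitz:
  assumes "0 \<le> x" "x \<le> y" "y \<le> 1 / 2"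
  shows "G y - G x \<le> (2 + q) * (y - x)"
proof (cases "x = 0 \<or> x = y")
  case True
  then show ?thesis using left_branch_bounds(2)[of y] assms q by (auto simp: distrib_right intro: order_trans)
next
  case False
  define G' where "G' = (\<lambda>z. 1 + (1 - ln (2 * z)) powr (- q) + q * (1 - ln (2 * z)) powr (- q - 1))"
  have u: "1 \<le> 1 - ln (2 * z)" if "x \<le> z" "z \<le> y" for z using that assms False by auto
  have "\<exists>z>x. z < y \<and> G y - G x = (y - x) * G' z"
  proof (rule MVT2)
    show "x < y" using assms False by auto
    fix z assume z: "x \<le> z" "z \<le> y"
    have "z > 0" using z assms False by auto
    moreover have "ln (z * 2) < 1" using u[OF z] by (simp add: mult.commute)
    ultimately show "(G has_real_derivative G' z) (at z)"
      unfolding left_branch_def G'_def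
      by (auto intro!: derivative_eq_intros simp: field_simps powr_diff)
  qed
  then obtain z where z: "x < z" "z < y" "G y - G x = (y - x) * G' z" by blast
  have "(1 - ln (2 * z)) powr (- q) \<le> 1" using z assms by (intro log_weight_bounds q) auto
  moreover have "(1 - ln (2 * z)) powr (- (q + 1)) \<le> 1" using z assms q by (intro log_weight_bounds) auto
  then have "q * (1 - ln (2 * z)) powr (- q - 1) \<le> q" using q by simp
  ultimately have "G' z \<le> 2 + q" by (simp add: G'_def)
  then have "(y - x) * G' z \<le> (y - x) * (2 + q)" using z by (intro mult_left_mono) auto
  then show ?thesis using z(3) by (simp add: mult.commute)
qed

lemma left_branch_onto:
  assumes "0 \<le> t" "t < 1"
  shows "\<exists>y. 0 \<le> y \<and> y < 1 / 2 \<and> G y = t"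
proof -
  have "continuous_on {0..1 / 2} G"
  proof (rule continuous_onI)
    fix x d :: real assume x: "x \<in> {0..1 / 2}" and d: "0 < d"
    have "dist (G x') (G x) \<le> d" if "x' \<in> {0..1 / 2}" "dist x' x < d / (2 + q)" for x'
    proof -
      have "dist (G x') (G x) \<le> (2 + q) * dist x' x"
        using left_branch_lipschitz[of x x'] left_branch_lipschitz[of x' x] x that(1)
          left_branch_strict_mono[of x x'] left_branch_strict_mono[of x' x]
        by (cases x x' rule: linorder_cases) (auto simp: dist_real_def abs_if)
      also have "\<dots> \<le> (2 + q) * (d / (2 + q))" using that q by (intro mult_left_mono) auto
      finally show ?thesis using q by simp
    qed
    then show "\<exists>e>0. \<forall>x'\<in>{0..1 / 2}. dist x' x < e \<longrightarrow> dist (G x') (G x) \<le> d"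
      using d q by (intro exI[of _ "d / (2 + q)"]) auto
  qed
  then obtain y where y: "0 \<le> y" "y \<le> 1 / 2" "G y = t"
    using IVT'[of G 0 t "1 / 2"] assms by auto
  moreover have "y \<noteq> 1 / 2" using y(3) assms(2) left_branch_half[of q] by (metis less_irrefl)
  ultimately show ?thesis by (intro exI[of _ y]) auto
qed

section \<open>Fibres and the pairing of their points\<close>

lemma T_qlog_fibre:
  assumes "0 \<le> a" "a < 1 / 2" "G a = circle_coord x"
  shows "{z. T_qlog q z = x} = {abs_circle a, abs_circle ((circle_coord x + 1) / 2)}"
    and "abs_circle a \<noteq> abs_circle ((circle_coord x + 1) / 2)"
proof -
  let ?t = "circle_coord x" and ?c = "(circle_coord x + 1) / 2"
  note t = circle_coord_bounds[of x]
  have ca: "circle_coord (abs_circle a) = a" "circle_coord (abs_circle ?c) = ?c"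
    by (rule circle_coord_abs_id; use assms t in simp)+
  show "abs_circle a \<noteq> abs_circle ?c" using ca assms(2) t by force
  have "T_qlog q (abs_circle a) = x" using assms by (simp add: T_qlog_eq ca abs_circle_coord)
  moreover have "T_qlog q (abs_circle ?c) = x"
  proof -
    have "T_qlog q (abs_circle ?c) = abs_circle (2 * ?c)"
      using t by (simp add: T_qlog_eq ca del: times_divide_eq_right)
    also have "2 * ?c = ?t + 1" by simp
    also have "abs_circle (?t + 1) = abs_circle ?t" by (simp add: abs_circle_eq_iff)
    finally show ?thesis by (simp add: abs_circle_coord)
  qed
  moreover have "z = abs_circle a \<or> z = abs_circle ?c" if "T_qlog q z = x" for z
  proof (cases "circle_coord z < 1 / 2")
    case True
    note z = circle_coord_bounds[of z]
    have "0 \<le> G (circle_coord z)" "G (circle_coord z) < 1"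
      using left_branch_bounds[of "circle_coord z"] z True by auto
    then have "?t = G (circle_coord z)"
      using that True by (auto simp: T_qlog_eq circle_coord_abs_id)
    then have "circle_coord z = a"
      using left_branch_strict_mono[of "circle_coord z" a] left_branch_strict_mono[of a "circle_coord z"]
        assms z True by (cases "circle_coord z" a rule: linorder_cases) auto
    then show ?thesis by (metis abs_circle_coord)
  next
    case False
    note z = circle_coord_bounds[of z]
    have "x = abs_circle (2 * circle_coord z)" using that False by (simp add: T_qlog_eq)
    also have "\<dots> = abs_circle (2 * circle_coord z - 1)" by (simp add: abs_circle_eq_iff)
    finally have "?t = 2 * circle_coord z - 1"
      using z False circle_coord_abs_id[of "2 * circle_coord z - 1"] by auto
    then have "circle_coord z = ?c" by simp
    then show ?thesis by (metis abs_circle_coord)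
  qed
  ultimately show "{z. T_qlog q z = x} = {abs_circle a, abs_circle ?c}" by blast
qed

text \<open>Halving the logarithmic weight leaves room for a first pair whose points lie on opposite
  sides of the fixed point 0, hence in different branches.\<close>

definition fibre_matching :: "circle \<Rightarrow> circle \<Rightarrow> bool" where
  "fibre_matching x x' \<longleftrightarrow> (\<exists>z\<^sub>1 z\<^sub>2 z\<^sub>1' z\<^sub>2'. z\<^sub>1 \<noteq> z\<^sub>2 \<and> z\<^sub>1' \<noteq> z\<^sub>2' \<and>
     {y. T_qlog q y = x} = {z\<^sub>1, z\<^sub>2} \<and> {y. T_qlog q y = x'} = {z\<^sub>1', z\<^sub>2'} \<and>
     dist z\<^sub>1 z\<^sub>1' * (1 + (1 - ln (dist z\<^sub>1 z\<^sub>1')) powr (- q) / 2) \<le> dist x x' \<and>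
     dist z\<^sub>2 z\<^sub>2' \<le> dist x x' / 2)"

lemma fibre_matching_sym: "fibre_matching x x' \<Longrightarrow> fibre_matching x' x"
  unfolding fibre_matching_def by (metis dist_commute)

text \<open>The pairs are the end points of the two preimage arcs of the shorter arc between
  \<open>x\<close> and \<open>x'\<close>. If that arc does not cross 0, each preimage arc stays in
  one branch. Otherwise one of them surrounds 0 and the other \<open>1 / 2\<close>, so both pairs
  mix the branches.\<close>

lemma fibre_matching_le:
  assumes "circle_coord x \<le> circle_coord x'"
  shows "fibre_matching x x'"
proof -
  define t t' where "t = circle_coord x" and "t' = circle_coord x'"
  have t: "0 \<le> t" "t \<le> t'" "t' < 1" using assms circle_coord_bounds by (auto simp: t_def t'_def)
  have x: "x = abs_circle t" "x' = abs_circle t'" by (simp_all add: t_def t'_def abs_circle_coord)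
  obtain a where a: "0 \<le> a" "a < 1 / 2" "G a = t" using left_branch_onto[of t] t by auto
  obtain a' where a': "0 \<le> a'" "a' < 1 / 2" "G a' = t'" using left_branch_onto[of t'] t by auto
  note f = T_qlog_fibre[OF a(1,2) a(3)[unfolded t_def]] and f' = T_qlog_fibre[OF a'(1,2) a'(3)[unfolded t'_def]]
  have aa': "a \<le> a'"
    using left_branch_strict_mono[of a' a] a a' t by force
  show ?thesis
  proof (cases "t' - t \<le> 1 / 2")
    case True
    then have D: "dist x x' = t' - t" using t dist_abs_circle_near[of t t'] by (simp add: x)
    define s where "s = a' - a"
    have s: "0 \<le> s" "s \<le> 1 / 2" using aa' a a' by (auto simp: s_def)
    have "dist (abs_circle a) (abs_circle a') = s"
      using dist_abs_circle_near[of a a'] s by (auto simp: s_def)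
    moreover have "s * (1 + (1 - ln s) powr (- q) / 2) \<le> t' - t"
    proof -
      have "s * (1 + (1 - ln s) powr (- q) / 2) \<le> s * (1 + (1 - ln s) powr (- q))"
        using s by (intro mult_left_mono) auto
      also have "\<dots> \<le> G s" by (rule left_branch_ge[OF s])
      also have "\<dots> \<le> t' - t" using left_branch_superadd[of a s] a a' s by (simp add: s_def)
      finally show ?thesis .
    qed
    moreover have "dist (abs_circle ((t + 1) / 2)) (abs_circle ((t' + 1) / 2)) \<le> (t' - t) / 2"
      using dist_abs_circle_le[of "(t + 1) / 2" "(t' + 1) / 2"] t by (simp add: field_simps)
    ultimately show ?thesis unfolding fibre_matching_def D
      using f f' by (intro exI[of _ "abs_circle a"] exI[of _ "abs_circle ((t + 1) / 2)"]
        exI[of _ "abs_circle a'"] exI[of _ "abs_circle ((t' + 1) / 2)"]) (simp add: t_def t'_def)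
  next
    case False
    then have D: "dist x x' = 1 - (t' - t)"
      using t dist_abs_circle_far[of t' t] by (simp add: x dist_commute)
    \<comment> \<open>The preimage arc around 0 has length \<open>a\<close> on the left branch and
      \<open>b\<close> on the right one. The right part is doubled, so the image arc has length
      \<open>2 * b + t\<close>.\<close>
    define b where "b = (1 - t') / 2"
    define s where "s = a + b"
    have at: "a \<le> t" "t' \<le> 2 * a'" using left_branch_bounds[of a] left_branch_bounds[of a'] a a' by auto
    have b: "0 < b" "2 * b = 1 - t'" using t by (auto simp: b_def)
    have s: "0 < s" "s \<le> 1 / 2" using at b a False by (auto simp: s_def)
    have ds: "dist (abs_circle a) (abs_circle ((t' + 1) / 2)) = s"
      using dist_abs_circle_far[of "(t' + 1) / 2" a] at t a s
      by (simp add: dist_commute s_def b_def field_simps)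
    have k: "(1 - ln s) powr (- q) \<le> 1" using s by (intro log_weight_bounds q) auto
    have "s * (1 + (1 - ln s) powr (- q) / 2) \<le> 2 * b + t"
    proof (cases "b \<le> a")
      case True
      \<comment> \<open>As \<open>s \<le> 2 * a\<close>, the weight that expands \<open>a\<close> is
        at least the weight at \<open>s\<close>; and \<open>a\<close> is at least half of
        \<open>s\<close>, which is where the half weight comes from.\<close>
      have "(1 - ln s) powr (- q) \<le> (1 - ln (2 * a)) powr (- q)"
        using s True a b by (intro log_weight_mono q) (auto simp: s_def)
      then have "a * (1 + (1 - ln s) powr (- q)) \<le> G a"
        using a(1) unfolding left_branch_def mult.commute[of a] by (intro mult_right_mono) auto
      moreover have "s / 2 * (1 - ln s) powr (- q) \<le> a * (1 - ln s) powr (- q)"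
        using True by (intro mult_right_mono) (auto simp: s_def)
      moreover have "s * (1 + (1 - ln s) powr (- q) / 2) = a + b + s / 2 * (1 - ln s) powr (- q)"
        by (simp add: s_def algebra_simps)
      moreover have "a * (1 + (1 - ln s) powr (- q)) = a + a * (1 - ln s) powr (- q)"
        by (simp add: algebra_simps)
      ultimately show ?thesis using a(3) b by linarith
    next
      case False
      \<comment> \<open>More than half of the arc is now doubled, which alone expands it by
        \<open>3 / 2\<close>.\<close>
      have "s * (1 + (1 - ln s) powr (- q) / 2) \<le> s * (1 + 1 / 2)"
        using k s by (intro mult_left_mono) auto
      also have "\<dots> \<le> 2 * b + t" using False at a by (simp add: s_def)
      finally show ?thesis .
    qed
    then have "s * (1 + (1 - ln s) powr (- q) / 2) \<le> dist x x'" using b by (simp add: D)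
    \<comment> \<open>The arc around \<open>1 / 2\<close> has length
      \<open>(1 / 2 - a') + t / 2\<close>, and \<open>a' \<ge> t' / 2\<close>.\<close>
    moreover have "dist (abs_circle ((t + 1) / 2)) (abs_circle a') \<le> dist x x' / 2"
      using dist_abs_circle_le[of "(t + 1) / 2" a'] at a' t by (simp add: D abs_if field_simps split: if_splits)
    ultimately show ?thesis unfolding fibre_matching_def ds[symmetric]
      using f f' by (intro exI[of _ "abs_circle a"] exI[of _ "abs_circle ((t + 1) / 2)"]
        exI[of _ "abs_circle ((t' + 1) / 2)"] exI[of _ "abs_circle a'"]) (simp add: t_def t'_def insert_commute)
  qed
qed

lemma fibre_matching: "fibre_matching x x'"
  using fibre_matching_le[of x x'] fibre_matching_sym[OF fibre_matching_le[of x' x]] by (meson linear)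

text \<open>The lift \<open>F\<close> is increasing and Lipschitz with \<open>F 1 = 2\<close>, an
  integer; an arc crossing 0 is split there. The bound makes the map measurable and keeps Lipschitz
  observables Lipschitz under composition.\<close>

lemma T_qlog_lipschitz: "dist (T_qlog q x) (T_qlog q y) \<le> (2 + q) * dist x y"
proof -
  define F where "F = (\<lambda>c. if c < 1 / 2 then G c else 2 * c)"
  have G_mono: "G x \<le> G y" if "0 \<le> x" "x \<le> y" "y \<le> 1 / 2" for x y
    using left_branch_strict_mono[of x y] that by (cases "x = y") auto
  have F_le: "F y - F x \<le> (2 + q) * (y - x)" if "0 \<le> x" "x \<le> y" for x y
  proof -
    have "2 * (z - w) \<le> (2 + q) * (z - w)" if "w \<le> z" for z w :: real
      using that q by (intro mult_right_mono) auto
    note * = this[of x y] this[of "1 / 2" y]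
    show ?thesis
      using that * left_branch_lipschitz[of x y] left_branch_lipschitz[of x "1 / 2"]
      by (auto simp: F_def algebra_simps)
  qed
  have F_mono: "F x \<le> F y" if "0 \<le> x" "x \<le> y" for x y
    using G_mono[of x y] G_mono[of x "1 / 2"] that by (auto simp: F_def)
  have le: "dist (T_qlog q x) (T_qlog q y) \<le> (2 + q) * dist x y" if "circle_coord x \<le> circle_coord y" for x y
  proof -
    define t t' where "t = circle_coord x" and "t' = circle_coord y"
    have t: "0 \<le> t" "t \<le> t'" "t' < 1" using that circle_coord_bounds by (auto simp: t_def t'_def)
    have x: "x = abs_circle t" "y = abs_circle t'" by (simp_all add: t_def t'_def abs_circle_coord)
    have Tx: "T_qlog q x = abs_circle (F t)" "T_qlog q y = abs_circle (F t')"
      by (simp_all add: T_qlog_eq F_def t_def t'_def)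
    show ?thesis
    proof (cases "t' - t \<le> 1 / 2")
      case True
      have "dist (T_qlog q x) (T_qlog q y) \<le> F t' - F t"
        using dist_abs_circle_le[of "F t" "F t'"] F_mono[of t t'] t by (simp add: Tx)
      also have "\<dots> \<le> (2 + q) * (t' - t)" using t by (intro F_le) auto
      also have "t' - t = dist x y" using dist_abs_circle_near[of t t'] t True by (simp add: x)
      finally show ?thesis .
    next
      case False
      have D: "dist x y = 1 - (t' - t)"
        using t False dist_abs_circle_far[of t' t] by (simp add: x dist_commute)
      have F01: "F 0 = 0" "F 1 = 2" by (simp_all add: F_def)
      have "abs_circle (F t') = abs_circle (F t' - 2)" by (simp add: abs_circle_eq_iff)
      then have "dist (T_qlog q x) (T_qlog q y) \<le> \<bar>F t - (F t' - 2)\<bar>"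
        using dist_abs_circle_le[of "F t" "F t' - 2"] by (simp add: Tx)
      also have "\<dots> = (F t - F 0) + (F 1 - F t')"
        using F_mono[of 0 t] F_mono[of t' 1] t by (simp add: F01)
      also have "\<dots> \<le> (2 + q) * (t - 0) + (2 + q) * (1 - t')"
        using t by (intro add_mono F_le) auto
      also have "\<dots> = (2 + q) * dist x y" by (simp add: D algebra_simps)
      finally show ?thesis .
    qed
  qed
  show ?thesis
    using le[of x y] le[of y x] by (metis dist_commute linear)
qed

text \<open>For \<open>t\<close> half the weight, \<open>(1 + t) powr \<alpha> \<ge> 1 + \<alpha> *
  ln (1 + t) \<ge> 1 + \<alpha> * t / 2\<close> because \<open>t \<le> 1\<close>. The 4 combines
  this 2 with the halving.\<close>

lemma log_weight_absorbed:
  assumes "0 < \<alpha>" "0 \<le> s" "s \<le> 1 / 2" "s * (1 + (1 - ln s) powr (- q) / 2) \<le> D"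
  shows "s powr \<alpha> * (1 - ln s) powr (- q) \<le> 4 / \<alpha> * (D powr \<alpha> - s powr \<alpha>)"
proof (cases "s = 0")
  case True
  then show ?thesis using assms by simp
next
  case False
  define t where "t = (1 - ln s) powr (- q) / 2"
  have t: "0 < t" "t \<le> 1" using log_weight_bounds[OF q, of s] assms False by (auto simp: t_def)
  have "1 + \<alpha> * (t / 2) \<le> 1 + \<alpha> * ln (1 + t)"
  proof -
    have "t / 2 \<le> t / (1 + t)" using t by (intro divide_left_mono) auto
    also have "\<dots> = 1 - 1 / (1 + t)" using t by (simp add: field_simps)
    also have "\<dots> \<le> ln (1 + t)"
      using t ln_le_minus_one[of "1 / (1 + t)"] by (simp add: ln_div)
    finally show ?thesis using assms(1) by simp
  qed
  also have "\<dots> \<le> exp (\<alpha> * ln (1 + t))" by (rule exp_ge_add_one_self)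
  also have "\<dots> = (1 + t) powr \<alpha>" using t by (simp add: powr_def)
  finally have "s powr \<alpha> * (1 + \<alpha> * (t / 2)) \<le> s powr \<alpha> * (1 + t) powr \<alpha>"
    by (intro mult_left_mono) auto
  also have "\<dots> = (s * (1 + t)) powr \<alpha>" using assms t by (simp add: powr_mult)
  also have "\<dots> \<le> D powr \<alpha>" using assms t by (intro powr_mono2) (auto simp: t_def)
  finally show ?thesis using assms(1) by (simp add: t_def field_simps)
qed

end

text \<open>The logarithmic modulus for \<open>r\<^sub>0 = e\<close>, as
  \<open>1 - ln d = ln (e / d)\<close>. Fixing it matches the weight in
  \<open>left_branch_ge\<close> and makes different exponents comparable.\<close>

definition log_regular :: "real \<Rightarrow> real \<Rightarrow> (circle \<Rightarrow> real) \<Rightarrow> real \<Rightarrow> bool" where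
  "log_regular q \<alpha> A C \<longleftrightarrow>
     (\<forall>x y. \<bar>A x - A y\<bar> \<le> C * (dist x y powr \<alpha> * (1 - ln (dist x y)) powr (- q)))"

lemma paired_transfer_T_qlog:
  assumes q: "0 < q" and \<alpha>: "0 < \<alpha>" and C: "0 \<le> C" and A: "log_regular q \<alpha> A C"
  shows "paired_transfer (T_qlog q) A \<alpha> (C * (4 / \<alpha>)) (2 powr (- \<alpha>)) (\<bar>A x0\<bar> + C)"
proof
  note half = dist_circle_le_half
  show "dist x y \<le> 1" for x y :: circle using half[of x y] by simp
  show "0 < 2 powr - \<alpha>" "2 powr - \<alpha> < 1" using \<alpha> powr_less_mono[of "-\<alpha>" 0 2] by auto
  show "\<bar>A x\<bar> \<le> \<bar>A x0\<bar> + C" for x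
  proof -
    have "dist x x0 powr \<alpha> * (1 - ln (dist x x0)) powr (- q) \<le> 1 * 1"
    proof (cases "dist x x0 = 0")
      case False
      then show ?thesis
        using half[of x x0] \<alpha> log_weight_bounds[OF q, of "dist x x0"]
        by (intro mult_mono powr_le1 log_weight_bounds(2) q) auto
    qed simp
    then have "C * (dist x x0 powr \<alpha> * (1 - ln (dist x x0)) powr (- q)) \<le> C"
      using C by (simp add: mult_left_le)
    then have "\<bar>A x - A x0\<bar> \<le> C" using A unfolding log_regular_def by (meson order_trans)
    then show ?thesis by linarith
  qed
  fix x x' :: circle
  obtain z1 z2 z1' z2' where z: "z1 \<noteq> z2" "z1' \<noteq> z2'"
     "{y. T_qlog q y = x} = {z1, z2}" "{y. T_qlog q y = x'} = {z1', z2'}"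
     "dist z1 z1' * (1 + (1 - ln (dist z1 z1')) powr (- q) / 2) \<le> dist x x'"
     "dist z2 z2' \<le> dist x x' / 2"
    using fibre_matching[OF q, of x x'] unfolding fibre_matching_def[OF q] by blast
  \<comment> \<open>Weights are at most 1, so a pair contracted by 2 also satisfies the inequality
    of the first pair, and one estimate of \<open>A\<close> serves both.\<close>
  have "dist z2 z2' * (1 + (1 - ln (dist z2 z2')) powr (- q) / 2) \<le> dist x x'"
  proof (cases "dist z2 z2' = 0")
    case False
    then have "dist z2 z2' * (1 + (1 - ln (dist z2 z2')) powr (- q) / 2) \<le> dist z2 z2' * 2"
      using half[of z2 z2'] log_weight_bounds[OF q, of "dist z2 z2'"] by (intro mult_left_mono) auto
    then show ?thesis using z(6) by linarith
  qed simp
  moreover have flat: "\<bar>A z - A z'\<bar> \<le> C * (4 / \<alpha>) * (dist x x' powr \<alpha> - dist z z' powr \<alpha>)"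
    if "dist z z' * (1 + (1 - ln (dist z z')) powr (- q) / 2) \<le> dist x x'" for z z'
  proof -
    have "\<bar>A z - A z'\<bar> \<le> C * (dist z z' powr \<alpha> * (1 - ln (dist z z')) powr (- q))"
      using A by (simp add: log_regular_def)
    also have "\<dots> \<le> C * (4 / \<alpha> * (dist x x' powr \<alpha> - dist z z' powr \<alpha>))"
      using C half[of z z'] that by (intro mult_left_mono log_weight_absorbed q \<alpha>) auto
    finally show ?thesis by (simp add: mult.assoc)
  qed
  moreover have "dist z1 z1' powr \<alpha> \<le> dist x x' powr \<alpha>"
  proof (rule powr_mono2)
    have "dist z1 z1' * 1 \<le> dist z1 z1' * (1 + (1 - ln (dist z1 z1')) powr (- q) / 2)"
      by (intro mult_left_mono) auto
    then show "dist z1 z1' \<le> dist x x'" using z(5) by simp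
  qed (use \<alpha> in auto)
  moreover have "dist z2 z2' powr \<alpha> \<le> 2 powr (- \<alpha>) * dist x x' powr \<alpha>"
  proof -
    have "dist z2 z2' powr \<alpha> \<le> (dist x x' / 2) powr \<alpha>" using z(6) \<alpha> by (intro powr_mono2) auto
    then show ?thesis by (simp add: powr_divide powr_minus field_simps)
  qed
  ultimately show "\<exists>z\<^sub>1 z\<^sub>2 z\<^sub>1' z\<^sub>2'. z\<^sub>1 \<noteq> z\<^sub>2 \<and> z\<^sub>1' \<noteq> z\<^sub>2' \<and>
      {y. T_qlog q y = x} = {z\<^sub>1, z\<^sub>2} \<and> {y. T_qlog q y = x'} = {z\<^sub>1', z\<^sub>2'} \<and>
      dist z\<^sub>1 z\<^sub>1' powr \<alpha> \<le> dist x x' powr \<alpha> \<and>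
      \<bar>A z\<^sub>1 - A z\<^sub>1'\<bar> \<le> C * (4 / \<alpha>) * (dist x x' powr \<alpha> - dist z\<^sub>1 z\<^sub>1' powr \<alpha>) \<and>
      \<bar>A z\<^sub>2 - A z\<^sub>2'\<bar> \<le> C * (4 / \<alpha>) * (dist x x' powr \<alpha> - dist z\<^sub>2 z\<^sub>2' powr \<alpha>) \<and>
      dist z\<^sub>2 z\<^sub>2' powr \<alpha> \<le> 2 powr - \<alpha> * dist x x' powr \<alpha>"
    using z by (intro exI[of _ z1] exI[of _ z2] exI[of _ z1'] exI[of _ z2']) simp
qed (use \<alpha> C in auto)

section \<open>Weak limits on the circle and the eigenmeasure\<close>

text \<open>The infimum is attained: for \<open>x \<noteq> y\<close> the difference quotient is a
  lower bound of all admissible constants.\<close>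

lemma Hol_const_nonneg_bound:
  assumes "f \<in> Holder_space \<alpha>"
  shows "0 \<le> Hol_const (power_modulus \<alpha>) f"
    and "\<bar>f x - f y\<bar> \<le> Hol_const (power_modulus \<alpha>) f * dist x y powr \<alpha>"
proof -
  let ?S = "{C. 0 \<le> C \<and> (\<forall>x y. \<bar>f x - f y\<bar> \<le> C * power_modulus \<alpha> (dist x y))}"
  obtain C where C: "\<And>x y. \<bar>f x - f y\<bar> \<le> C * dist x y powr \<alpha>"
    using assms by (auto simp: modulus_space_def power_modulus_def)
  have "\<bar>f x - f y\<bar> \<le> \<bar>C\<bar> * dist x y powr \<alpha>" for x y
    by (rule order_trans[OF C]) (simp add: mult_right_mono)
  then have ne: "?S \<noteq> {}" by (auto simp: power_modulus_def intro!: exI[of _ "\<bar>C\<bar>"])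
  then show "0 \<le> Hol_const (power_modulus \<alpha>) f"
    unfolding Hol_const_def by (intro cInf_greatest) auto
  show "\<bar>f x - f y\<bar> \<le> Hol_const (power_modulus \<alpha>) f * dist x y powr \<alpha>"
  proof (cases "x = y")
    case False
    then have d: "0 < dist x y powr \<alpha>" by simp
    have "\<bar>f x - f y\<bar> / dist x y powr \<alpha> \<le> Hol_const (power_modulus \<alpha>) f"
      unfolding Hol_const_def using ne d
      by (intro cInf_greatest) (auto simp: power_modulus_def divide_le_eq)
    then show ?thesis using d by (simp add: divide_le_eq)
  qed simp
qed

lemma Hol_const_le:
  assumes "0 \<le> C" "\<And>x y. \<bar>f x - f y\<bar> \<le> C * dist x y powr \<alpha>"
  shows "Hol_const (power_modulus \<alpha>) f \<le> C"
  unfolding Hol_const_def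
  by (rule cInf_lower) (use assms in \<open>auto simp: power_modulus_def intro: bdd_belowI[of _ 0]\<close>)

lemma holder_bound_imp_Holder_space: "holder_bound \<alpha> f N \<Longrightarrow> f \<in> Holder_space \<alpha>"
  by (auto simp: holder_bound_def modulus_space_def power_modulus_def)

lemma Holder_norm_le:
  assumes "holder_bound \<alpha> f N"
  shows "Holder_norm \<alpha> f \<le> 2 * N"
proof -
  note f = holder_boundD[OF assms]
  have "(SUP x. \<bar>f x\<bar>) \<le> N" by (rule cSUP_least) (auto simp: f)
  then show ?thesis unfolding modulus_norm_def using Hol_const_le[OF f(3) f(2)] by simp
qed

lemma dist_circle_powr_le_1: "0 < \<alpha> \<Longrightarrow> dist x y powr \<alpha> \<le> 1" for x y :: circle
  using dist_circle_le_half[of x y] by (intro powr_le1) auto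

text \<open>Since the diameter is at most 1, a Hoelder function is bounded, and the supremum in the
  norm is a true upper bound.\<close>

lemma holder_bound_Holder_norm:
  fixes f :: "circle \<Rightarrow> real"
  assumes "f \<in> Holder_space \<alpha>" "0 < \<alpha>"
  shows "holder_bound \<alpha> f (Holder_norm \<alpha> f)"
proof -
  note H = Hol_const_nonneg_bound[OF assms(1)]
  let ?H = "Hol_const (power_modulus \<alpha>) f"
  have "\<bar>f x\<bar> \<le> \<bar>f y\<bar> + ?H" for x y
  proof -
    have "?H * dist x y powr \<alpha> \<le> ?H"
      using H(1) dist_circle_powr_le_1[OF assms(2)] by (simp add: mult_left_le)
    then show ?thesis using H(2)[of x y] by linarith
  qed
  then have "bdd_above (range (\<lambda>x. \<bar>f x\<bar>))" by (intro bdd_aboveI2[of _ _ "\<bar>f undefined\<bar> + ?H"]) auto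
  then have S: "\<bar>f x\<bar> \<le> (SUP x. \<bar>f x\<bar>)" for x by (intro cSUP_upper) auto
  then have "0 \<le> (SUP x. \<bar>f x\<bar>)" by (meson abs_ge_zero order_trans)
  then have "?H \<le> Holder_norm \<alpha> f" by (simp add: modulus_norm_def)
  moreover have "\<bar>f x\<bar> \<le> Holder_norm \<alpha> f" for x using S[of x] H(1) by (simp add: modulus_norm_def)
  ultimately show ?thesis unfolding holder_bound_def
    using H(2) by (meson mult_right_mono order_trans powr_ge_zero)
qed

text \<open>Distances are at most 1, so lowering the exponent only enlarges the modulus.\<close>

lemma holder_bound_exponent:
  fixes f :: "circle \<Rightarrow> real"
  assumes "holder_bound \<alpha> f N" "\<beta> \<le> \<alpha>"
  shows "holder_bound \<beta> f N"
proof (rule holder_boundI)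
  fix x y :: circle
  have "dist x y powr \<alpha> \<le> dist x y powr \<beta>"
    using dist_circle_le_half[of x y] assms(2) by (cases "x = y") (auto intro!: powr_mono')
  then have "N * dist x y powr \<alpha> \<le> N * dist x y powr \<beta>"
    using holder_boundD(3)[OF assms(1)] by (intro mult_left_mono)
  then show "f x - f y \<le> N * dist x y powr \<beta>"
    using holder_boundD(2)[OF assms(1), of x y] by linarith
qed (rule holder_boundD(1)[OF assms(1)])

lemma holder_bound_continuous:
  assumes "holder_bound \<alpha> f N" "0 < \<alpha>"
  shows "continuous_on UNIV f"
proof -
  have "isCont f x" for x
    unfolding isCont_def
  proof (rule LIM_zero_cancel, rule Lim_null_comparison)
    show "\<forall>\<^sub>F y in at x. norm (f y - f x) \<le> N * dist y x powr \<alpha>"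
      using holder_boundD(2)[OF assms(1)] by (intro always_eventually) auto
    have "((\<lambda>y. dist y x) \<longlongrightarrow> dist x x) (at x)" by (intro tendsto_intros)
    then have "((\<lambda>y. dist y x powr \<alpha>) \<longlongrightarrow> 0) (at x)"
      using assms(2) by (intro tendsto_zero_powrI[where b = \<alpha>]) auto
    then show "((\<lambda>y. N * dist y x powr \<alpha>) \<longlongrightarrow> 0) (at x)" by (rule tendsto_mult_right_zero)
  qed
  then show ?thesis by (intro continuous_at_imp_continuous_on) auto
qed

lemma holder_bound_measurable:
  "holder_bound \<alpha> f N \<Longrightarrow> 0 < \<alpha> \<Longrightarrow> f \<in> borel_measurable borel"
  by (intro borel_measurable_continuous_onI holder_bound_continuous)

lemma holder_bound_integrable:
  assumes "finite_measure \<nu>" "sets \<nu> = sets borel" "holder_bound \<alpha> f N" "0 < \<alpha>"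
  shows "integrable \<nu> f"
proof -
  have "f \<in> borel_measurable \<nu>"
    using holder_bound_measurable[OF assms(3,4)] by (simp add: measurable_cong_sets[OF assms(2) refl])
  then show ?thesis
    using holder_boundD(1)[OF assms(3)]
    by (intro finite_measure.integrable_const_bound[OF assms(1), where B = N]) auto
qed

lemma holder_bound_inverse:
  assumes "holder_bound \<alpha> f N" "0 < m" "\<And>x. m \<le> f x"
  shows "holder_bound \<alpha> (\<lambda>x. 1 / f x) (1 / m + N / m\<^sup>2)"
proof (rule holder_boundI)
  note f = holder_boundD[OF assms(1)]
  have pos: "0 < f x" for x using assms(2) assms(3)[of x] by linarith
  have "1 / f x \<le> 1 / m" for x using pos assms(2,3) by (intro divide_left_mono) auto
  moreover have "0 \<le> N / m\<^sup>2" using f(3) by simp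
  ultimately show "\<bar>1 / f x\<bar> \<le> 1 / m + N / m\<^sup>2" for x using pos[of x] by (smt (verit) divide_pos_pos)
  fix x y
  have "1 / f x - 1 / f y = (f y - f x) / (f x * f y)" using pos[of x] pos[of y] by (simp add: field_simps)
  also have "\<dots> \<le> (N * dist x y powr \<alpha>) / (m * m)"
    using f(2)[of x y] assms(2,3) pos f(3) by (intro frac_le mult_mono) (auto simp: abs_le_iff less_imp_le)
  also have "\<dots> \<le> (1 / m + N / m\<^sup>2) * dist x y powr \<alpha>"
    using assms(2) by (simp add: power2_eq_square distrib_right)
  finally show "1 / f x - 1 / f y \<le> (1 / m + N / m\<^sup>2) * dist x y powr \<alpha>" .
qed

text \<open>Evaluating an iterate at one point is integration against finitely many point masses
  that do not depend on \<open>f\<close>; these give the measures whose weak limit is taken.\<close>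

lemma transfer_op_pow_sum:
  assumes "\<And>x. finite {y. T y = x}"
  shows "\<exists>S c. finite S \<and> (\<forall>y\<in>S. 0 < c y) \<and> (\<forall>f. (transfer_op T A ^^ n) f x = (\<Sum>y\<in>S. c y * f y))"
proof (induction n)
  case 0
  show ?case by (intro exI[of _ "{x}"] exI[of _ "\<lambda>_. 1"]) auto
next
  case (Suc n)
  then obtain S c where S: "finite S" "\<And>y. y \<in> S \<Longrightarrow> 0 < c y"
    "\<And>f. (transfer_op T A ^^ n) f x = (\<Sum>y\<in>S. c y * f y)" by blast
  define S' where "S' = {z. T z \<in> S}"
  have "S' = (\<Union>y\<in>S. {z. T z = y})" by (auto simp: S'_def)
  then have S': "finite S'" using S(1) assms by auto
  have "(transfer_op T A ^^ Suc n) f x = (\<Sum>z\<in>S'. (c (T z) * exp (A z)) * f z)" for f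
  proof -
    have "(transfer_op T A ^^ Suc n) f x = (\<Sum>y\<in>S. c y * transfer_op T A f y)"
      using S(3)[of "transfer_op T A f"] by (simp add: funpow_swap1)
    also have "\<dots> = (\<Sum>y\<in>S. \<Sum>z\<in>{z\<in>S'. T z = y}. (c (T z) * exp (A z)) * f z)"
    proof (rule sum.cong[OF refl])
      fix y assume "y \<in> S"
      then have "{z \<in> S'. T z = y} = {z. T z = y}" by (auto simp: S'_def)
      then show "c y * transfer_op T A f y = (\<Sum>z\<in>{z\<in>S'. T z = y}. (c (T z) * exp (A z)) * f z)"
        by (auto simp: transfer_op_def sum_distrib_left mult.assoc intro!: sum.cong)
    qed
    also have "\<dots> = (\<Sum>z\<in>S'. (c (T z) * exp (A z)) * f z)"
      by (rule sum.group[OF S' S(1)]) (auto simp: S'_def)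
    finally show ?thesis .
  qed
  then show ?case using S' S(2)
    by (intro exI[of _ S'] exI[of _ "\<lambda>z. c (T z) * exp (A z)"]) (auto simp: S'_def)
qed

section \<open>Weak compactness and determination of measures\<close>

lemma continuous_abs_circle: "continuous_on UNIV abs_circle"
proof (rule continuous_onI)
  fix x d :: real assume "0 < d"
  then show "\<exists>e>0. \<forall>x'\<in>UNIV. dist x' x < e \<longrightarrow> dist (abs_circle x') (abs_circle x) \<le> d"
    by (intro exI[of _ d]) (auto simp: dist_real_def intro: order_trans[OF dist_abs_circle_le])
qed

text \<open>The coordinate jumps at the point 0, but its sublevel sets for \<open>t < 1\<close> are
  continuous images of the compact intervals \<open>{0..t}\<close>, hence closed.\<close>

lemma measurable_circle_coord: "circle_coord \<in> borel_measurable borel"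
proof (rule borel_measurableI_le)
  fix t
  show "{z \<in> space borel. circle_coord z \<le> t} \<in> sets borel"
  proof (cases "t < 1")
    case True
    have "{z. circle_coord z \<le> t} = abs_circle ` {0..t}"
    proof (intro set_eqI iffI)
      fix z assume "z \<in> {z. circle_coord z \<le> t}"
      then show "z \<in> abs_circle ` {0..t}"
        by (intro image_eqI[of _ _ "circle_coord z"]) (auto simp: abs_circle_coord circle_coord_bounds)
    qed (use True in \<open>auto simp: circle_coord_abs_id\<close>)
    moreover have "compact (abs_circle ` {0..t})"
      by (intro compact_continuous_image continuous_on_subset[OF continuous_abs_circle]) auto
    ultimately show ?thesis by (simp add: borel_closed compact_imp_closed)
  next
    case False
    then have "{z. circle_coord z \<le> t} = UNIV"
      using order_trans[OF less_imp_le[OF circle_coord_bounds(2)], of t] by auto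
    then show ?thesis by simp
  qed
qed

text \<open>Helly's selection theorem, transported from the line through the coordinate in \<open>[0,1)\<close>.\<close>

lemma circle_prob_convergent_subseq:
  fixes m :: "nat \<Rightarrow> circle measure"
  assumes m: "\<And>n. prob_space (m n)" "\<And>n. sets (m n) = sets borel"
  shows "\<exists>\<nu> s. prob_space \<nu> \<and> sets \<nu> = sets borel \<and> strict_mono (s :: nat \<Rightarrow> nat) \<and>
    (\<forall>f::circle \<Rightarrow> real. continuous_on UNIV f \<longrightarrow> (\<forall>x. \<bar>f x\<bar> \<le> B) \<longrightarrow>
       (\<lambda>k. \<integral>x. f x \<partial>m (s k)) \<longlonglongrightarrow> (\<integral>x. f x \<partial>\<nu>))"
proof -
  have coord: "circle_coord \<in> measurable (m n) borel" for n
    using measurable_circle_coord by (simp add: measurable_cong_sets[OF m(2) refl])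
  define \<mu> where "\<mu> = (\<lambda>n. distr (m n) borel circle_coord)"
  have \<mu>: "real_distribution (\<mu> n)" for n
    unfolding \<mu>_def by (rule prob_space.real_distribution_distr[OF m(1) coord])
  have "tight \<mu>" unfolding tight_def
  proof (intro conjI allI impI \<mu>)
    fix \<epsilon> :: real assume "0 < \<epsilon>"
    have "measure (\<mu> n) {-1<..1} = 1" for n
    proof -
      have "circle_coord -` {-1<..1} \<inter> space (m n) = space (m n)"
        using order_less_le_trans[OF _ circle_coord_bounds(1), of "-1"] less_imp_le[OF circle_coord_bounds(2)]
        by auto
      then show ?thesis unfolding \<mu>_def
        by (subst measure_distr[OF coord]) (auto simp: prob_space.prob_space[OF m(1)])
    qed
    then show "\<exists>a b. a < b \<and> (\<forall>n. 1 - \<epsilon> < measure (\<mu> n) {a<..b})"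
      using \<open>0 < \<epsilon>\<close> by (intro exI[of _ "-1"] exI[of _ 1]) auto
  qed
  then obtain s M where s: "strict_mono (s :: nat \<Rightarrow> nat)" "real_distribution M" "weak_conv_m (\<mu> \<circ> id \<circ> s) M"
    using tight_imp_convergent_subsubsequence[of \<mu> id] by (auto simp: strict_mono_def)
  \<comment> \<open>\<open>M\<close> may charge 1, since coordinates can accumulate there;
    \<open>abs_circle\<close> is continuous on the whole line and returns that mass to the point
    0.\<close>
  define \<nu> where "\<nu> = distr M borel abs_circle"
  interpret M: real_distribution M by fact
  have abs: "abs_circle \<in> measurable borel borel"
    by (rule borel_measurable_continuous_onI[OF continuous_abs_circle])
  then have absM: "abs_circle \<in> measurable M borel" by (simp add: measurable_cong_sets[OF M.events_eq_borel refl])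
  have "(\<lambda>k. \<integral>x. f x \<partial>m (s k)) \<longlonglongrightarrow> (\<integral>x. f x \<partial>\<nu>)"
    if f: "continuous_on UNIV f" "\<And>x. \<bar>f x\<bar> \<le> B" for f :: "circle \<Rightarrow> real"
  proof -
    let ?g = "\<lambda>t. f (abs_circle t)"
    have fm: "f \<in> borel_measurable borel" by (rule borel_measurable_continuous_onI[OF f(1)])
    have g: "continuous_on UNIV ?g"
      using continuous_on_compose2[OF f(1) continuous_abs_circle] by simp
    then have gm: "?g \<in> borel_measurable borel" by (rule borel_measurable_continuous_onI)
    have "(\<lambda>k. integral\<^sup>L ((\<mu> \<circ> id \<circ> s) k) ?g) \<longlonglongrightarrow> integral\<^sup>L M ?g"
      by (rule weak_conv_imp_integral_bdd_continuous_conv[OF _ s(2,3)])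
        (use \<mu> f(2) g in \<open>auto simp: continuous_on_eq_continuous_at\<close>)
    moreover have "integral\<^sup>L ((\<mu> \<circ> id \<circ> s) k) ?g = (\<integral>x. f x \<partial>m (s k))" for k
      unfolding \<mu>_def comp_def id_def
      by (subst integral_distr[OF coord gm]) (simp add: abs_circle_coord)
    moreover have "integral\<^sup>L M ?g = (\<integral>x. f x \<partial>\<nu>)"
      unfolding \<nu>_def by (rule integral_distr[OF absM fm, symmetric])
    ultimately show ?thesis by simp
  qed
  moreover have "prob_space \<nu>" unfolding \<nu>_def by (rule M.prob_space_distr[OF absM])
  moreover have "sets \<nu> = sets borel" by (simp add: \<nu>_def)
  ultimately show ?thesis using s(1) by blast
qed

text \<open>Closed sets form a generator stable under intersections, and the indicator of a closed
  set is a decreasing limit of truncated multiples of the distance to it, which are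
  Lipschitz.\<close>

lemma finite_measure_eqI_lipschitz:
  fixes \<mu> \<nu> :: "'a::metric_space measure"
  assumes \<mu>: "finite_measure \<mu>" "sets \<mu> = sets borel" and \<nu>: "finite_measure \<nu>" "sets \<nu> = sets borel"
    and eq: "\<And>f N. holder_bound 1 f N \<Longrightarrow> (\<integral>x. f x \<partial>\<mu>) = (\<integral>x. f x \<partial>\<nu>)"
  shows "\<mu> = \<nu>"
proof -
  interpret \<mu>: finite_measure \<mu> by fact
  interpret \<nu>: finite_measure \<nu> by fact
  have sp: "space \<mu> = UNIV" "space \<nu> = UNIV" using sets_eq_imp_space_eq[OF \<mu>(2)] sets_eq_imp_space_eq[OF \<nu>(2)] by auto
  have closed_eq: "emeasure \<mu> F = emeasure \<nu> F" if F: "closed F" for F :: "'a set"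
  proof (cases "F = {}")
    case False
    define f where "f = (\<lambda>n x. max 0 (1 - real n * infdist x F))"
    have fb: "holder_bound 1 (f n) (real n + 1)" for n
    proof (rule holder_boundI)
      show "\<bar>f n x\<bar> \<le> real n + 1" for x
        using mult_nonneg_nonneg[OF of_nat_0_le_iff infdist_nonneg, of n x F] by (simp add: f_def max_def)
      fix x y
      have "f n x - f n y \<le> real n * \<bar>infdist x F - infdist y F\<bar>"
      proof -
        have "real n * (infdist y F - infdist x F) \<le> real n * \<bar>infdist x F - infdist y F\<bar>"
          by (intro mult_left_mono) auto
        then show ?thesis
          using mult_nonneg_nonneg[of "real n" "\<bar>infdist x F - infdist y F\<bar>"]
          unfolding f_def right_diff_distrib max_def by (simp only: split: if_split) linarith
      qed
      also have "\<dots> \<le> (real n + 1) * dist x y"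
        using infdist_triangle_abs[of x F y] by (intro mult_mono) auto
      finally show "f n x - f n y \<le> (real n + 1) * dist x y powr 1" by simp
    qed
    have lim: "(\<lambda>n. f n x) \<longlonglongrightarrow> indicator F x" for x
    proof (cases "x \<in> F")
      case True
      then have "f n x = 1" for n by (simp add: f_def)
      then show ?thesis using True by simp
    next
      case x: False
      then have d: "0 < infdist x F" using F False by (metis in_closed_iff_infdist_zero infdist_nonneg less_eq_real_def)
      obtain k :: nat where k: "1 / infdist x F < real k" using reals_Archimedean2 by blast
      have "f n x = 0" if "k \<le> n" for n
      proof -
        have "1 \<le> real n * infdist x F"
          using k d that by (metis divide_le_eq less_imp_le of_nat_le_iff order_trans)
        then show ?thesis by (simp add: f_def)
      qed
      then have "\<forall>\<^sub>F n in sequentially. f n x = 0" by (auto simp: eventually_sequentially)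
      then have "(\<lambda>n. f n x) \<longlonglongrightarrow> 0" by (rule tendsto_eventually)
      then show ?thesis using x by simp
    qed
    have "(\<lambda>n. \<integral>x. f n x \<partial>M) \<longlonglongrightarrow> measure M F" if M: "finite_measure M" "sets M = sets borel" for M
    proof -
      interpret M: finite_measure M by fact
      have meas: "borel_measurable M = borel_measurable (borel :: 'a measure)"
        by (rule measurable_cong_sets[OF M(2) refl])
      have FM: "F \<in> sets M" using F M(2) by simp
      have "(\<lambda>n. integral\<^sup>L M (f n)) \<longlonglongrightarrow> integral\<^sup>L M (indicator F :: 'a \<Rightarrow> real)"
      proof (rule integral_dominated_convergence[where w = "\<lambda>_. 1"])
        show "f n \<in> borel_measurable M" for n unfolding meas by (rule holder_bound_measurable[OF fb]) simp
        show "AE x in M. norm (f n x) \<le> 1" for n by (auto simp: f_def infdist_nonneg)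
      qed (use lim FM in auto)
      then show ?thesis using FM by (simp add: M.emeasure_eq_measure)
    qed
    from this[OF \<mu>] this[OF \<nu>] have "measure \<mu> F = measure \<nu> F"
      using eq[OF fb] LIMSEQ_unique by auto
    then show ?thesis by (simp add: \<mu>.emeasure_eq_measure \<nu>.emeasure_eq_measure)
  qed simp
  show ?thesis
  proof (rule measure_eqI_generator_eq[where E = "Collect closed" and \<Omega> = UNIV and A = "\<lambda>_. UNIV"])
    show "Int_stable (Collect closed)" by (auto simp: Int_stable_def)
    show "sets \<mu> = sigma_sets UNIV (Collect closed)" "sets \<nu> = sigma_sets UNIV (Collect closed)"
      unfolding \<mu>(2) \<nu>(2) borel_eq_closed by simp_all
  qed (use closed_eq in auto)
qed

text \<open>A spectral decomposition whose leading part is the rank-one map sending \<open>f\<close>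
  to its \<open>\<nu>\<close>-integral times \<open>h\<close>. Taking \<open>f = h\<close> shows
  that \<open>h\<close> has integral 1.\<close>

definition geometric_convergence ::
  "real \<Rightarrow> ((circle \<Rightarrow> real) \<Rightarrow> circle \<Rightarrow> real) \<Rightarrow> (circle \<Rightarrow> real) \<Rightarrow> real \<Rightarrow> circle measure \<Rightarrow>
   real \<Rightarrow> real \<Rightarrow> bool" where
  "geometric_convergence \<alpha> L h \<rho> \<nu> M r \<longleftrightarrow>
     prob_space \<nu> \<and> sets \<nu> = sets borel \<and> (\<exists>N. holder_bound \<alpha> h N) \<and> (\<exists>m>0. \<forall>x. m \<le> h x) \<and>
     0 < \<rho> \<and> (\<forall>x. L h x = \<rho> * h x) \<and> 0 < M \<and> 0 < r \<and> r < 1 \<and>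
     (\<forall>f N n. holder_bound \<alpha> f N \<longrightarrow>
        holder_bound \<alpha> (\<lambda>x. (L ^^ n) f x / \<rho> ^ n - (\<integral>y. f y \<partial>\<nu>) * h x) (M * r ^ n * N))"

lemma T_qlog_finite_fibre:
  assumes "0 < q"
  shows "finite {y. T_qlog q y = x}"
proof -
  obtain z1 z2 where "{y. T_qlog q y = x} = {z1, z2}"
    using fibre_matching[OF assms, of x x] unfolding fibre_matching_def[OF assms] by blast
  then show ?thesis by simp
qed

text \<open>The coefficient \<open>l\<close> of \<open>spectral_convergence\<close> must be
  recognised as an integral. Quotients of iterates at \<open>x0\<close> are integrals of
  \<open>f\<close> against probability measures and converge to \<open>l / l1\<close>, where
  \<open>l1\<close> belongs to the constant 1; every weak limit therefore represents the
  functional.\<close>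

theorem ex_geometric_convergence:
  assumes q: "0 < q" and \<alpha>: "0 < \<alpha>" and A: "log_regular q \<alpha> A C"
  shows "\<exists>h \<rho> \<nu> M r. geometric_convergence \<alpha> (transfer_op (T_qlog q) A) h \<rho> \<nu> M r"
proof -
  define L where "L = transfer_op (T_qlog q) A"
  fix x0 :: circle
  have "log_regular q \<alpha> A \<bar>C\<bar>"
    using A unfolding log_regular_def
    by (meson abs_ge_self mult_nonneg_nonneg mult_right_mono order_trans powr_ge_zero)
  then interpret P: paired_transfer "T_qlog q" A \<alpha> "\<bar>C\<bar> * (4 / \<alpha>)" "2 powr (- \<alpha>)" "\<bar>A x0\<bar> + \<bar>C\<bar>" x0
    by (intro paired_transfer_T_qlog q \<alpha>) auto
  obtain h \<rho> M r N m0 where h: "holder_bound \<alpha> h N" "0 < m0" "\<And>x. m0 \<le> h x" "0 < \<rho>" "\<And>x. L h x = \<rho> * h x"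
    "0 < M" "0 < r" "r < 1"
    and conv: "\<And>f N. holder_bound \<alpha> f N \<Longrightarrow>
        \<exists>l. \<forall>n. holder_bound \<alpha> (\<lambda>x. (L ^^ n) f x / \<rho> ^ n - l * h x) (M * r ^ n * N)"
    using P.spectral_convergence unfolding L_def by blast
  have lim: "(\<lambda>n. (L ^^ n) f x / \<rho> ^ n) \<longlonglongrightarrow> l * h x"
    if l: "\<And>n. holder_bound \<alpha> (\<lambda>x. (L ^^ n) f x / \<rho> ^ n - l * h x) (M * r ^ n * N)" for f l N x
  proof (rule LIM_zero_cancel, rule Lim_null_comparison)
    show "\<forall>\<^sub>F n in sequentially. norm ((L ^^ n) f x / \<rho> ^ n - l * h x) \<le> M * r ^ n * N"
      using holder_boundD(1)[OF l] by (intro always_eventually) auto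
    show "(\<lambda>n. M * r ^ n * N) \<longlonglongrightarrow> 0"
      using h by (intro tendsto_mult_left_zero tendsto_mult_right_zero LIMSEQ_realpow_zero) auto
  qed
  have Lh: "(L ^^ n) h x = \<rho> ^ n * h x" for n x
  proof (induction n arbitrary: x)
    case (Suc n)
    then have "(L ^^ n) h = (\<lambda>x. \<rho> ^ n * h x)" by blast
    then show ?case using h(5) by (simp add: L_def transfer_op_scale)
  qed simp
  have hpos: "0 < h x" for x using h(2) h(3)[of x] by linarith
  obtain l1 where l1: "\<And>n. holder_bound \<alpha> (\<lambda>x. (L ^^ n) (\<lambda>_. 1) x / \<rho> ^ n - l1 * h x) (M * r ^ n * 1)"
    using conv[OF holder_bound_const[of 1]] by auto
  have "\<exists>S c. finite S \<and> (\<forall>y\<in>S. 0 < c y) \<and> (\<forall>f. (L ^^ n) f x0 = (\<Sum>y\<in>S. c y * f y))" for n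
    unfolding L_def by (intro transfer_op_pow_sum T_qlog_finite_fibre q)
  then obtain S c where S: "\<And>n. finite (S n)" "\<And>n y. y \<in> S n \<Longrightarrow> 0 < c n y"
     "\<And>n f. (L ^^ n) f x0 = (\<Sum>y\<in>S n. c n y * f y)" by metis
  define Z where "Z = (\<lambda>n. (L ^^ n) (\<lambda>_. 1) x0)"
  have Z_sum: "Z n = (\<Sum>y\<in>S n. c n y)" for n by (simp add: Z_def S(3))
  have Npos: "0 < N" using holder_boundD(1)[OF h(1), of x0] hpos[of x0] by simp
  \<comment> \<open>From \<open>h \<le> N\<close>, iterates of 1 dominate those of \<open>h\<close>
    divided by \<open>N\<close>; this keeps \<open>l1\<close> away from 0.\<close>
  have Z_ge: "\<rho> ^ n * h x0 / N \<le> Z n" for n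
  proof -
    have "\<rho> ^ n * h x0 = (\<Sum>y\<in>S n. c n y * h y)" using Lh[of n x0] S(3) by simp
    also have "\<dots> \<le> (\<Sum>y\<in>S n. c n y * N)"
      using S(2) holder_boundD(1)[OF h(1)] by (intro sum_mono mult_left_mono) (auto simp: abs_le_iff less_imp_le)
    also have "\<dots> = Z n * N" by (simp add: Z_sum sum_distrib_right)
    finally show ?thesis using Npos by (simp add: divide_le_eq)
  qed
  have Zpos: "0 < Z n" for n
    using order_less_le_trans[OF _ Z_ge[of n]] h(4) hpos Npos by simp
  have "h x0 / N \<le> l1 * h x0"
  proof (rule LIMSEQ_le_const[OF lim[OF l1]])
    have "h x0 / N \<le> Z n / \<rho> ^ n" for n using Z_ge[of n] h(4) by (simp add: field_simps)
    then show "\<exists>k. \<forall>n\<ge>k. h x0 / N \<le> (L ^^ n) (\<lambda>_. 1) x0 / \<rho> ^ n" by (auto simp: Z_def)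
  qed
  then have l1pos: "0 < l1" using hpos[of x0] Npos
    by (smt (verit) divide_pos_pos zero_less_mult_pos2)
  \<comment> \<open>The point measure lives on its finite support with all subsets measurable;
    pushing it forward by \<open>id\<close> makes it a Borel measure on the circle.\<close>
  define m where "m = (\<lambda>n. distr (point_measure (S n) (\<lambda>y. ennreal (c n y / Z n))) borel id)"
  have idm: "id \<in> measurable (point_measure (S n) (\<lambda>y. ennreal (c n y / Z n))) borel" for n
    by (auto simp: measurable_def space_point_measure sets_point_measure)
  have m: "prob_space (m n)" "sets (m n) = sets borel" for n
  proof -
    have "prob_space (point_measure (S n) (\<lambda>y. ennreal (c n y / Z n)))"
    proof (rule prob_space_point_measure[OF S(1)])
      have "(\<Sum>y\<in>S n. ennreal (c n y / Z n)) = ennreal (\<Sum>y\<in>S n. c n y / Z n)"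
        using S(2) Zpos[of n] by (intro sum_ennreal) (auto simp: less_imp_le)
      also have "(\<Sum>y\<in>S n. c n y / Z n) = 1"
        using Zpos[of n] by (simp add: Z_sum flip: sum_divide_distrib)
      finally show "(\<Sum>y\<in>S n. ennreal (c n y / Z n)) = 1" by simp
    qed simp
    then show "prob_space (m n)" unfolding m_def by (rule prob_space.prob_space_distr[OF _ idm])
    show "sets (m n) = sets borel" by (simp add: m_def)
  qed
  have m_int: "(\<integral>x. f x \<partial>m n) = (L ^^ n) f x0 / Z n" if "f \<in> borel_measurable borel" for f n
  proof -
    have "(\<integral>x. f x \<partial>m n) = (\<Sum>y\<in>S n. (c n y / Z n) *\<^sub>R f y)"
      unfolding m_def integral_distr[OF idm that] id_apply
      using S(1,2) Zpos[of n] by (intro lebesgue_integral_point_measure_finite) (auto simp: less_imp_le)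
    then show ?thesis by (simp add: S(3) sum_divide_distrib)
  qed
  obtain \<nu> s where \<nu>: "prob_space \<nu>" "sets \<nu> = sets borel" "strict_mono (s :: nat \<Rightarrow> nat)"
    "\<And>f::circle\<Rightarrow>real. continuous_on UNIV f \<Longrightarrow> (\<And>x. \<bar>f x\<bar> \<le> 1) \<Longrightarrow> (\<lambda>k. \<integral>x. f x \<partial>m (s k)) \<longlonglongrightarrow> (\<integral>x. f x \<partial>\<nu>)"
    using circle_prob_convergent_subseq[of m 1] m by blast
  interpret \<nu>: prob_space \<nu> by fact
  have int: "l = l1 * (\<integral>y. f y \<partial>\<nu>)"
    if f: "holder_bound \<alpha> f B" and l: "\<And>n. holder_bound \<alpha> (\<lambda>x. (L ^^ n) f x / \<rho> ^ n - l * h x) (M * r ^ n * B)"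
    for f B l
  proof -
    have "(\<lambda>n. ((L ^^ n) f x0 / \<rho> ^ n) / ((L ^^ n) (\<lambda>_. 1) x0 / \<rho> ^ n)) \<longlonglongrightarrow> (l * h x0) / (l1 * h x0)"
      using l1pos hpos[of x0] by (intro tendsto_divide lim[OF l] lim[OF l1]) auto
    also have "(\<lambda>n. ((L ^^ n) f x0 / \<rho> ^ n) / ((L ^^ n) (\<lambda>_. 1) x0 / \<rho> ^ n)) = (\<lambda>n. \<integral>x. f x \<partial>m n)"
      using h(4) by (auto simp: m_int[OF holder_bound_measurable[OF f \<alpha>]] Z_def)
    finally have 1: "(\<lambda>k. \<integral>x. f x \<partial>m (s k)) \<longlonglongrightarrow> l / l1"
      using LIMSEQ_subseq_LIMSEQ[OF _ \<nu>(3)] hpos[of x0] by (fastforce simp: comp_def)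
    \<comment> \<open>The weak limit was obtained for functions bounded by 1, so \<open>f\<close> is
      rescaled; adding 1 keeps the divisor positive when \<open>B = 0\<close>.\<close>
    define B' where "B' = B + 1"
    have B': "0 < B'" using holder_boundD(3)[OF f] by (simp add: B'_def)
    have "(\<lambda>k. \<integral>x. 1 / B' * f x \<partial>m (s k)) \<longlonglongrightarrow> (\<integral>x. 1 / B' * f x \<partial>\<nu>)"
    proof (rule \<nu>(4))
      show "continuous_on UNIV (\<lambda>x. 1 / B' * f x)"
        by (intro continuous_intros holder_bound_continuous[OF f \<alpha>])
      show "\<bar>1 / B' * f x\<bar> \<le> 1" for x
        using holder_boundD(1)[OF f, of x] B' by (simp add: abs_mult B'_def)
    qed
    then have "(\<lambda>k. 1 / B' * (\<integral>x. f x \<partial>m (s k))) \<longlonglongrightarrow> 1 / B' * (\<integral>x. f x \<partial>\<nu>)" by simp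
    moreover have "(\<lambda>k. 1 / B' * (\<integral>x. f x \<partial>m (s k))) \<longlonglongrightarrow> 1 / B' * (l / l1)"
      by (intro tendsto_intros 1)
    ultimately have "1 / B' * (\<integral>x. f x \<partial>\<nu>) = 1 / B' * (l / l1)" by (rule LIMSEQ_unique)
    then show ?thesis using B' l1pos by (simp add: field_simps)
  qed
  \<comment> \<open>Absorbs \<open>l1\<close>, so that the coefficient of the eigenfunction becomes
    the integral itself.\<close>
  define h1 where "h1 = (\<lambda>x. l1 * h x)"
  have "holder_bound \<alpha> (\<lambda>x. (L ^^ n) f x / \<rho> ^ n - (\<integral>y. f y \<partial>\<nu>) * h1 x) (M * r ^ n * B)"
    if f: "holder_bound \<alpha> f B" for f B n
  proof -
    obtain l where l: "\<And>n. holder_bound \<alpha> (\<lambda>x. (L ^^ n) f x / \<rho> ^ n - l * h x) (M * r ^ n * B)"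
      using conv[OF f] by blast
    show ?thesis using l[of n] unfolding int[OF f l] by (simp add: h1_def mult_ac)
  qed
  moreover have "\<exists>N. holder_bound \<alpha> h1 N" unfolding h1_def using holder_bound_scale[OF h(1)] by blast
  moreover have "\<exists>m>0. \<forall>x. m \<le> h1 x" using h(2,3) l1pos
    by (intro exI[of _ "l1 * m0"]) (auto simp: h1_def)
  moreover have "L h1 x = \<rho> * h1 x" for x using h(5) by (simp add: h1_def L_def transfer_op_scale)
  ultimately show ?thesis unfolding geometric_convergence_def L_def[symmetric]
    using h \<nu>(1,2) by blast
qed

section \<open>Logarithmic moduli of continuity\<close>

lemma log_regular_log_Holder_space:
  assumes q: "0 < q" and A: "A \<in> log_Holder_space \<alpha> q"
  shows "\<exists>C. log_regular q \<alpha> A C"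
proof -
  obtain \<omega> C where \<omega>: "is_log_modulus \<alpha> q \<omega>" and C: "\<And>x y. \<bar>A x - A y\<bar> \<le> C * \<omega> (dist x y)"
    using A by (auto simp: log_Holder_space_def modulus_space_def)
  then obtain r0 where r0: "1 < r0" "\<And>r. 0 < r \<Longrightarrow> r \<le> 1 \<Longrightarrow> \<omega> r = r powr \<alpha> / (ln (r0 / r)) powr q"
    by (auto simp: is_log_modulus_def)
  \<comment> \<open>For \<open>d \<le> 1\<close> this gives
    \<open>c * (1 - ln d) \<le> ln r0 - ln d\<close>, so passing from \<open>r0\<close> to e costs
    only the factor \<open>c powr (- q)\<close>.\<close>
  define c where "c = min 1 (ln r0)"
  have c: "0 < c" "c \<le> 1" "c \<le> ln r0" using r0(1) by (auto simp: c_def)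
  have "log_regular q \<alpha> A (\<bar>C\<bar> * c powr (- q))"
    unfolding log_regular_def
  proof (intro allI)
    fix x y :: circle
    define d where "d = dist x y"
    show "\<bar>A x - A y\<bar> \<le> \<bar>C\<bar> * c powr (- q) * (dist x y powr \<alpha> * (1 - ln (dist x y)) powr (- q))"
    proof (cases "x = y")
      case False
      then have d: "0 < d" "d \<le> 1" using dist_circle_le_half[of x y] by (auto simp: d_def)
      have lnd: "ln d \<le> 0" using d by simp
      have u: "0 < c * (1 - ln d)" using c lnd by simp
      have "c * (1 - ln d) \<le> ln (r0 / d)"
      proof -
        have "c * (- ln d) \<le> - ln d" using c lnd mult_right_mono[of c 1 "- ln d"] by simp
        then show ?thesis using c d r0(1) by (simp add: ln_div algebra_simps)
      qed
      then have "ln (r0 / d) powr (- q) \<le> (c * (1 - ln d)) powr (- q)"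
        using u q by (intro powr_mono2') auto
      also have "\<dots> = c powr (- q) * (1 - ln d) powr (- q)" using c lnd by (intro powr_mult)
      finally have "d powr \<alpha> * ln (r0 / d) powr (- q) \<le> d powr \<alpha> * (c powr (- q) * (1 - ln d) powr (- q))"
        by (intro mult_left_mono) auto
      moreover have "\<omega> d = d powr \<alpha> * ln (r0 / d) powr (- q)"
        using r0(2)[OF d] by (simp add: powr_minus divide_inverse)
      ultimately have "\<bar>C\<bar> * \<omega> d \<le> \<bar>C\<bar> * (d powr \<alpha> * (c powr (- q) * (1 - ln d) powr (- q)))"
        by (intro mult_left_mono) auto
      moreover have "C * \<omega> d \<le> \<bar>C\<bar> * \<omega> d" using r0(2)[OF d] by (intro mult_right_mono) auto
      ultimately show ?thesis using C[of x y] by (simp add: d_def mult_ac)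
    qed simp
  qed
  then show ?thesis by blast
qed

lemma log_regular_exponent:
  assumes A: "log_regular q \<alpha> A C" and "\<beta> \<le> \<alpha>"
  shows "log_regular q \<beta> A \<bar>C\<bar>"
  unfolding log_regular_def
proof (intro allI)
  fix x y :: circle
  let ?k = "(1 - ln (dist x y)) powr (- q)"
  have "dist x y powr \<alpha> \<le> dist x y powr \<beta>"
    using dist_circle_le_half[of x y] assms(2) by (cases "x = y") (auto intro!: powr_mono')
  then have "\<bar>C\<bar> * (dist x y powr \<alpha> * ?k) \<le> \<bar>C\<bar> * (dist x y powr \<beta> * ?k)"
    by (intro mult_left_mono mult_right_mono) auto
  moreover have "C * (dist x y powr \<alpha> * ?k) \<le> \<bar>C\<bar> * (dist x y powr \<alpha> * ?k)"
    by (intro mult_right_mono) auto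
  ultimately show "\<bar>A x - A y\<bar> \<le> \<bar>C\<bar> * (dist x y powr \<beta> * ?k)"
    using A unfolding log_regular_def by (meson order_trans)
qed

section \<open>A concave modulus with the prescribed germ\<close>

lemma DERIV_log_power:
  fixes a c U r :: real
  assumes "0 < r" "ln r < U"
  shows "((\<lambda>r. r powr a * (U - ln r) powr c) has_real_derivative
    a * (r powr (a - 1) * (U - ln r) powr c) - c * (r powr (a - 1) * (U - ln r) powr (c - 1))) (at r)"
proof -
  have 1: "((\<lambda>r. r powr a) has_real_derivative a * r powr (a - 1)) (at r)"
    by (rule has_real_derivative_powr[OF assms(1)])
  have 2: "((\<lambda>r. (U - ln r) powr c) has_real_derivative c * (U - ln r) powr (c - 1) * - (1 / r)) (at r)"
    using assms by (intro DERIV_chain2[OF has_real_derivative_powr]) (auto intro!: derivative_eq_intros)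
  have "r powr a = r powr (a - 1) * r" using assms(1) by (simp add: powr_diff)
  then show ?thesis using DERIV_mult[OF 1 2] assms(1) by (simp add: algebra_simps)
qed

text \<open>With \<open>u = U - ln r\<close> the second derivative is a positive factor times
  \<open>\<alpha> * (\<alpha> - 1) + (2 * \<alpha> - 1) * (q / u) + (q / u) * ((q + 1) / u)\<close>.
  The two conditions on \<open>U\<close> bound each of the last two terms by
  \<open>\<alpha> * (1 - \<alpha>) / 2\<close>.\<close>

lemma concave_log_power:
  fixes \<alpha> q U :: real
  assumes \<alpha>: "0 < \<alpha>" "\<alpha> < 1" and q: "0 < q" and U: "q + 1 \<le> U" "2 * q / (\<alpha> * (1 - \<alpha>)) \<le> U"
  shows "concave_on {0<..1} (\<lambda>r. r powr \<alpha> * (U - ln r) powr (- q))"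
proof (rule f''_le0_imp_concave)
  show "convex {0<..1::real}" by simp
  fix r :: real assume "r \<in> {0<..1}"
  then have r: "0 < r" "r \<le> 1" by auto
  define u where "u = U - ln r"
  have "ln r \<le> 0" using r by simp
  then have u: "U \<le> u" "0 < u" using U q by (auto simp: u_def)
  show "((\<lambda>r. r powr \<alpha> * (U - ln r) powr (- q)) has_real_derivative
      \<alpha> * (r powr (\<alpha> - 1) * (U - ln r) powr (- q)) + q * (r powr (\<alpha> - 1) * (U - ln r) powr (- q - 1))) (at r)"
    using DERIV_log_power[OF r(1), of U \<alpha> "- q"] u(2) by (simp add: u_def)
  define f'' where "f'' = (\<lambda>r. (\<alpha> * (\<alpha> - 1)) * (r powr (\<alpha> - 2) * (U - ln r) powr (- q))
      + ((2 * \<alpha> - 1) * q) * (r powr (\<alpha> - 2) * (U - ln r) powr (- q - 1))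
      + (q * (q + 1)) * (r powr (\<alpha> - 2) * (U - ln r) powr (- q - 2)))"
  show "((\<lambda>r. \<alpha> * (r powr (\<alpha> - 1) * (U - ln r) powr (- q)) + q * (r powr (\<alpha> - 1) * (U - ln r) powr (- q - 1)))
      has_real_derivative f'' r) (at r)"
    using DERIV_add[OF DERIV_cmult[OF DERIV_log_power[OF r(1), of U "\<alpha> - 1" "- q"], of \<alpha>]
        DERIV_cmult[OF DERIV_log_power[OF r(1), of U "\<alpha> - 1" "- q - 1"], of q]] u(2)
    by (simp add: u_def f''_def algebra_simps)
  have a1: "0 < \<alpha> * (1 - \<alpha>)" using \<alpha> by simp
  have 1: "q / u \<le> \<alpha> * (1 - \<alpha>) / 2"
  proof -
    have "2 * q \<le> U * (\<alpha> * (1 - \<alpha>))" using U(2) a1 by (simp add: divide_le_eq)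
    also have "\<dots> \<le> u * (\<alpha> * (1 - \<alpha>))" using u a1 by (intro mult_right_mono) auto
    finally show ?thesis using u(2) by (simp add: field_simps)
  qed
  have 2: "(q + 1) / u \<le> 1" using U u by simp
  have "(q / u) * ((q + 1) / u) \<le> (\<alpha> * (1 - \<alpha>) / 2) * 1"
    using 1 2 q u(2) a1 by (intro mult_mono) auto
  moreover have "(2 * \<alpha> - 1) * (q / u) \<le> 1 * (\<alpha> * (1 - \<alpha>) / 2)"
    using 1 \<alpha> q u(2) mult_right_mono[of "2 * \<alpha> - 1" 1 "q / u"] by simp
  moreover have "\<alpha> * (\<alpha> - 1) = - (\<alpha> * (1 - \<alpha>))" by (simp add: algebra_simps)
  ultimately have "\<alpha> * (\<alpha> - 1) + (2 * \<alpha> - 1) * (q / u) + (q / u) * ((q + 1) / u) \<le> 0" by linarith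
  then have "(r powr (\<alpha> - 2) * u powr (- q)) *
      (\<alpha> * (\<alpha> - 1) + (2 * \<alpha> - 1) * (q / u) + (q / u) * ((q + 1) / u)) \<le> 0"
    by (intro mult_nonneg_nonpos) auto
  also have "(r powr (\<alpha> - 2) * u powr (- q)) *
      (\<alpha> * (\<alpha> - 1) + (2 * \<alpha> - 1) * (q / u) + (q / u) * ((q + 1) / u)) = f'' r"
  proof -
    have p: "u powr (- q - 1) = u powr (- q) / u" "u powr (- q - 2) = u powr (- q) / (u * u)"
      using u(2) by (simp_all add: powr_diff power2_eq_square)
    have "Y * X * (a + c * (q / u) + (q / u) * ((q + 1) / u))
        = a * (Y * X) + (c * q) * (Y * (X / u)) + (q * (q + 1)) * (Y * (X / (u * u)))" for X Y a c
      using u(2) by (simp add: field_simps)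
    then show ?thesis unfolding f''_def u_def[symmetric] p .
  qed
  finally show "f'' r \<le> 0" .
qed

lemma log_power_mono:
  fixes \<alpha> q U :: real
  assumes "0 < \<alpha>" "0 < q" "0 < U" "0 < x" "x \<le> y" "y \<le> 1"
  shows "x powr \<alpha> * (U - ln x) powr (- q) \<le> y powr \<alpha> * (U - ln y) powr (- q)"
proof -
  have "ln x \<le> ln y" "ln y \<le> 0" using assms by auto
  then have "(U - ln x) powr (- q) \<le> (U - ln y) powr (- q)" using assms by (intro powr_mono2'; linarith)
  moreover have "x powr \<alpha> \<le> y powr \<alpha>" using assms by (intro powr_mono2) auto
  ultimately show ?thesis by (intro mult_mono) auto
qed

text \<open>Without an admissible modulus the union defining \<open>log_Holder_space\<close> would
  be empty. Here \<open>U\<close> is \<open>ln r\<^sub>0\<close>, taken large enough for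
  \<open>concave_log_power\<close>.\<close>

lemma ex_log_modulus:
  fixes \<alpha> q :: real
  assumes \<alpha>: "0 < \<alpha>" "\<alpha> < 1" and q: "0 < q"
  shows "\<exists>\<omega>. is_log_modulus \<alpha> q \<omega>"
proof -
  define U where "U = q + 1 + 2 * q / (\<alpha> * (1 - \<alpha>))"
  have U: "q + 1 \<le> U" "2 * q / (\<alpha> * (1 - \<alpha>)) \<le> U" "0 < U" using \<alpha> q by (auto simp: U_def add_pos_nonneg)
  define w where "w = (\<lambda>r. r powr \<alpha> * (U - ln r) powr (- q))"
  \<comment> \<open>Extended by a constant beyond 1; as the germ increases on \<open>(0, 1]\<close>,
    this keeps both monotonicity and concavity.\<close>
  define \<omega> where "\<omega> = (\<lambda>r. if r \<le> 0 then 0 else w (min r 1))"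
  have w_mono: "w x \<le> w y" if "0 < x" "x \<le> y" "y \<le> 1" for x y
    unfolding w_def using that \<alpha> q U by (intro log_power_mono) auto
  have w_nonneg: "0 \<le> w x" for x by (simp add: w_def)
  have w_cont: "continuous_on {0<..1} w"
    unfolding w_def
  proof (intro continuous_intros)
    show "\<forall>x\<in>{0<..1}. U - ln x \<noteq> 0"
    proof
      fix x :: real assume "x \<in> {0<..1}"
      then have "ln x \<le> 0" by simp
      then show "U - ln x \<noteq> 0" using U by auto
    qed
  qed auto
  have w_conc: "concave_on {0<..1} w"
    unfolding w_def by (rule concave_log_power[OF \<alpha> q U(1,2)])
  \<comment> \<open>Concavity with left end point 0, obtained as a limit: the end point
    \<open>s / real (Suc n)\<close> tends to 0 and its nonnegative term is dropped.\<close>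
  have w_scale: "t * w s \<le> w (t * s)" if t: "0 < t" "t \<le> 1" and s: "0 < s" "s \<le> 1" for t s
  proof (rule tendsto_lowerbound)
    have ts: "0 < t * s" "t * s \<le> 1" using t s by (auto simp: mult_le_one)
    let ?z = "\<lambda>n. (1 - t) * (s / real (Suc n)) + t * s"
    have zn: "0 < ?z n" "?z n \<le> 1" for n
    proof -
      have "0 < s / real (Suc n)" "s / real (Suc n) \<le> s" using s by (auto simp: divide_le_eq mult_le_cancel_left1)
      then have "0 \<le> (1 - t) * (s / real (Suc n))" "(1 - t) * (s / real (Suc n)) \<le> (1 - t) * s"
        using t mult_left_mono[of "s / real (Suc n)" s "1 - t"] by auto
      then show "0 < ?z n" "?z n \<le> 1" using ts s by (auto simp: algebra_simps)
    qed
    have "?z \<longlonglongrightarrow> (1 - t) * 0 + t * s"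
      by (intro tendsto_intros) (use lim_const_over_n[of s, THEN LIMSEQ_Suc] in simp)
    then show "(\<lambda>n. w (?z n)) \<longlonglongrightarrow> w (t * s)"
      using continuous_on_tendsto_compose[OF w_cont, of ?z "t * s" sequentially] ts zn by auto
    have "t * w s \<le> w (?z n)" for n
    proof -
      have "s / real (Suc n) \<in> {0<..1}" using s by (auto simp: divide_le_eq)
      then have "(1 - t) * w (s / real (Suc n)) + t * w s \<le> w (?z n)"
        using concave_onD[OF w_conc, of t "s / real (Suc n)" s] t s unfolding real_scaleR_def by simp
      then show ?thesis using t w_nonneg[of "s / real (Suc n)"] by (smt (verit) mult_nonneg_nonneg)
    qed
    then show "\<forall>\<^sub>F n in sequentially. t * w s \<le> w (?z n)" by (intro always_eventually) auto
  qed simp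
  have \<omega>_mono: "\<omega> x \<le> \<omega> y" if "x \<le> y" for x y
    using that w_mono[of "min x 1" "min y 1"] w_nonneg by (auto simp: \<omega>_def)
  have \<omega>_nonneg: "0 \<le> \<omega> x" for x by (simp add: \<omega>_def w_nonneg)
  have "continuous_on {0..} \<omega>"
    unfolding continuous_on_eq_continuous_within
  proof
    fix x :: real assume x: "x \<in> {0..}"
    show "continuous (at x within {0..}) \<omega>"
    proof (cases "x = 0")
      case True
      have "(\<omega> \<longlongrightarrow> 0) (at 0 within {0..})"
      proof (rule Lim_null_comparison)
        have "\<omega> r \<le> r powr \<alpha> * U powr (- q)" if "0 \<le> r" for r
        proof (cases "r = 0")
          case False
          then have m: "0 < min r 1" "min r 1 \<le> 1" using that by auto
          then have "ln (min r 1) \<le> 0" by (simp only: ln_le_zero_iff)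
          then have "(U - ln (min r 1)) powr (- q) \<le> U powr (- q)" using U q by (intro powr_mono2'; linarith)
          moreover have "min r 1 powr \<alpha> \<le> r powr \<alpha>" using m \<alpha> by (intro powr_mono2) auto
          ultimately have "w (min r 1) \<le> r powr \<alpha> * U powr (- q)"
            unfolding w_def by (intro mult_mono) auto
          then show ?thesis using False that by (simp add: \<omega>_def)
        qed (simp add: \<omega>_def)
        then show "\<forall>\<^sub>F r in at 0 within {0..}. norm (\<omega> r) \<le> r powr \<alpha> * U powr (- q)"
          unfolding eventually_at_filter by (intro always_eventually) (simp add: \<omega>_nonneg)
        have "((\<lambda>r. r powr \<alpha>) \<longlongrightarrow> 0) (at 0 within {0..})"
          by (rule tendsto_zero_powrI[where b = \<alpha>]) (use \<alpha> in \<open>auto simp: eventually_at_filter\<close>)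
        then show "((\<lambda>r. r powr \<alpha> * U powr (- q)) \<longlongrightarrow> 0) (at 0 within {0..})"
          by (rule tendsto_mult_left_zero)
      qed
      then show ?thesis using True by (simp add: continuous_within \<omega>_def)
    next
      case False
      then have "0 < x" using x by auto
      have "continuous_on {0<..} (\<lambda>r. w (min r 1))"
        by (intro continuous_on_compose2[OF w_cont] continuous_intros) auto
      then have "continuous_on {0<..} \<omega>"
        by (rule continuous_on_eq) (simp add: \<omega>_def)
      then have "isCont \<omega> x" using \<open>0 < x\<close> by (simp add: continuous_on_eq_continuous_at)
      then show ?thesis by (rule continuous_at_imp_continuous_within)
    qed
  qed
  moreover have "mono_on {0..} \<omega>" using \<omega>_mono by (auto intro!: mono_onI)
  moreover have "concave_on {0..} \<omega>"
    unfolding concave_on_iff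
  proof (intro conjI ballI allI impI)
    have half: "v * \<omega> y \<le> \<omega> (v * y)" if "0 \<le> v" "v \<le> 1" "0 \<le> y" for v y :: real
    proof (cases "v = 0 \<or> y = 0")
      case False
      then have p: "0 < v" "0 < min y 1" using that by auto
      then have "v * w (min y 1) \<le> w (v * min y 1)" using that by (intro w_scale) auto
      also have "v * min y 1 \<le> min (v * y) 1"
        using that p by (auto simp: min_def mult_le_one mult_left_le)
      then have "w (v * min y 1) \<le> w (min (v * y) 1)"
        using p by (intro w_mono) auto
      finally show ?thesis using p False that by (simp add: \<omega>_def not_le mult_less_0_iff mult_le_0_iff)
    qed (auto simp: \<omega>_def)
    fix x y u v :: real
    assume x: "x \<in> {0..}" and y: "y \<in> {0..}" and uv: "0 \<le> u" "0 \<le> v" "u + v = 1"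
    show "u * \<omega> x + v * \<omega> y \<le> \<omega> (u *\<^sub>R x + v *\<^sub>R y)"
    proof (cases "x = 0 \<or> y = 0")
      case True
      then show ?thesis using half[of u x] half[of v y] x y uv by (auto simp: \<omega>_def)
    next
      case False
      then have p: "min x 1 \<in> {0<..1}" "min y 1 \<in> {0<..1}" using x y by auto
      let ?m = "u * min x 1 + v * min y 1"
      have m: "?m \<in> {0<..1}"
        using convexD[of "{0<..1::real}", OF _ p uv] by simp
      have "?m \<le> u * x + v * y" using uv by (intro add_mono mult_left_mono) auto
      then have mle: "?m \<le> min (u * x + v * y) 1" using m by auto
      have "u * w (min x 1) + v * w (min y 1) \<le> w ?m"
        using w_conc p uv unfolding concave_on_iff by auto
      also have "\<dots> \<le> w (min (u * x + v * y) 1)" using m mle by (intro w_mono) auto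
      finally show ?thesis using x y False m mle by (auto simp: \<omega>_def)
    qed
  qed simp
  moreover have "\<omega> r = r powr \<alpha> / ln (exp U / r) powr q" if "r \<in> {0<..1}" for r
  proof -
    have "ln (exp U / r) = U - ln r" using that by (simp add: ln_div)
    then show ?thesis using that by (simp add: \<omega>_def w_def powr_minus divide_inverse)
  qed
  ultimately show ?thesis unfolding is_log_modulus_def is_modulus_def using U(3)
    by (intro exI[of _ \<omega>]) (auto simp: \<omega>_def intro!: exI[of _ "exp U"])
qed

lemma Holder_space_subset_log_Holder_space:
  fixes A :: "circle \<Rightarrow> real"
  assumes \<alpha>: "0 < \<alpha>" "\<alpha> < 1" "\<alpha> < \<gamma>" and q: "0 < q" and A: "A \<in> Holder_space \<gamma>"
  shows "A \<in> log_Holder_space \<alpha> q"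
proof -
  obtain \<omega> where \<omega>: "is_log_modulus \<alpha> q \<omega>" using ex_log_modulus[OF \<alpha>(1,2) q] by blast
  then obtain r0 where r0: "1 < r0" "\<And>r. 0 < r \<Longrightarrow> r \<le> 1 \<Longrightarrow> \<omega> r = r powr \<alpha> / (ln (r0 / r)) powr q"
    and \<omega>0: "\<omega> 0 = 0"
    by (auto simp: is_log_modulus_def is_modulus_def)
  let ?H = "Hol_const (power_modulus \<gamma>) A"
  note H = Hol_const_nonneg_bound[OF A]
  \<comment> \<open>Chosen so that the \<open>q\<close>-th power of \<open>y powr p / p\<close>,
    which bounds \<open>ln y\<close>, is a constant times
    \<open>y powr (\<gamma> - \<alpha>)\<close>, the surplus of Hoelder regularity.\<close>
  define p where "p = (\<gamma> - \<alpha>) / q"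
  have p: "0 < p" "p * q = \<gamma> - \<alpha>" using \<alpha> q by (auto simp: p_def)
  define K where "K = r0 powr (\<gamma> - \<alpha>) / p powr q"
  have key: "d powr \<gamma> \<le> K * \<omega> d" if d: "0 < d" "d \<le> 1" for d
  proof -
    have "1 < r0 / d" using r0(1) d by (simp add: less_divide_eq)
    then have l: "0 < ln (r0 / d)" "ln (r0 / d) \<le> (r0 / d) powr p / p"
      using p by (auto intro!: ln_powr_bound)
    have "ln (r0 / d) powr q \<le> ((r0 / d) powr p / p) powr q"
      using l q by (intro powr_mono2) auto
    also have "\<dots> = K / d powr (\<gamma> - \<alpha>)"
    proof -
      have "((r0 / d) powr p / p) powr q = (r0 / d) powr (p * q) / p powr q"
        by (simp only: powr_divide powr_powr)
      also have "(r0 / d) powr (p * q) = r0 powr (\<gamma> - \<alpha>) / d powr (\<gamma> - \<alpha>)"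
        unfolding p(2) by (rule powr_divide)
      finally show ?thesis by (simp add: K_def)
    qed
    finally have "ln (r0 / d) powr q * d powr (\<gamma> - \<alpha>) \<le> K" using d by (simp add: pos_le_divide_eq)
    then have "ln (r0 / d) powr q * d powr (\<gamma> - \<alpha>) * \<omega> d \<le> K * \<omega> d"
      using r0(2)[OF d] by (intro mult_right_mono) auto
    moreover have "ln (r0 / d) powr q * d powr (\<gamma> - \<alpha>) * \<omega> d = d powr \<gamma>"
      using r0(2)[OF d] l(1) d by (simp flip: powr_add)
    ultimately show ?thesis by simp
  qed
  have "\<bar>A x - A y\<bar> \<le> (?H * K) * \<omega> (dist x y)" for x y
  proof (cases "x = y")
    case False
    then have "dist x y powr \<gamma> \<le> K * \<omega> (dist x y)" using dist_circle_le_half[of x y] by (intro key) auto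
    then have "?H * dist x y powr \<gamma> \<le> ?H * (K * \<omega> (dist x y))" using H(1) by (rule mult_left_mono)
    then show ?thesis using H(2)[of x y] by (simp add: mult.assoc)
  qed (simp add: \<omega>0)
  then have "A \<in> modulus_space \<omega>" unfolding modulus_space_def by blast
  then show ?thesis using \<omega> unfolding log_Holder_space_def by blast
qed

section \<open>Spectral gap, uniqueness and decay of correlations\<close>

lemma borel_measurable_T_qlog:
  assumes "0 < q"
  shows "T_qlog q \<in> measurable borel borel"
proof (rule borel_measurable_continuous_onI, rule continuous_onI)
  fix x :: circle and d :: real assume "0 < d"
  have "dist (T_qlog q x') (T_qlog q x) \<le> d" if "dist x' x < d / (2 + q)" for x'
  proof -
    have "(2 + q) * dist x' x \<le> (2 + q) * (d / (2 + q))" using that assms by (intro mult_left_mono) auto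
    then show ?thesis using T_qlog_lipschitz[OF assms, of x' x] assms by simp
  qed
  then show "\<exists>e>0. \<forall>x'\<in>UNIV. dist x' x < e \<longrightarrow> dist (T_qlog q x') (T_qlog q x) \<le> d"
    using \<open>0 < d\<close> assms by (intro exI[of _ "d / (2 + q)"]) auto
qed

lemma holder_bound_comp_T_qlog:
  assumes "0 < q" "\<alpha> \<le> 1" "holder_bound 1 g N"
  shows "holder_bound \<alpha> (\<lambda>x. g (T_qlog q x)) (N * (2 + q))"
proof (rule holder_bound_exponent[OF _ assms(2)], rule holder_boundI)
  note g = holder_boundD[OF assms(3)]
  have "N * 1 \<le> N * (2 + q)" using g(3) assms(1) by (intro mult_left_mono) auto
  then show "\<bar>g (T_qlog q x)\<bar> \<le> N * (2 + q)" for x using g(1)[of "T_qlog q x"] by simp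
  fix x y
  have "g (T_qlog q x) - g (T_qlog q y) \<le> N * dist (T_qlog q x) (T_qlog q y)"
    using g(2)[of "T_qlog q x" "T_qlog q y"] by simp
  also have "\<dots> \<le> N * ((2 + q) * dist x y)"
    using g(3) T_qlog_lipschitz[OF assms(1)] by (intro mult_left_mono)
  finally show "g (T_qlog q x) - g (T_qlog q y) \<le> N * (2 + q) * dist x y powr 1" by simp
qed

lemma circle_positive_lower_bound:
  fixes f :: "circle \<Rightarrow> real"
  assumes "continuous_on UNIV f" "\<And>x. 0 < f x"
  shows "\<exists>m>0. \<forall>x. m \<le> f x"
proof -
  have "compact (abs_circle ` {0..1})"
    by (intro compact_continuous_image continuous_on_subset[OF continuous_abs_circle]) auto
  moreover have "abs_circle ` {0..1} = UNIV"
  proof -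
    have "z \<in> abs_circle ` {0..1}" for z
      using circle_coord_bounds[of z] by (intro image_eqI[of _ _ "circle_coord z"]) (auto simp: abs_circle_coord)
    then show ?thesis by blast
  qed
  ultimately obtain z where "\<And>x. f z \<le> f x"
    using continuous_attains_inf[of UNIV f] assms(1) by auto
  then show ?thesis using assms(2)[of z] by blast
qed

lemma finite_measure_density:
  assumes f: "integrable \<nu> f" "\<And>x. 0 \<le> f x"
  shows "finite_measure (density \<nu> (\<lambda>x. ennreal (f x)))"
proof (rule finite_measureI)
  have "emeasure (density \<nu> (\<lambda>x. ennreal (f x))) (space \<nu>) = (\<integral>\<^sup>+x. ennreal (f x) \<partial>\<nu>)"
    using f(1) by (auto simp: emeasure_density intro!: nn_integral_cong)
  also have "\<dots> = ennreal (\<integral>x. f x \<partial>\<nu>)" using f by (intro nn_integral_eq_integral) auto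
  finally show "emeasure (density \<nu> (\<lambda>x. ennreal (f x))) (space (density \<nu> (\<lambda>x. ennreal (f x)))) \<noteq> \<infinity>"
    by simp
qed

text \<open>Bundles the spectral data for one exponent, so that decay of correlations can interpret
  it at two exponents for the same potential.\<close>

locale gap_measure =
  fixes q \<alpha> :: real and A h :: "circle \<Rightarrow> real" and \<rho> :: real and \<nu> :: "circle measure" and M r :: real
  assumes q_pos: "0 < q" and alpha: "0 < \<alpha>" "\<alpha> \<le> 1"
    and gap: "geometric_convergence \<alpha> (transfer_op (T_qlog q) A) h \<rho> \<nu> M r"
begin

abbreviation T where "T \<equiv> T_qlog q"
abbreviation L where "L \<equiv> transfer_op T A"

lemma prob_nu: "prob_space \<nu>" and sets_nu: "sets \<nu> = sets borel"
  and h_holder: "\<exists>N. holder_bound \<alpha> h N" and h_lower: "\<exists>m>0. \<forall>x. m \<le> h x"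
  and rho_pos: "0 < \<rho>" and L_h: "L h x = \<rho> * h x"
  and rate: "0 < M" "0 < r" "r < 1"
  and gap_bound: "holder_bound \<alpha> f N \<Longrightarrow>
    holder_bound \<alpha> (\<lambda>x. (L ^^ n) f x / \<rho> ^ n - (\<integral>y. f y \<partial>\<nu>) * h x) (M * r ^ n * N)"
  using gap unfolding geometric_convergence_def by blast+

sublocale \<nu>: prob_space \<nu> by (rule prob_nu)

lemma measurable_nu: "measurable \<nu> N = measurable borel N"
  by (rule measurable_cong_sets[OF sets_nu refl])

lemma holder_integrable: "holder_bound \<alpha> f N \<Longrightarrow> integrable \<nu> f"
  by (rule holder_bound_integrable[OF \<nu>.finite_measure_axioms sets_nu _ alpha(1)])

lemma holder_measurable: "holder_bound \<alpha> f N \<Longrightarrow> f \<in> borel_measurable \<nu>"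
  using holder_integrable by blast

lemma h_pos: "0 < h x"
  using h_lower by (meson order_less_le_trans)

lemma abs_integral_le: "holder_bound \<alpha> f N \<Longrightarrow> \<bar>\<integral>y. f y \<partial>\<nu>\<bar> \<le> N"
proof -
  assume f: "holder_bound \<alpha> f N"
  have "\<bar>\<integral>y. f y \<partial>\<nu>\<bar> \<le> (\<integral>y. \<bar>f y\<bar> \<partial>\<nu>)" by (rule integral_abs_bound)
  also have "\<dots> \<le> (\<integral>y. N \<partial>\<nu>)"
    using holder_integrable[OF f] holder_boundD(1)[OF f] by (intro integral_mono) auto
  finally show ?thesis by (simp add: \<nu>.prob_space)
qed

lemma iterates_tendsto:
  assumes "holder_bound \<alpha> f N"
  shows "(\<lambda>n. (L ^^ n) f x / \<rho> ^ n) \<longlonglongrightarrow> (\<integral>y. f y \<partial>\<nu>) * h x"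
proof (rule LIM_zero_cancel, rule Lim_null_comparison)
  show "\<forall>\<^sub>F n in sequentially. norm ((L ^^ n) f x / \<rho> ^ n - (\<integral>y. f y \<partial>\<nu>) * h x) \<le> M * r ^ n * N"
    using holder_boundD(1)[OF gap_bound[OF assms]] by (intro always_eventually) auto
  show "(\<lambda>n. M * r ^ n * N) \<longlonglongrightarrow> 0"
    using rate by (intro tendsto_mult_left_zero tendsto_mult_right_zero LIMSEQ_realpow_zero) auto
qed

text \<open>Boundedness is read off from the convergence bound at \<open>n = 1\<close>, which writes
  \<open>L f / \<rho>\<close> as a small term plus a multiple of \<open>h\<close>.\<close>

lemma L_holder: "\<exists>K. \<forall>f N. holder_bound \<alpha> f N \<longrightarrow> holder_bound \<alpha> (L f) (K * N)"
proof -
  obtain B where B: "holder_bound \<alpha> h B" using h_holder by blast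
  have "holder_bound \<alpha> (L f) ((\<rho> * (M * r + B)) * N)" if f: "holder_bound \<alpha> f N" for f N
  proof -
    let ?I = "\<integral>y. f y \<partial>\<nu>"
    have "holder_bound \<alpha> (\<lambda>x. \<bar>\<rho>\<bar> * ((L f x / \<rho> - ?I * h x) + ?I * h x)) (\<bar>\<bar>\<rho>\<bar>\<bar> * (M * r * N + \<bar>?I\<bar> * B))"
      using gap_bound[OF f, of 1]
      by (intro holder_bound_scale holder_bound_add holder_bound_scale[OF B]) auto
    then have 1: "holder_bound \<alpha> (L f) (\<rho> * (M * r * N + \<bar>?I\<bar> * B))" using rho_pos by simp
    have "\<bar>?I\<bar> * B \<le> N * B"
      using abs_integral_le[OF f] holder_boundD(3)[OF B] by (rule mult_right_mono)
    then have "\<rho> * (M * r * N + \<bar>?I\<bar> * B) \<le> \<rho> * ((M * r + B) * N)"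
      using rho_pos by (intro mult_left_mono) (auto simp: algebra_simps)
    then show ?thesis using 1 by (simp add: holder_bound_mono mult.assoc)
  qed
  then show ?thesis by blast
qed

text \<open>The iterates of \<open>f\<close> shifted by one step are the iterates of
  \<open>L f\<close>; the two resulting expressions for the limit must agree.\<close>

lemma eigenmeasure:
  assumes f: "holder_bound \<alpha> f N"
  shows "(\<integral>x. L f x \<partial>\<nu>) = \<rho> * (\<integral>x. f x \<partial>\<nu>)"
proof -
  fix x
  obtain K where K: "holder_bound \<alpha> (L f) (K * N)" using L_holder f by blast
  have "(\<lambda>n. \<rho> * ((L ^^ Suc n) f x / \<rho> ^ Suc n)) \<longlonglongrightarrow> \<rho> * ((\<integral>y. f y \<partial>\<nu>) * h x)"
    by (intro tendsto_intros LIMSEQ_Suc[OF iterates_tendsto[OF f]])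
  also have "(\<lambda>n. \<rho> * ((L ^^ Suc n) f x / \<rho> ^ Suc n)) = (\<lambda>n. (L ^^ n) (L f) x / \<rho> ^ n)"
    using rho_pos by (simp add: funpow_swap1)
  finally have "\<rho> * ((\<integral>y. f y \<partial>\<nu>) * h x) = (\<integral>y. L f y \<partial>\<nu>) * h x"
    using iterates_tendsto[OF K, of x] by (rule LIMSEQ_unique)
  then show ?thesis using h_pos[of x] by simp
qed

section \<open>The RPF property and the spectral gap\<close>

lemma RPF_triple_nu: "RPF_triple (Holder_space \<alpha>) L h \<rho> \<nu>"
proof -
  have "h \<in> Holder_space \<alpha>" using h_holder holder_bound_imp_Holder_space by blast
  moreover have "(\<integral>x. L f x \<partial>\<nu>) = \<rho> * (\<integral>x. f x \<partial>\<nu>)" if "f \<in> Holder_space \<alpha>" for f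
    using eigenmeasure[OF holder_bound_Holder_norm[OF that alpha(1)]] .
  ultimately show ?thesis unfolding RPF_triple_def
    using h_pos rho_pos L_h sets_nu \<nu>.finite_measure_axioms \<nu>.emeasure_space_1 by auto
qed

lemma RPF_with_spectral_gap_T_qlog: "RPF_with_spectral_gap (Holder_space \<alpha>) (Holder_norm \<alpha>) L"
proof -
  have hn: "holder_bound \<alpha> f (Holder_norm \<alpha> f)" if "f \<in> Holder_space \<alpha>" for f :: "circle \<Rightarrow> real"
    by (rule holder_bound_Holder_norm[OF that alpha(1)])
  obtain K where K: "\<And>f N. holder_bound \<alpha> f N \<Longrightarrow> holder_bound \<alpha> (L f) (K * N)" using L_holder by blast
  have "acts_continuously (Holder_space \<alpha>) (Holder_norm \<alpha>) L"
    unfolding acts_continuously_def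
  proof (intro conjI exI[of _ "2 * K"] ballI)
    fix f :: "circle \<Rightarrow> real" assume f: "f \<in> Holder_space \<alpha>"
    show "L f \<in> Holder_space \<alpha>" using K[OF hn[OF f]] by (rule holder_bound_imp_Holder_space)
    show "Holder_norm \<alpha> (L f) \<le> 2 * K * Holder_norm \<alpha> f"
      using Holder_norm_le[OF K[OF hn[OF f]]] by (simp add: mult.assoc)
  qed
  \<comment> \<open>The 2 compares the norm with \<open>holder_bound\<close>, and the maximum
    provides the required constant at least 1.\<close>
  moreover have "Holder_norm \<alpha> ((L ^^ t) f) \<le> max 1 (2 * M) * \<rho> ^ t * (1 - (1 - r)) ^ t * Holder_norm \<alpha> f"
    if f: "f \<in> Holder_space \<alpha>" and 0: "(\<integral>x. f x \<partial>\<nu>) = 0" for f t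
  proof -
    note b = hn[OF f]
    have "holder_bound \<alpha> (\<lambda>x. \<rho> ^ t * ((L ^^ t) f x / \<rho> ^ t)) (\<bar>\<rho> ^ t\<bar> * (M * r ^ t * Holder_norm \<alpha> f))"
      using gap_bound[OF b, of t] 0 by (intro holder_bound_scale) auto
    then have "holder_bound \<alpha> ((L ^^ t) f) (\<rho> ^ t * (M * r ^ t * Holder_norm \<alpha> f))"
      using rho_pos by simp
    then have "Holder_norm \<alpha> ((L ^^ t) f) \<le> 2 * (\<rho> ^ t * (M * r ^ t * Holder_norm \<alpha> f))"
      by (rule Holder_norm_le)
    also have "\<dots> = (2 * M) * (\<rho> ^ t * r ^ t * Holder_norm \<alpha> f)" by simp
    also have "\<dots> \<le> max 1 (2 * M) * (\<rho> ^ t * r ^ t * Holder_norm \<alpha> f)"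
      using rho_pos rate holder_boundD(3)[OF b] by (intro mult_right_mono) auto
    finally show ?thesis by (simp add: mult_ac)
  qed
  ultimately show ?thesis unfolding RPF_with_spectral_gap_def
    using RPF_triple_nu rate
    by (intro conjI exI[of _ h] exI[of _ \<rho>] exI[of _ \<nu>] exI[of _ "max 1 (2 * M)"] bexI[of _ "1 - r"])
      auto
qed

lemma ex_RPF_measure: "\<exists>\<mu>. RPF_measure (Holder_space \<alpha>) L \<mu>"
proof -
  obtain B where B: "holder_bound \<alpha> h B" using h_holder by blast
  obtain m where m: "0 < m" "\<And>x. m \<le> h x" using h_lower by blast
  define I where "I = (\<integral>x. h x \<partial>\<nu>)"
  have "(\<integral>x. m \<partial>\<nu>) \<le> I" unfolding I_def using m holder_integrable[OF B] by (intro integral_mono) auto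
  then have I: "0 < I" using m by (simp add: \<nu>.prob_space)
  define k where "k = (\<lambda>x. 1 / I * h x)"
  have k: "holder_bound \<alpha> k (\<bar>1 / I\<bar> * B)" unfolding k_def by (rule holder_bound_scale[OF B])
  have kpos: "0 < k x" for x using I h_pos[of x] by (simp add: k_def)
  have "L k x = \<rho> * k x" for x unfolding k_def transfer_op_scale L_h by simp
  then have "RPF_triple (Holder_space \<alpha>) L k \<rho> \<nu>"
    using RPF_triple_nu kpos holder_bound_imp_Holder_space[OF k] unfolding RPF_triple_def by blast
  moreover have "prob_space (density \<nu> (\<lambda>x. ennreal (k x)))"
  proof (rule prob_spaceI)
    have "emeasure (density \<nu> (\<lambda>x. ennreal (k x))) (space \<nu>) = (\<integral>\<^sup>+x. ennreal (k x) \<partial>\<nu>)"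
      using holder_measurable[OF k] by (auto simp: emeasure_density intro!: nn_integral_cong)
    also have "\<dots> = ennreal (\<integral>x. k x \<partial>\<nu>)"
      using holder_integrable[OF k] kpos by (intro nn_integral_eq_integral) (auto simp: less_imp_le)
    also have "(\<integral>x. k x \<partial>\<nu>) = 1" using I by (simp add: k_def I_def)
    finally show "emeasure (density \<nu> (\<lambda>x. ennreal (k x))) (space (density \<nu> (\<lambda>x. ennreal (k x)))) = 1"
      by simp
  qed
  ultimately show ?thesis unfolding RPF_measure_def by blast
qed

text \<open>
  Since \<open>L (f \<cdot> (g \<circ> T)) = L f \<cdot> g\<close>, the two sides integrate Lipschitz
  functions equally.
\<close>

lemma distr_T_density:
  assumes f: "holder_bound \<alpha> f N" and pos: "\<And>x. 0 \<le> f x"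
  shows "distr (density \<nu> (\<lambda>x. ennreal (f x))) borel T = density \<nu> (\<lambda>x. ennreal (L f x / \<rho>))"
proof -
  obtain K where Lf: "holder_bound \<alpha> (L f) (K * N)" using L_holder f by blast
  have Lpos: "0 \<le> L f x / \<rho>" for x
    unfolding transfer_op_def using pos rho_pos by (intro divide_nonneg_pos sum_nonneg) auto
  have Lf': "holder_bound \<alpha> (\<lambda>x. L f x / \<rho>) (\<bar>1 / \<rho>\<bar> * (K * N))"
    using holder_bound_scale[OF Lf, of "1 / \<rho>"] by simp
  have T: "T \<in> measurable (density \<nu> (\<lambda>x. ennreal (f x))) borel"
    using borel_measurable_T_qlog[OF q_pos] by (simp add: measurable_nu)
  show ?thesis
  proof (rule finite_measure_eqI_lipschitz)
    show "finite_measure (distr (density \<nu> (\<lambda>x. ennreal (f x))) borel T)"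
      using finite_measure_density[OF holder_integrable[OF f] pos] T by (rule finite_measure.finite_measure_distr)
    show "finite_measure (density \<nu> (\<lambda>x. ennreal (L f x / \<rho>)))"
      by (rule finite_measure_density[OF holder_integrable[OF Lf'] Lpos])
    show "sets (density \<nu> (\<lambda>x. ennreal (L f x / \<rho>))) = sets borel" by (simp add: sets_nu)
    fix g :: "circle \<Rightarrow> real" and B assume g: "holder_bound 1 g B"
    note gT = holder_bound_comp_T_qlog[OF q_pos alpha(2) g]
    have gm: "g \<in> borel_measurable borel" by (rule holder_bound_measurable[OF g]) simp
    have "(\<integral>x. g x \<partial>distr (density \<nu> (\<lambda>x. ennreal (f x))) borel T)
        = (\<integral>x. g (T x) \<partial>density \<nu> (\<lambda>x. ennreal (f x)))"
      by (rule integral_distr[OF T gm])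
    also have "\<dots> = (\<integral>x. f x * g (T x) \<partial>\<nu>)"
      using pos by (subst integral_density) (auto intro!: holder_measurable[OF f] holder_measurable[OF gT])
    also have "\<dots> = (\<integral>x. L (\<lambda>x. f x * g (T x)) x \<partial>\<nu>) / \<rho>"
      using eigenmeasure[OF holder_bound_mult[OF f gT]] rho_pos by simp
    also have "L (\<lambda>x. f x * g (T x)) = (\<lambda>x. L f x * g x)"
      by (auto simp: transfer_op_def sum_distrib_right mult.assoc intro!: sum.cong)
    also have "(\<integral>x. L f x * g x \<partial>\<nu>) / \<rho> = (\<integral>x. L f x / \<rho> * g x \<partial>\<nu>)" by simp
    also have "\<dots> = (\<integral>x. g x \<partial>density \<nu> (\<lambda>x. ennreal (L f x / \<rho>)))"
      using Lpos gm holder_measurable[OF Lf'] by (subst integral_density) (auto simp: measurable_nu)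
    finally show "(\<integral>x. g x \<partial>distr (density \<nu> (\<lambda>x. ennreal (f x))) borel T)
        = (\<integral>x. g x \<partial>density \<nu> (\<lambda>x. ennreal (L f x / \<rho>)))" .
  qed simp
qed

section \<open>Duality with composition by the map and decay\<close>

lemma integrable_holder_mult:
  assumes f: "holder_bound \<alpha> f N" and g: "integrable \<nu> g"
  shows "integrable \<nu> (\<lambda>x. f x * g x)"
proof (rule Bochner_Integration.integrable_bound)
  show "integrable \<nu> (\<lambda>x. N * g x)" using g by simp
  show "(\<lambda>x. f x * g x) \<in> borel_measurable \<nu>"
    using holder_measurable[OF f] g by (intro borel_measurable_times) auto
  show "AE x in \<nu>. norm (f x * g x) \<le> norm (N * g x)"
    using holder_boundD(1,3)[OF f] by (auto simp: abs_mult intro!: mult_right_mono)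
qed

text \<open>For \<open>f \<ge> 0\<close> both sides integrate \<open>g\<close> against the two
  measures identified in \<open>distr_T_density\<close>, which reaches every integrable
  \<open>g\<close>. A signed \<open>f\<close> is the difference of \<open>f + N\<close> and
  \<open>N\<close>.\<close>

lemma duality_step:
  assumes f: "holder_bound \<alpha> f N" and g: "integrable \<nu> g"
  shows "integrable \<nu> (\<lambda>x. f x * g (T x)) \<and> (\<integral>x. f x * g (T x) \<partial>\<nu>) = (\<integral>x. L f x * g x \<partial>\<nu>) / \<rho>"
proof -
  have gm: "g \<in> borel_measurable borel" using g measurable_nu by (metis borel_measurable_integrable)
  have gT: "(\<lambda>x. g (T x)) \<in> borel_measurable \<nu>"
    using measurable_compose[OF borel_measurable_T_qlog[OF q_pos] gm] by (simp add: measurable_nu)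
  have pos: "integrable \<nu> (\<lambda>x. f x * g (T x)) \<and> (\<integral>x. f x * g (T x) \<partial>\<nu>) = (\<integral>x. L f x * g x \<partial>\<nu>) / \<rho>"
    if f: "holder_bound \<alpha> f N" and f0: "\<And>x. 0 \<le> f x" for f N
  proof -
    obtain K where Lf: "holder_bound \<alpha> (L f) (K * N)" using L_holder f by blast
    have L0: "0 \<le> L f x / \<rho>" for x
      unfolding transfer_op_def using f0 rho_pos by (intro divide_nonneg_pos sum_nonneg) auto
    have Lf': "holder_bound \<alpha> (\<lambda>x. L f x / \<rho>) (\<bar>1 / \<rho>\<bar> * (K * N))"
      using holder_bound_scale[OF Lf, of "1 / \<rho>"] by simp
    have T: "T \<in> measurable (density \<nu> (\<lambda>x. ennreal (f x))) borel"
      using borel_measurable_T_qlog[OF q_pos] by (simp add: measurable_nu)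
    have g\<nu>: "g \<in> borel_measurable \<nu>" using g by blast
    have "integrable (density \<nu> (\<lambda>x. ennreal (L f x / \<rho>))) g"
      using L0 integrable_holder_mult[OF Lf' g] holder_measurable[OF Lf'] g\<nu> by (subst integrable_density) auto
    then have "integrable (density \<nu> (\<lambda>x. ennreal (f x))) (\<lambda>x. g (T x))"
      unfolding distr_T_density[OF f f0, symmetric] integrable_distr_eq[OF T gm] .
    then have "integrable \<nu> (\<lambda>x. f x * g (T x))"
      using f0 holder_measurable[OF f] gT by (subst (asm) integrable_density) auto
    moreover have "(\<integral>x. f x * g (T x) \<partial>\<nu>) = (\<integral>x. L f x * g x \<partial>\<nu>) / \<rho>"
    proof -
      have "(\<integral>x. f x * g (T x) \<partial>\<nu>) = (\<integral>x. g (T x) \<partial>density \<nu> (\<lambda>x. ennreal (f x)))"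
        using f0 holder_measurable[OF f] gT by (subst integral_density) auto
      also have "\<dots> = (\<integral>x. g x \<partial>density \<nu> (\<lambda>x. ennreal (L f x / \<rho>)))"
        unfolding distr_T_density[OF f f0, symmetric] by (rule integral_distr[OF T gm, symmetric])
      also have "\<dots> = (\<integral>x. L f x / \<rho> * g x \<partial>\<nu>)"
        using L0 holder_measurable[OF Lf'] g\<nu> by (subst integral_density) auto
      finally show ?thesis by simp
    qed
    ultimately show ?thesis by blast
  qed
  have N: "0 \<le> N" by (rule holder_boundD(3)[OF f])
  let ?f1 = "\<lambda>x. f x + N" and ?f2 = "\<lambda>x::circle. N"
  have b: "holder_bound \<alpha> ?f1 (N + N)" "holder_bound \<alpha> ?f2 N"
    using holder_bound_add[OF f holder_bound_const[OF N]] holder_bound_const[OF N] by auto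
  have nn: "0 \<le> f x + N" for x using holder_boundD(1)[OF f, of x] by linarith
  obtain K1 K2 where K: "holder_bound \<alpha> (L ?f1) (K1 * (N + N))" "holder_bound \<alpha> (L ?f2) (K2 * N)"
    using L_holder b by blast
  note p1 = pos[OF b(1) nn] and p2 = pos[OF b(2) N]
  have e1: "(\<lambda>x. f x * g (T x)) = (\<lambda>x. ?f1 x * g (T x) - ?f2 x * g (T x))" by (auto simp: algebra_simps)
  have "L f x = L ?f1 x - L ?f2 x" for x unfolding transfer_op_add by simp
  then have e2: "(\<lambda>x. L f x * g x) = (\<lambda>x. L ?f1 x * g x - L ?f2 x * g x)" by (auto simp: left_diff_distrib)
  have "integrable \<nu> (\<lambda>x. f x * g (T x))" unfolding e1 using p1 p2 by (intro Bochner_Integration.integrable_diff) auto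
  moreover have "(\<integral>x. f x * g (T x) \<partial>\<nu>) = (\<integral>x. ?f1 x * g (T x) \<partial>\<nu>) - (\<integral>x. ?f2 x * g (T x) \<partial>\<nu>)"
    unfolding e1 using p1 p2 by (intro Bochner_Integration.integral_diff) auto
  moreover have "(\<integral>x. L f x * g x \<partial>\<nu>) = (\<integral>x. L ?f1 x * g x \<partial>\<nu>) - (\<integral>x. L ?f2 x * g x \<partial>\<nu>)"
    unfolding e2 by (intro Bochner_Integration.integral_diff integrable_holder_mult[OF K(1) g] integrable_holder_mult[OF K(2) g])
  ultimately show ?thesis using p1 p2 by (simp add: diff_divide_distrib)
qed

lemma duality:
  assumes f: "holder_bound \<alpha> f N" and g: "integrable \<nu> g"
  shows "integrable \<nu> (\<lambda>x. f x * g ((T ^^ t) x))" (is "?I t f")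
    and "(\<integral>x. f x * g ((T ^^ t) x) \<partial>\<nu>) = (\<integral>x. (L ^^ t) f x / \<rho> ^ t * g x \<partial>\<nu>)" (is "?E t f")
proof -
  have "?I t f \<and> ?E t f"
    using f
  proof (induction t arbitrary: f N)
    case 0
    then show ?case using integrable_holder_mult[OF _ g] by auto
  next
    case (Suc t)
    obtain K where K: "holder_bound \<alpha> (L f) (K * N)" using L_holder Suc.prems by blast
    \<comment> \<open>The induction hypothesis for the constant 1 lets \<open>g\<close> composed
      with the iterate take the place of \<open>g\<close> in the single step.\<close>
    have "integrable \<nu> (\<lambda>x. g ((T ^^ t) x))"
      using Suc.IH[OF holder_bound_const[of 1]] by simp
    note * = duality_step[OF Suc.prems this]
    have "(\<integral>x. L f x * g ((T ^^ t) x) \<partial>\<nu>) / \<rho> = (\<integral>x. (L ^^ Suc t) f x / \<rho> ^ Suc t * g x \<partial>\<nu>)"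
    proof -
      have "(\<integral>x. L f x * g ((T ^^ t) x) \<partial>\<nu>) / \<rho> = (\<integral>x. (L ^^ t) (L f) x / \<rho> ^ t * g x / \<rho> \<partial>\<nu>)"
        using Suc.IH[OF K] by simp
      also have "(\<lambda>x. (L ^^ t) (L f) x / \<rho> ^ t * g x / \<rho>) = (\<lambda>x. (L ^^ Suc t) f x / \<rho> ^ Suc t * g x)"
        by (auto simp: funpow_swap1)
      finally show ?thesis .
    qed
    then show ?case using * by (simp add: funpow_swap1)
  qed
  then show "?I t f" "?E t f" by blast+
qed

text \<open>Centring \<open>f\<close> and multiplying by the density \<open>k\<close> gives a
  function of \<open>\<nu>\<close>-integral 0, for which the convergence bound has no leading term;
  \<open>duality\<close> moves the iterates of the map onto it.\<close>

lemma decay: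
  assumes k: "holder_bound \<alpha> k B" "0 < m" "\<And>x. m \<le> k x" "\<And>x. L k x = \<rho> * k x"
    and \<mu>: "\<mu> = density \<nu> (\<lambda>x. ennreal (k x))" "prob_space \<mu>"
    and a: "\<alpha> \<le> a"
  shows "\<exists>C>0. \<forall>f\<in>Holder_space a. \<forall>g. integrable \<mu> g \<longrightarrow> (\<forall>t::nat.
          \<bar>(\<integral>x. f x * g ((T ^^ t) x) \<partial>\<mu>) - (\<integral>x. f x \<partial>\<mu>) * (\<integral>x. g x \<partial>\<mu>)\<bar>
            \<le> C * r ^ t * Hol_const (power_modulus a) f * (\<integral>x. \<bar>g x\<bar> \<partial>\<mu>))"
proof -
  interpret \<mu>: prob_space \<mu> by fact
  have k0: "0 \<le> k x" "k x \<noteq> 0" for x using k(2) k(3)[of x] by auto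
  have sets_\<mu>: "sets \<mu> = sets borel" by (simp add: \<mu>(1) sets_nu)
  have meas_\<mu>: "measurable \<mu> N = measurable borel N" for N by (rule measurable_cong_sets[OF sets_\<mu> refl])
  have int_\<mu>: "(\<integral>x. f x \<partial>\<mu>) = (\<integral>x. k x * f x \<partial>\<nu>)" "integrable \<mu> f \<longleftrightarrow> integrable \<nu> (\<lambda>x. k x * f x)"
    if "f \<in> borel_measurable borel" for f :: "circle \<Rightarrow> real"
    using that k0 holder_measurable[OF k(1)] unfolding \<mu>(1)
    by (subst integral_density integrable_density; simp add: measurable_nu)+
  have Lk: "(L ^^ t) k x / \<rho> ^ t = k x" for t x
  proof (induction t arbitrary: x)
    case (Suc t)
    have "(L ^^ t) k = (\<lambda>x. \<rho> ^ t * k x)" using Suc rho_pos by (auto simp: field_simps)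
    then show ?case using rho_pos by (simp add: transfer_op_scale k(4))
  qed simp
  \<comment> \<open>\<open>2 * B\<close> comes from multiplying by \<open>k\<close>,
    \<open>M\<close> from the gap, and \<open>1 / m\<close> from passing from \<open>\<nu>\<close>
    back to \<open>\<mu>\<close>.\<close>
  define C where "C = 2 * B * M / m"
  have B: "0 < B" using holder_boundD(1)[OF k(1), of undefined] k(2) k(3)[of undefined] by linarith
  have C: "0 < C" using B rate k(2) by (simp add: C_def)
  have "\<bar>(\<integral>x. f x * g ((T ^^ t) x) \<partial>\<mu>) - (\<integral>x. f x \<partial>\<mu>) * (\<integral>x. g x \<partial>\<mu>)\<bar>
            \<le> C * r ^ t * Hol_const (power_modulus a) f * (\<integral>x. \<bar>g x\<bar> \<partial>\<mu>)"
    if f: "f \<in> Holder_space a" and g: "integrable \<mu> g" for f :: "circle \<Rightarrow> real" and g t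
  proof -
    define H where "H = Hol_const (power_modulus a) f"
    note Hb = Hol_const_nonneg_bound[OF f, folded H_def]
    have apos: "0 < a" using alpha(1) a by simp
    note fb = holder_bound_Holder_norm[OF f apos]
    have f\<alpha>: "holder_bound \<alpha> f (Holder_norm a f)" by (rule holder_bound_exponent[OF fb a])
    have f\<mu>: "integrable \<mu> f" by (rule holder_bound_integrable[OF \<mu>.finite_measure_axioms sets_\<mu> fb apos])
    have gb: "g \<in> borel_measurable borel" using g meas_\<mu> by (metis borel_measurable_integrable)
    \<comment> \<open>As \<open>1 / k\<close> is bounded, integrability with respect to
      \<open>\<mu>\<close> implies integrability with respect to \<open>\<nu>\<close>.\<close>
    obtain N' where kinv: "holder_bound \<alpha> (\<lambda>x. 1 / k x) N'" using holder_bound_inverse[OF k(1-3)] by blast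
    have "integrable \<nu> (\<lambda>x. 1 / k x * (k x * g x))"
      using integrable_holder_mult[OF kinv] g int_\<mu>(2)[OF gb] by blast
    then have g\<nu>: "integrable \<nu> g" using k0 by simp
    have gT: "(\<lambda>x. g ((T ^^ t) x)) \<in> borel_measurable borel"
    proof -
      have "T ^^ t \<in> measurable borel borel"
      proof (induction t)
        case (Suc t)
        then show ?case unfolding funpow.simps by (rule measurable_comp[OF _ borel_measurable_T_qlog[OF q_pos]])
      qed simp
      then show ?thesis using gb by (rule measurable_compose)
    qed
    define c where "c = (\<integral>x. f x \<partial>\<mu>)"
    define F where "F = (\<lambda>x. f x - c)"
    \<comment> \<open>After centring, the Hoelder constant alone also bounds the supremum, because
      the diameter is at most 1. Hence \<open>Hol_const\<close> rather than the full norm in the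
      result.\<close>
    have Fb: "holder_bound \<alpha> F H"
    proof (rule holder_bound_exponent[OF holder_boundI a])
      show "F x - F y \<le> H * dist x y powr a" for x y using Hb(2)[of x y] by (simp add: F_def)
      show "\<bar>F x\<bar> \<le> H" for x
      proof -
        have "\<bar>f x - f y\<bar> \<le> H" for y
          using Hb(2)[of x y] Hb(1) dist_circle_powr_le_1[OF apos, of x y] mult_left_mono[of "dist x y powr a" 1 H] by simp
        then have le: "f x - H \<le> f y" "f y \<le> f x + H" for y by (auto simp: abs_le_iff algebra_simps)
        have "(\<integral>y. f x - H \<partial>\<mu>) \<le> c" "c \<le> (\<integral>y. f x + H \<partial>\<mu>)"
          unfolding c_def using le f\<mu> by (intro integral_mono; simp)+
        then show ?thesis by (simp add: F_def \<mu>.prob_space)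
      qed
    qed
    define \<phi> where "\<phi> = (\<lambda>x. k x * F x)"
    have \<phi>: "holder_bound \<alpha> \<phi> (2 * B * H)" unfolding \<phi>_def by (rule holder_bound_mult[OF k(1) Fb])
    have \<phi>0: "(\<integral>x. \<phi> x \<partial>\<nu>) = 0"
    proof -
      have "(\<integral>x. \<phi> x \<partial>\<nu>) = (\<integral>x. F x \<partial>\<mu>)"
        unfolding \<phi>_def using holder_bound_measurable[OF Fb alpha(1)] by (rule int_\<mu>(1)[symmetric])
      also have "\<dots> = 0" unfolding F_def using f\<mu> by (simp add: c_def \<mu>.prob_space)
      finally show ?thesis .
    qed
    have kf: "holder_bound \<alpha> (\<lambda>x. k x * f x) (2 * B * Holder_norm a f)"
      by (rule holder_bound_mult[OF k(1) f\<alpha>])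
    have i1: "integrable \<nu> (\<lambda>x. k x * f x * g ((T ^^ t) x))" by (rule duality(1)[OF kf g\<nu>])
    have i2: "integrable \<nu> (\<lambda>x. k x * g ((T ^^ t) x))" by (rule duality(1)[OF k(1) g\<nu>])
    have "(\<integral>x. g x \<partial>\<mu>) = (\<integral>x. k x * g ((T ^^ t) x) \<partial>\<nu>)"
      using duality(2)[OF k(1) g\<nu>, of t] int_\<mu>(1)[OF gb] by (simp only: Lk)
    moreover have "(\<integral>x. f x * g ((T ^^ t) x) \<partial>\<mu>) = (\<integral>x. k x * f x * g ((T ^^ t) x) \<partial>\<nu>)"
      using int_\<mu>(1)[of "\<lambda>x. f x * g ((T ^^ t) x)"] holder_bound_measurable[OF f\<alpha> alpha(1)] gT
      by (simp add: mult.assoc)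
    moreover have "(\<integral>x. \<phi> x * g ((T ^^ t) x) \<partial>\<nu>)
        = (\<integral>x. k x * f x * g ((T ^^ t) x) \<partial>\<nu>) - c * (\<integral>x. k x * g ((T ^^ t) x) \<partial>\<nu>)"
    proof -
      have "(\<lambda>x. \<phi> x * g ((T ^^ t) x)) = (\<lambda>x. k x * f x * g ((T ^^ t) x) - c * (k x * g ((T ^^ t) x)))"
        by (auto simp: \<phi>_def F_def algebra_simps)
      then show ?thesis using i1 i2 by simp
    qed
    ultimately have eq: "(\<integral>x. f x * g ((T ^^ t) x) \<partial>\<mu>) - (\<integral>x. f x \<partial>\<mu>) * (\<integral>x. g x \<partial>\<mu>)
        = (\<integral>x. (L ^^ t) \<phi> x / \<rho> ^ t * g x \<partial>\<nu>)"
      using duality(2)[OF \<phi> g\<nu>, of t] by (simp add: c_def)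
    have Lb: "holder_bound \<alpha> (\<lambda>x. (L ^^ t) \<phi> x / \<rho> ^ t) (M * r ^ t * (2 * B * H))"
      using gap_bound[OF \<phi>, of t] by (simp add: \<phi>0)
    let ?D = "M * r ^ t * (2 * B * H)"
    have D: "0 \<le> ?D" by (rule holder_boundD(3)[OF Lb])
    have "\<bar>\<integral>x. (L ^^ t) \<phi> x / \<rho> ^ t * g x \<partial>\<nu>\<bar> \<le> (\<integral>x. \<bar>(L ^^ t) \<phi> x / \<rho> ^ t * g x\<bar> \<partial>\<nu>)"
      by (rule integral_abs_bound)
    also have "\<dots> \<le> (\<integral>x. ?D / m * (k x * \<bar>g x\<bar>) \<partial>\<nu>)"
    proof (rule integral_mono)
      show "integrable \<nu> (\<lambda>x. \<bar>(L ^^ t) \<phi> x / \<rho> ^ t * g x\<bar>)"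
        using integrable_holder_mult[OF Lb g\<nu>] by (rule integrable_abs)
      show "integrable \<nu> (\<lambda>x. ?D / m * (k x * \<bar>g x\<bar>))"
        by (intro integrable_mult_right integrable_holder_mult[OF k(1)] integrable_abs g\<nu>)
      fix x
      have "\<bar>(L ^^ t) \<phi> x / \<rho> ^ t * g x\<bar> \<le> ?D * \<bar>g x\<bar>"
        using holder_boundD(1)[OF Lb, of x] unfolding abs_mult by (intro mult_right_mono) auto
      also have "\<dots> = ?D / m * (m * \<bar>g x\<bar>)" using k(2) by simp
      also have "\<dots> \<le> ?D / m * (k x * \<bar>g x\<bar>)"
        using D k(2,3) by (intro mult_left_mono mult_right_mono divide_nonneg_pos) auto
      finally show "\<bar>(L ^^ t) \<phi> x / \<rho> ^ t * g x\<bar> \<le> ?D / m * (k x * \<bar>g x\<bar>)" .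
    qed
    also have "\<dots> = ?D / m * (\<integral>x. \<bar>g x\<bar> \<partial>\<mu>)"
      using int_\<mu>(1)[of "\<lambda>x. \<bar>g x\<bar>"] gb by simp
    also have "?D / m = C * r ^ t * H" by (simp add: C_def)
    finally show ?thesis unfolding eq H_def .
  qed
  then show ?thesis using C by blast
qed

text \<open>A triple on the smaller space is tested against the gap on the larger one. The powers of
  \<open>\<rho>' / \<rho>\<close> have a positive limit, so the ratio is 1. Integrating the
  normalised iterates of a Lipschitz \<open>f\<close> against \<open>\<nu>'\<close> gives a constant
  sequence, while the gap sends it to \<open>(\<integral>x. f x \<partial>\<nu>) * c\<close>;
  \<open>inv\<close> keeps the iterates where \<open>\<nu>'\<close> is known to be an
  eigenmeasure.\<close>

lemma RPF_triple_unique: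
  assumes \<beta>: "\<alpha> \<le> \<beta>" "\<beta> \<le> 1" and inv: "\<And>f. f \<in> Holder_space \<beta> \<Longrightarrow> L f \<in> Holder_space \<beta>"
    and R: "RPF_triple (Holder_space \<beta>) L h' \<rho>' \<nu>'"
  shows "\<rho>' = \<rho>" and "\<exists>c>0. \<nu>' = density \<nu> (\<lambda>x. ennreal c)"
proof -
  have \<beta>0: "0 < \<beta>" using \<beta> alpha by simp
  have h': "h' \<in> Holder_space \<beta>" "\<And>x. 0 < h' x" "0 < \<rho>'" "\<And>x. L h' x = \<rho>' * h' x"
    and \<nu>': "finite_measure \<nu>'" "sets \<nu>' = sets borel" "emeasure \<nu>' (space \<nu>') \<noteq> 0"
    and eig: "\<And>f. f \<in> Holder_space \<beta> \<Longrightarrow> (\<integral>x. L f x \<partial>\<nu>') = \<rho>' * (\<integral>x. f x \<partial>\<nu>')"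
    using R unfolding RPF_triple_def by auto
  interpret \<nu>': finite_measure \<nu>' by fact
  have h'b: "holder_bound \<alpha> h' (Holder_norm \<beta> h')"
    by (rule holder_bound_exponent[OF holder_bound_Holder_norm[OF h'(1) \<beta>0] \<beta>(1)])
  obtain m where m: "0 < m" "\<And>x. m \<le> h' x"
    using circle_positive_lower_bound[OF holder_bound_continuous[OF h'b alpha(1)] h'(2)] by blast
  have Lh': "(L ^^ n) h' x = \<rho>' ^ n * h' x" for n x
  proof (induction n arbitrary: x)
    case (Suc n)
    then have "(L ^^ n) h' = (\<lambda>x. \<rho>' ^ n * h' x)" by blast
    then show ?case by (simp add: transfer_op_scale h'(4))
  qed simp
  show \<rho>: "\<rho>' = \<rho>"
  proof -
    fix x
    have "(\<integral>y. m \<partial>\<nu>) \<le> (\<integral>y. h' y \<partial>\<nu>)" using m holder_integrable[OF h'b] by (intro integral_mono) auto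
    then have I: "0 < (\<integral>y. h' y \<partial>\<nu>)" using m by (simp add: \<nu>.prob_space)
    define l where "l = (\<integral>y. h' y \<partial>\<nu>) * h x / h' x"
    have l: "0 < l" using I h_pos[of x] h'(2)[of x] by (simp add: l_def)
    have "(\<lambda>n. (L ^^ n) h' x / \<rho> ^ n / h' x) \<longlonglongrightarrow> l"
      unfolding l_def using h'(2)[of x] by (intro tendsto_divide iterates_tendsto[OF h'b] tendsto_const) auto
    then have lim: "(\<lambda>n. (\<rho>' / \<rho>) ^ n) \<longlonglongrightarrow> l"
      using h'(2)[of x] by (simp add: Lh' power_divide less_imp_neq[symmetric])
    have "(\<lambda>n. (\<rho>' / \<rho>) * (\<rho>' / \<rho>) ^ n) \<longlonglongrightarrow> (\<rho>' / \<rho>) * l" by (intro tendsto_intros lim)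
    then have "(\<rho>' / \<rho>) * l = l" using LIMSEQ_Suc[OF lim] by (simp add: LIMSEQ_unique)
    then have "\<rho>' / \<rho> = 1" using l by (metis mult_cancel_right1 less_irrefl)
    then show ?thesis using l rho_pos by simp
  qed
  define c where "c = (\<integral>x. h x \<partial>\<nu>')"
  obtain B where hB: "holder_bound \<alpha> h B" using h_holder by blast
  have int': "integrable \<nu>' f" if "holder_bound \<alpha> f N" for f N
    by (rule holder_bound_integrable[OF \<nu>'(1,2) that alpha(1)])
  have main: "(\<integral>x. f x \<partial>\<nu>') = (\<integral>x. f x \<partial>\<nu>) * c" if f: "holder_bound 1 f N" for f N
  proof -
    have f\<beta>: "f \<in> Holder_space \<beta>" using holder_bound_exponent[OF f \<beta>(2)] by (rule holder_bound_imp_Holder_space)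
    have f\<alpha>: "holder_bound \<alpha> f N" using holder_bound_exponent[OF f alpha(2)] .
    have Ln: "(L ^^ n) f \<in> Holder_space \<beta>" for n using f\<beta> by (induction n) (auto intro: inv)
    have en: "(\<integral>x. (L ^^ n) f x \<partial>\<nu>') = \<rho> ^ n * (\<integral>x. f x \<partial>\<nu>')" for n
      by (induction n) (use eig[OF Ln] \<rho> in \<open>auto\<close>)
    define W where "W = measure \<nu>' (space \<nu>')"
    have "\<bar>(\<integral>x. f x \<partial>\<nu>') - (\<integral>x. f x \<partial>\<nu>) * c\<bar> \<le> M * r ^ n * N * W" for n
    proof -
      let ?u = "\<lambda>x. (L ^^ n) f x / \<rho> ^ n - (\<integral>y. f y \<partial>\<nu>) * h x"
      have u: "holder_bound \<alpha> ?u (M * r ^ n * N)" by (rule gap_bound[OF f\<alpha>])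
      have "integrable \<nu>' ((L ^^ n) f)"
        by (rule holder_bound_integrable[OF \<nu>'(1,2) holder_bound_Holder_norm[OF Ln \<beta>0] \<beta>0])
      then have "(\<integral>x. ?u x \<partial>\<nu>') = (\<integral>x. f x \<partial>\<nu>') - (\<integral>x. f x \<partial>\<nu>) * c"
        using int'[OF hB] rho_pos by (simp add: en c_def)
      moreover have "\<bar>\<integral>x. ?u x \<partial>\<nu>'\<bar> \<le> (\<integral>x. M * r ^ n * N \<partial>\<nu>')"
        using holder_boundD(1)[OF u] int'[OF u]
        by (intro order_trans[OF integral_abs_bound] integral_mono) auto
      ultimately show ?thesis by (simp add: W_def mult_ac)
    qed
    moreover have "(\<lambda>n. M * r ^ n * N * W) \<longlonglongrightarrow> 0"
      using rate by (intro tendsto_mult_left_zero tendsto_mult_right_zero LIMSEQ_realpow_zero) auto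
    ultimately have "\<bar>(\<integral>x. f x \<partial>\<nu>') - (\<integral>x. f x \<partial>\<nu>) * c\<bar> \<le> 0"
      by (intro LIMSEQ_le_const[where X = "\<lambda>n. M * r ^ n * N * W"]) auto
    then show ?thesis by simp
  qed
  have "measure \<nu>' (space \<nu>') = c"
    using main[OF holder_bound_const[of 1]] by (simp add: \<nu>.prob_space)
  then have c: "0 < c" using \<nu>'(3) measure_nonneg[of \<nu>' "space \<nu>'"]
    by (auto simp: \<nu>'.emeasure_eq_measure less_le)
  have "\<nu>' = density \<nu> (\<lambda>x. ennreal c)"
  proof (rule finite_measure_eqI_lipschitz[OF \<nu>'(1,2)])
    show "finite_measure (density \<nu> (\<lambda>x. ennreal c))" using c by (intro finite_measure_density) auto
    show "sets (density \<nu> (\<lambda>x. ennreal c)) = sets borel" by (simp add: sets_nu)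
    fix f :: "circle \<Rightarrow> real" and N assume f: "holder_bound 1 f N"
    have "f \<in> borel_measurable \<nu>" by (rule holder_measurable[OF holder_bound_exponent[OF f alpha(2)]])
    then show "(\<integral>x. f x \<partial>\<nu>') = (\<integral>x. f x \<partial>density \<nu> (\<lambda>x. ennreal c))"
      using c by (subst integral_density) (auto simp: main[OF f])
  qed
  then show "\<exists>c>0. \<nu>' = density \<nu> (\<lambda>x. ennreal c)" using c by blast
qed

end

lemma ex_gap_measure:
  assumes "0 < q" "0 < \<alpha>" "\<alpha> \<le> 1" "log_regular q \<alpha> A C"
  shows "\<exists>h \<rho> \<nu> M r. gap_measure q \<alpha> A h \<rho> \<nu> M r"
  using ex_geometric_convergence[OF assms(1,2,4)] assms(1-3) by (simp add: gap_measure_def)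

lemma exp_decay_of_correlations_RPF_measure:
  assumes q: "0 < q" and \<alpha>: "0 < \<alpha>" "\<alpha> \<le> 1" and A: "log_regular q \<alpha> A C"
    and \<mu>: "RPF_measure (Holder_space \<alpha>) (transfer_op (T_qlog q) A) \<mu>"
  shows "exp_decay_of_correlations (T_qlog q) \<mu>"
  unfolding exp_decay_of_correlations_def
proof
  fix a :: real assume a: "a \<in> {0<..1}"
  \<comment> \<open>The data at the exponent \<open>\<alpha>\<close> show that the operator
    preserves \<open>Holder_space \<alpha>\<close>, as required for uniqueness.\<close>
  obtain h0 \<rho>0 \<nu>0 M0 r0 where "gap_measure q \<alpha> A h0 \<rho>0 \<nu>0 M0 r0"
    using ex_gap_measure[OF q \<alpha> A] by blast
  then interpret G0: gap_measure q \<alpha> A h0 \<rho>0 \<nu>0 M0 r0 .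
  define \<beta> where "\<beta> = min a \<alpha>"
  have \<beta>: "0 < \<beta>" "\<beta> \<le> 1" "\<beta> \<le> \<alpha>" "\<beta> \<le> a" using a \<alpha> by (auto simp: \<beta>_def)
  obtain h \<rho> \<nu> M r where "gap_measure q \<beta> A h \<rho> \<nu> M r"
    using ex_gap_measure[OF q \<beta>(1,2) log_regular_exponent[OF A \<beta>(3)]] by blast
  then interpret G: gap_measure q \<beta> A h \<rho> \<nu> M r .
  obtain h' \<rho>' \<nu>' where R: "RPF_triple (Holder_space \<alpha>) G.L h' \<rho>' \<nu>'"
    and \<mu>': "\<mu> = density \<nu>' (\<lambda>x. ennreal (h' x))" "prob_space \<mu>"
    using \<mu> unfolding RPF_measure_def by blast
  have inv: "G.L f \<in> Holder_space \<alpha>" if "f \<in> Holder_space \<alpha>" for f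
    using G0.RPF_with_spectral_gap_T_qlog that
    unfolding RPF_with_spectral_gap_def acts_continuously_def by blast
  note unique = G.RPF_triple_unique[OF \<beta>(3) \<alpha>(2) inv R]
  obtain c where c: "0 < c" "\<nu>' = density \<nu> (\<lambda>x. ennreal c)" using unique(2) by blast
  have h': "h' \<in> Holder_space \<alpha>" "\<And>x. 0 < h' x" "\<And>x. G.L h' x = \<rho> * h' x"
    using R unique(1) unfolding RPF_triple_def by auto
  note h'b = holder_bound_Holder_norm[OF h'(1) \<alpha>(1)]
  \<comment> \<open>The factor between the eigenmeasures moves into the eigenfunction, so that
    \<open>\<mu>\<close> has density \<open>k\<close> with respect to \<open>\<nu>\<close>.\<close>
  define k where "k = (\<lambda>x. c * h' x)"
  have k: "holder_bound \<beta> k (\<bar>c\<bar> * Holder_norm \<alpha> h')"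
    unfolding k_def by (rule holder_bound_exponent[OF holder_bound_scale[OF h'b] \<beta>(3)])
  have kpos: "0 < k x" for x using c(1) h'(2) by (simp add: k_def)
  obtain m where m: "0 < m" "\<And>x. m \<le> k x"
    using circle_positive_lower_bound[OF holder_bound_continuous[OF k \<beta>(1)] kpos] by blast
  have Lk: "G.L k x = \<rho> * k x" for x unfolding k_def by (simp add: transfer_op_scale h'(3))
  have "\<mu> = density \<nu> (\<lambda>x. ennreal c * ennreal (h' x))"
    unfolding \<mu>'(1) c(2)
    by (intro density_density_eq)
      (auto simp: G.measurable_nu intro: measurable_compose[OF holder_bound_measurable[OF h'b \<alpha>(1)]])
  then have "\<mu> = density \<nu> (\<lambda>x. ennreal (k x))"
    using c(1) h'(2) by (simp add: k_def ennreal_mult less_imp_le)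
  then obtain C where "0 < C" "\<forall>f\<in>Holder_space a. \<forall>g. integrable \<mu> g \<longrightarrow> (\<forall>t::nat.
          \<bar>(\<integral>x. f x * g ((T_qlog q ^^ t) x) \<partial>\<mu>) - (\<integral>x. f x \<partial>\<mu>) * (\<integral>x. g x \<partial>\<mu>)\<bar>
            \<le> C * r ^ t * Hol_const (power_modulus a) f * (\<integral>x. \<bar>g x\<bar> \<partial>\<mu>))"
    using G.decay[OF k m Lk _ \<mu>'(2) \<beta>(4)] by blast
  then show "\<exists>C>0. \<exists>\<delta>\<in>{0<..<1}. \<forall>f\<in>Holder_space a. \<forall>g. integrable \<mu> g \<longrightarrow> (\<forall>t::nat.
          \<bar>(\<integral>x. f x * g ((T_qlog q ^^ t) x) \<partial>\<mu>) - (\<integral>x. f x \<partial>\<mu>) * (\<integral>x. g x \<partial>\<mu>)\<bar>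
            \<le> C * (1 - \<delta>) ^ t * Hol_const (power_modulus a) f * (\<integral>x. \<bar>g x\<bar> \<partial>\<mu>))"
    using G.rate by (intro exI[of _ C] conjI bexI[of _ "1 - r"]) auto
qed

text \<open>For Hoelder \<open>A\<close> the existence clause keeps the decay clause from being
  vacuous, and decay is claimed for every admissible exponent and every RPF measure.\<close>

theorem theorem2:
  fixes q :: real
  assumes "q > 0"
  shows "(\<forall>\<alpha>\<in>{0<..<1}. \<forall>A \<in> log_Holder_space \<alpha> q.
            RPF_with_spectral_gap (Holder_space \<alpha>) (Holder_norm \<alpha>) (transfer_op (T_qlog q) A))
       \<and> (\<forall>\<gamma>\<in>{0<..1}. \<forall>A \<in> Holder_space \<gamma>.
            (\<exists>\<alpha>\<in>{0<..<1}. A \<in> log_Holder_space \<alpha> q \<and>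
               (\<exists>\<mu>. RPF_measure (Holder_space \<alpha>) (transfer_op (T_qlog q) A) \<mu>))
          \<and> (\<forall>\<alpha>\<in>{0<..<1}. A \<in> log_Holder_space \<alpha> q \<longrightarrow>
               (\<forall>\<mu>. RPF_measure (Holder_space \<alpha>) (transfer_op (T_qlog q) A) \<mu> \<longrightarrow>
                  exp_decay_of_correlations (T_qlog q) \<mu>)))"
proof (intro conjI ballI impI allI)
  fix \<alpha> and A :: "circle \<Rightarrow> real"
  assume \<alpha>: "\<alpha> \<in> {0<..<1::real}" and A: "A \<in> log_Holder_space \<alpha> q"
  obtain C where C: "log_regular q \<alpha> A C" using log_regular_log_Holder_space[OF assms A] by blast
  then obtain h \<rho> \<nu> M r where "gap_measure q \<alpha> A h \<rho> \<nu> M r"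
    using ex_gap_measure[OF assms _ _ C] \<alpha> by auto
  then show "RPF_with_spectral_gap (Holder_space \<alpha>) (Holder_norm \<alpha>) (transfer_op (T_qlog q) A)"
    by (rule gap_measure.RPF_with_spectral_gap_T_qlog)
next
  fix \<gamma> and A :: "circle \<Rightarrow> real"
  assume \<gamma>: "\<gamma> \<in> {0<..1::real}" and A: "A \<in> Holder_space \<gamma>"
  \<comment> \<open>The embedding needs an exponent strictly below \<open>\<gamma>\<close>; half of
    \<open>\<gamma>\<close> is also below 1.\<close>
  define \<alpha> where "\<alpha> = \<gamma> / 2"
  have \<alpha>: "0 < \<alpha>" "\<alpha> < 1" "\<alpha> < \<gamma>" using \<gamma> by (auto simp: \<alpha>_def)
  have A': "A \<in> log_Holder_space \<alpha> q" by (rule Holder_space_subset_log_Holder_space[OF \<alpha> assms A])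
  obtain C where C: "log_regular q \<alpha> A C" using log_regular_log_Holder_space[OF assms A'] by blast
  obtain h \<rho> \<nu> M r where "gap_measure q \<alpha> A h \<rho> \<nu> M r"
    using ex_gap_measure[OF assms _ _ C] \<alpha> by auto
  then have "\<exists>\<mu>. RPF_measure (Holder_space \<alpha>) (transfer_op (T_qlog q) A) \<mu>"
    by (rule gap_measure.ex_RPF_measure)
  then show "\<exists>\<alpha>\<in>{0<..<1}. A \<in> log_Holder_space \<alpha> q \<and>
      (\<exists>\<mu>. RPF_measure (Holder_space \<alpha>) (transfer_op (T_qlog q) A) \<mu>)"
    using A' \<alpha> by auto
next
  fix \<gamma> A \<alpha> \<mu> assume \<alpha>: "\<alpha> \<in> {0<..<1::real}" and A: "A \<in> log_Holder_space \<alpha> q"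
    and \<mu>: "RPF_measure (Holder_space \<alpha>) (transfer_op (T_qlog q) A) \<mu>"
  obtain C where C: "log_regular q \<alpha> A C" using log_regular_log_Holder_space[OF assms A] by blast
  then show "exp_decay_of_correlations (T_qlog q) \<mu>"
    using exp_decay_of_correlations_RPF_measure[OF assms _ _ C \<mu>] \<alpha> by auto
qed

end
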